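(* Let $\eta_0,\tilde\eta_0\in\mathcal P(\mathbb T^d)$, and for $\gamma\in(0,\gamma_0]$ let $(\eta_n)_{n\in\mathbb N}$ and $(\tilde\eta_n)_{n\in\mathbb N}$ be defined by $\eta_{n+1}=\eta_nQ_{\eta_n}$ and $\tilde\eta_{n+1}=\tilde\eta_nQ_{\tilde\eta_n}$. Then for all $m\in\mathbb N$ and all $\gamma\in(0,\gamma_0]$, $$\mathcal W_\rho(\eta_m,\tilde\eta_m)\leqslant(1-\gamma\kappa_\gamma)^m\,\mathcal W_\rho(\eta_0,\tilde\eta_0).$$
   Context: $\mathbb T^d=\mathbb R^d/\mathbb Z^d$ is the flat torus with Euclidean distance $|x-y|$; $b\in\mathcal C^1(\mathbb T^d)$ is an $\mathbb R^d$-valued drift; $\lambda:\mathbb T^d\to[0,\infty)$ is Lipschitz with constant $L_\lambda$ (standing assumption). $\mathcal P(F)$ is the set of Borel probability measures on $F$; $\mathcal W_\rho(\mu,\nu)=\inf\{\mathbb E(\rho(X,Y)):X\sim\mu,\ Y\sim\nu\}$ for a distance $\rho$. $\mathbb N=\{0,1,\dots\}$. For $\gamma>0$, $K$ is the Markov kernel on $\mathbb T^d$ given by $Kf(x)=(2\pi)^{-d/2}\int_{\mathbb R^d}f(x+\gamma b(x)+\sqrt\gamma y)e^{-|y|^2/2}dy$, and $p(z)=1-e^{-\gamma\lambda(z)}$. For $\mu\in\mathcal P(\mathbb T^d)$, $Q_\mu(x,\cdot)$ is the law of $X_H$, where $(X_k,U_k)_{k\in\mathbb N}$ are independent random variables with,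 for every $k$, $X_k$ and $U_k$ independent, $U_k$ uniform on $[0,1]$, $X_0\sim K(x,\cdot)$, $X_k\sim\mu K$ for $k\geqslant1$, and $H=\inf\{k\in\mathbb N:U_k\geqslant p(X_k)\}$. For $x\in\mathbb T^{dN}$, $\pi(x)=\frac1N\sum_{i=1}^N\delta_{x_i}$ and $R_{N,\gamma}(x,\cdot)=Q_{\pi(x)}(x_1,\cdot)\otimes\cdots\otimes Q_{\pi(x)}(x_N,\cdot)$. Constants (fixed throughout, such constants exist): $c_1,a,\gamma_0>0$ depend only on $b$ and $d$ and are such that, with the metric $\rho(x,y)=(1-e^{-a|x-y|})/a$ on $\mathbb T^d$, $\mathcal W_\rho(\mu K,\nu K)\leqslant(1-c_1\gamma)\mathcal W_\rho(\mu,\nu)$ for all $\gamma\in(0,\gamma_0]$ and $\mu,\nu\in\mathcal P(\mathbb T^d)$; $c_2>0$ depends only on $b$ and $d$ and is such that, with $\kappa_\gamma=c_1-c_2L_\lambda e^{\gamma\|\lambda\|_\infty}$ (not assumed positive) and $\rho_N(x,y)=\sum_{i=1}^N\rho(x_i,y_i)$, one has $\mathcal W_{\rho_N}(\mu R_{N,\gamma},\nu R_{N,\gamma})\leqslant(1-\gamma\kappa_\gamma)\mathcal W_{\rho_N}(\mu,\nu)$ for all $\gamma\in(0,\gamma_0]$, $N\geqslant1$ and $\mu,\nu\in\mathcal P(\mathbb T^{dN})$. *)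

theory Defs
  imports "HOL-Probability.Probability"
begin

text \<open>The index type \<open>'n\<close> has as many elements as the torus has dimensions.\<close>

definition int_diff :: "real ^ 'n \<Rightarrow> real ^ 'n \<Rightarrow> bool" where
  "int_diff v w \<longleftrightarrow> (\<forall>i. v $ i - w $ i \<in> \<int>)"

lemma equivp_int_diff: "equivp (int_diff :: real ^ 'n \<Rightarrow> real ^ 'n \<Rightarrow> bool)"
proof (rule equivpI)
  show "reflp (int_diff :: real ^ 'n \<Rightarrow> real ^ 'n \<Rightarrow> bool)"
    by (auto simp: reflp_def int_diff_def)
  show "symp (int_diff :: real ^ 'n \<Rightarrow> real ^ 'n \<Rightarrow> bool)"
    unfolding symp_def int_diff_def by (metis Ints_minus minus_diff_eq)
  show "transp (int_diff :: real ^ 'n \<Rightarrow> real ^ 'n \<Rightarrow> bool)"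
    unfolding transp_def int_diff_def
  proof (intro allI impI)
    fix x y z :: "real ^ 'n" and i
    assume "\<forall>i. x $ i - y $ i \<in> \<int>" "\<forall>i. y $ i - z $ i \<in> \<int>"
    then have "(x $ i - y $ i) + (y $ i - z $ i) \<in> \<int>" by (intro Ints_add) auto
    then show "x $ i - z $ i \<in> \<int>" by simp
  qed
qed

quotient_type 'n torus = "real ^ 'n" / int_diff
  morphisms rep_torus to_torus
  by (rule equivp_int_diff)

lemma to_torus_eq_iff: "to_torus v = to_torus w \<longleftrightarrow> (\<forall>i. v $ i - w $ i \<in> \<int>)"
  using torus.abs_eq_iff[of v w] by (simp add: int_diff_def)

lemma to_torus_cases: obtains v where "x = to_torus v"
  using torus.abs_induct[of "\<lambda>x. \<exists>v. x = to_torus v" x] by blast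

instantiation torus :: (finite) ab_group_add
begin

lift_definition zero_torus :: "'a torus" is 0 .

lift_definition plus_torus :: "'a torus \<Rightarrow> 'a torus \<Rightarrow> 'a torus" is "(+)"
  unfolding int_diff_def
proof (intro allI)
  fix u v w x :: "real ^ 'a" and i
  assume "\<forall>i. u $ i - v $ i \<in> \<int>" "\<forall>i. w $ i - x $ i \<in> \<int>"
  then have "(u $ i - v $ i) + (w $ i - x $ i) \<in> \<int>" by (intro Ints_add) auto
  then show "(u + w) $ i - (v + x) $ i \<in> \<int>" by (simp add: algebra_simps)
qed

lift_definition uminus_torus :: "'a torus \<Rightarrow> 'a torus" is uminus
  unfolding int_diff_def
proof (intro allI)
  fix u v :: "real ^ 'a" and i
  assume "\<forall>i. u $ i - v $ i \<in> \<int>"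
  then have "- (u $ i - v $ i) \<in> \<int>" by (intro Ints_minus) auto
  then show "(- u) $ i - (- v) $ i \<in> \<int>" by simp
qed

definition minus_torus :: "'a torus \<Rightarrow> 'a torus \<Rightarrow> 'a torus" where
  "minus_torus x y = x + (- y)"

instance
proof
  fix x y z :: "'a torus"
  have refl: "int_diff v v" for v :: "real ^ 'a"
    by (simp add: int_diff_def)
  show "x + y + z = x + (y + z)" by transfer (simp add: add.assoc refl)
  show "x + y = y + x" by transfer (simp add: add.commute refl)
  show "0 + x = x" by transfer (simp add: refl)
  show "- x + x = 0" by transfer (simp add: refl)
  show "x - y = x + - y" by (rule minus_torus_def)
qed

end

lemma to_torus_add: "to_torus (v + w) = to_torus v + to_torus w"
  by (simp add: plus_torus.abs_eq)

lemma to_torus_minus: "to_torus (- v) = - to_torus v"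
  by (simp add: uminus_torus.abs_eq)

lemma to_torus_zero: "to_torus 0 = 0"
  by (simp add: zero_torus_def)

text \<open>The distance is the quotient of the Euclidean one: the smallest norm of a vector
  representing the difference.\<close>

instantiation torus :: (finite) metric_space
begin

definition dist_torus :: "'a torus \<Rightarrow> 'a torus \<Rightarrow> real" where
  "dist_torus x y = (INF v\<in>{v. to_torus v = x - y}. norm v)"

definition uniformity_torus :: "('a torus \<times> 'a torus) filter" where
  "uniformity_torus = (INF e\<in>{0 <..}. principal {(x, y). dist x y < e})"

definition open_torus :: "'a torus set \<Rightarrow> bool" where
  "open_torus U \<longleftrightarrow> (\<forall>x\<in>U. eventually (\<lambda>(x', y). x' = x \<longrightarrow> y \<in> U) uniformity)"

instance
proof
  have ne: "{v. to_torus v = x} \<noteq> {}" for x :: "'a torus"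
    using to_torus_cases[of x] by auto
  have bdd: "bdd_below (norm ` S)" for S :: "(real ^ 'a) set"
    by (rule bdd_belowI[of _ 0]) auto
  have le: "dist (x :: 'a torus) y \<le> norm v" if "to_torus v = x - y" for x y v
    unfolding dist_torus_def using that by (intro cINF_lower bdd) auto
  have approx: "\<exists>v. to_torus v = x - y \<and> norm v < e" if "dist (x :: 'a torus) y < e" for x y e
    using that cINF_less_iff[OF ne bdd, of "x - y" e] unfolding dist_torus_def by auto
  fix x y z :: "'a torus"
  show "uniformity = (INF e\<in>{0 <..}. principal {(x, y). dist (x :: 'a torus) y < e})"
    by (rule uniformity_torus_def)
  show "open U = (\<forall>x\<in>U. \<forall>\<^sub>F (x', y) in uniformity. x' = x \<longrightarrow> y \<in> U)" for U :: "'a torus set"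
    by (rule open_torus_def)
  have nonneg: "0 \<le> dist x y"
    unfolding dist_torus_def by (rule cINF_greatest[OF ne]) simp
  show "dist x y = 0 \<longleftrightarrow> x = y"
  proof
    assume "x = y"
    then have "dist x y \<le> norm (0 :: real ^ 'a)"
      by (intro le) (simp add: to_torus_zero)
    then show "dist x y = 0" using nonneg by simp
  next
    assume d: "dist x y = 0"
    obtain v where v: "to_torus v = x - y" "norm v < 1 / 2"
      using approx[of x y "1 / 2"] d by auto
    have "v = 0"
    proof (rule ccontr)
      assume "v \<noteq> 0"
      then obtain w where w: "to_torus w = x - y" "norm w < norm v"
        using approx[of x y "norm v"] d by auto
      have "v $ i = w $ i" for i
      proof -
        have "v $ i - w $ i \<in> \<int>"
          using v(1) w(1) to_torus_eq_iff[of v w] by simp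
        moreover have "\<bar>v $ i - w $ i\<bar> < 1"
          using v(2) w(2) component_le_norm_cart[of v i] component_le_norm_cart[of w i] by linarith
        ultimately show ?thesis
          using Ints_nonzero_abs_less1 by fastforce
      qed
      then have "v = w" by (simp add: vec_eq_iff)
      then show False using w(2) by simp
    qed
    then show "x = y" using v(1) by (simp add: to_torus_zero)
  qed
  have sym: "dist p q \<le> dist q (p :: 'a torus)" for p q
    unfolding dist_torus_def[of q p]
  proof (rule cINF_greatest[OF ne])
    fix v assume "v \<in> {v. to_torus v = q - p}"
    then have "to_torus (- v) = p - q" by (simp add: to_torus_minus)
    from le[OF this] show "dist p q \<le> norm v" by simp
  qed
  show "dist x y \<le> dist x z + dist y z"
  proof (rule field_le_epsilon)
    fix e :: real assume e: "e > 0"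
    obtain v where v: "to_torus v = x - z" "norm v < dist x z + e / 2"
      using approx[of x z "dist x z + e / 2"] e by auto
    obtain w where w: "to_torus w = z - y" "norm w < dist z y + e / 2"
      using approx[of z y "dist z y + e / 2"] e by auto
    have "dist x y \<le> norm (v + w)"
      by (rule le) (simp add: to_torus_add v w)
    also have "\<dots> \<le> norm v + norm w" by (rule norm_triangle_ineq)
    finally show "dist x y \<le> dist x z + dist y z + e"
      using v(2) w(2) sym[of z y] by linarith
  qed
qed

end

text \<open>A map on the torus is of class \<open>C\<^sup>1\<close> iff its periodic lift is.\<close>

definition C1_torus :: "('d::finite torus \<Rightarrow> real ^ 'd) \<Rightarrow> bool" where
  "C1_torus b \<longleftrightarrow> (\<exists>D :: real ^ 'd \<Rightarrow> (real ^ 'd) \<Rightarrow>\<^sub>L (real ^ 'd).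
     (\<forall>v. ((\<lambda>w. b (to_torus w)) has_derivative blinfun_apply (D v)) (at v)) \<and>
     continuous_on UNIV D)"

definition couplings :: "'a measure \<Rightarrow> 'a measure \<Rightarrow> 'a measure \<Rightarrow> ('a \<times> 'a) measure set" where
  "couplings M \<mu> \<nu> = {P \<in> space (prob_algebra (M \<Otimes>\<^sub>M M)). distr P M fst = \<mu> \<and> distr P M snd = \<nu>}"

text \<open>The Bochner integral is the expectation only for integrable costs; the costs below
  (\<open>rho\<close> and its finite sums) are bounded and measurable.\<close>

definition wasserstein :: "'a measure \<Rightarrow> ('a \<Rightarrow> 'a \<Rightarrow> real) \<Rightarrow> 'a measure \<Rightarrow> 'a measure \<Rightarrow> real" where
  "wasserstein M r \<mu> \<nu> = (INF P\<in>couplings M \<mu> \<nu>. \<integral>z. r (fst z) (snd z) \<partial>P)"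

definition rho :: "real \<Rightarrow> 'd::finite torus \<Rightarrow> 'd torus \<Rightarrow> real" where
  "rho a x y = (1 - exp (- a * dist x y)) / a"

text \<open>A configuration of \<open>N\<close> particles is an element of \<open>\<Pi>\<^sub>E i\<in>{..<N}. UNIV\<close>.\<close>

definition rhoN :: "real \<Rightarrow> nat \<Rightarrow> (nat \<Rightarrow> 'd::finite torus) \<Rightarrow> (nat \<Rightarrow> 'd torus) \<Rightarrow> real" where
  "rhoN a N x y = (\<Sum>i<N. rho a (x i) (y i))"

abbreviation config_space :: "nat \<Rightarrow> (nat \<Rightarrow> 'd::finite torus) measure" where
  "config_space N \<equiv> PiM {..<N} (\<lambda>_. borel)"

definition std_gaussian :: "(real ^ 'd::finite) measure" where
  "std_gaussian = density lborel
     (\<lambda>y. ennreal ((2 * pi) powr (- real CARD('d) / 2) * exp (- (norm y)\<^sup>2 / 2)))"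

definition K :: "real \<Rightarrow> ('d::finite torus \<Rightarrow> real ^ 'd) \<Rightarrow> 'd torus \<Rightarrow> 'd torus measure" where
  "K \<gamma> b x = distr std_gaussian borel (\<lambda>y. x + to_torus (\<gamma> *\<^sub>R b x + sqrt \<gamma> *\<^sub>R y))"

definition death_prob :: "real \<Rightarrow> ('d::finite torus \<Rightarrow> real) \<Rightarrow> 'd torus \<Rightarrow> real" where
  "death_prob \<gamma> l z = 1 - exp (- \<gamma> * l z)"

text \<open>The canonical space carrying the independent pairs \<open>(X\<^sub>k, U\<^sub>k)\<close>.\<close>

definition trials ::
  "real \<Rightarrow> ('d::finite torus \<Rightarrow> real ^ 'd) \<Rightarrow> 'd torus measure \<Rightarrow> 'd torus \<Rightarrow>
     (nat \<Rightarrow> 'd torus \<times> real) measure" where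
  "trials \<gamma> b \<mu> x = PiM UNIV
     (\<lambda>k. (if k = 0 then K \<gamma> b x else \<mu> \<bind> K \<gamma> b) \<Otimes>\<^sub>M uniform_measure lborel {0..1})"

text \<open>The infimum is over an empty set, hence a fixed but unspecified number, only on a null event.\<close>

definition survivor :: "real \<Rightarrow> ('d::finite torus \<Rightarrow> real) \<Rightarrow> (nat \<Rightarrow> 'd torus \<times> real) \<Rightarrow> nat" where
  "survivor \<gamma> l \<omega> = Inf {k. snd (\<omega> k) \<ge> death_prob \<gamma> l (fst (\<omega> k))}"

definition Q ::
  "real \<Rightarrow> ('d::finite torus \<Rightarrow> real ^ 'd) \<Rightarrow> ('d torus \<Rightarrow> real) \<Rightarrow> 'd torus measure \<Rightarrow>
     'd torus \<Rightarrow> 'd torus measure" where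
  "Q \<gamma> b l \<mu> x = distr (trials \<gamma> b \<mu> x) borel (\<lambda>\<omega>. fst (\<omega> (survivor \<gamma> l \<omega>)))"

text \<open>The image of the uniform distribution on the labels; for \<open>N \<ge> 1\<close> it is
  \<open>1/N\<close> times the sum of the Dirac masses at the \<open>x i\<close>.\<close>

definition empirical :: "nat \<Rightarrow> (nat \<Rightarrow> 'd::finite torus) \<Rightarrow> 'd torus measure" where
  "empirical N x = distr (uniform_count_measure {..<N}) borel x"

lemma emeasure_empirical:
  assumes "N \<ge> 1" "A \<in> sets borel"
  shows "emeasure (empirical N x) A = ennreal ((\<Sum>i<N. indicator A (x i)) / real N)"
proof -
  have "emeasure (empirical N x) A = emeasure (uniform_count_measure {..<N}) {i\<in>{..<N}. x i \<in> A}"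
    unfolding empirical_def using assms
    by (subst emeasure_distr) (auto simp: space_uniform_count_measure sets_uniform_count_measure
        measurable_def intro!: arg_cong[where f="emeasure _"])
  also have "\<dots> = ennreal (card {i\<in>{..<N}. x i \<in> A} / real N)"
    by (subst emeasure_uniform_count_measure) auto
  also have "real (card {i\<in>{..<N}. x i \<in> A}) = (\<Sum>i<N. indicator A (x i))"
    by (simp add: indicator_def sum.If_cases Int_def)
  finally show ?thesis .
qed

definition R ::
  "nat \<Rightarrow> real \<Rightarrow> ('d::finite torus \<Rightarrow> real ^ 'd) \<Rightarrow> ('d torus \<Rightarrow> real) \<Rightarrow>
     (nat \<Rightarrow> 'd torus) \<Rightarrow> (nat \<Rightarrow> 'd torus) measure" where
  "R N \<gamma> b l x = PiM {..<N} (\<lambda>i. Q \<gamma> b l (empirical N x) (x i))"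

primrec nonlinear_flow ::
  "real \<Rightarrow> ('d::finite torus \<Rightarrow> real ^ 'd) \<Rightarrow> ('d torus \<Rightarrow> real) \<Rightarrow> 'd torus measure \<Rightarrow>
     nat \<Rightarrow> 'd torus measure" where
  "nonlinear_flow \<gamma> b l \<eta> 0 = \<eta>"
| "nonlinear_flow \<gamma> b l \<eta> (Suc n) =
     nonlinear_flow \<gamma> b l \<eta> n \<bind> Q \<gamma> b l (nonlinear_flow \<gamma> b l \<eta> n)"

text \<open>A Lipschitz function on the compact torus is bounded, so the supremum is a proper one.\<close>

definition sup_norm :: "('d::finite torus \<Rightarrow> real) \<Rightarrow> real" where
  "sup_norm l = (SUP x. \<bar>l x\<bar>)"

definition kappa :: "real \<Rightarrow> real \<Rightarrow> real \<Rightarrow> ('d::finite torus \<Rightarrow> real) \<Rightarrow> real \<Rightarrow> real" where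
  "kappa c1 c2 L l \<gamma> = c1 - c2 * L * exp (\<gamma> * sup_norm l)"

end

theory Submission
  imports Defs
begin

text \<open>The nonlinear step \<open>\<mu> \<mapsto> \<mu> Q\<^sub>\<mu>\<close> is the law \<open>\<mu> K\<close> conditioned on survival, with density proportional
  to \<open>exp (- \<gamma> \<lambda>)\<close>. For an empirical measure \<open>\<pi>(x)\<close> it is the law of a uniformly chosen particle
  after one step of the \<open>N\<close>-particle system, so the contraction for \<open>R\<close> started from Dirac masses
  yields the claim for the pair \<open>\<pi>(x), \<pi>(y)\<close> with the cost of the pairing \<open>(x\<^sub>i, y\<^sub>i)\<close>. No law of
  large numbers is needed to pass to general measures: a near-optimal coupling is quantized
  deterministically on small cells with rational weights. The Harnack inequality
  \<open>K(x', \<cdot>) \<le> (1 + \<theta>) K(x, \<cdot>)\<close> for close \<open>x, x'\<close>, valid on the torus since the Gaussian density,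
  wrapped around it, is bounded below, turns this into
  a domination of measures up to a factor close to one, which is stable under the conditioning and
  under which Wasserstein distances are compared by completing a coupling with a product of
  residuals.\<close>

subsection \<open>The torus\<close>


text \<open>The particle system runs for a single step only: the one-step bound holds for every pair
  of probability measures, so it can be iterated along the two flows, and no propagation of chaos
  over many steps is involved. The obstacle is to reach measures that are not empirical without
  spoiling the constant \<open>1 - \<gamma> * kappa\<close>. Approximation in Wasserstein distance
  would require continuity of the nonlinear step and a triangle inequality. Domination avoids both,
  but an atomic measure is not dominated by a multiple of a diffuse one; this is why the comparison
  is made only after \<open>K\<close> has acted. Domination is also one-sided: only upper bounds for
  the empirical side are proved, and the lower bound on its surviving mass comes from bounding the
  complementary lost mass. What is left over has mass \<epsilon> and costs at most \<epsilon>/a,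
  because \<open>rho a\<close> is bounded by 1/a. For each \<epsilon> the number \<open>N\<close> of
  particles is whatever the quantization needs; \<epsilon> tends to 0 for a fixed coupling, and the
  infimum over couplings comes last.\<close>

lemma dist_torus_le:
  assumes "to_torus v = x - y"
  shows "dist (x :: 'd::finite torus) y \<le> norm v"
  unfolding dist_torus_def
  using assms by (intro cINF_lower bdd_belowI[of _ 0]) auto

lemma dist_torus_approx:
  assumes "dist (x :: 'd::finite torus) y < e"
  obtains v where "x = y + to_torus v" "norm v < e"
proof -
  have "{v. to_torus v = x - y} \<noteq> {}" by (rule to_torus_cases[of "x - y"]) auto
  moreover have "bdd_below (norm ` {v. to_torus v = x - y})"
    by (rule bdd_belowI[of _ 0]) auto
  ultimately obtain v where "to_torus v = x - y" "norm v < e"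
    using cINF_less_iff[of "{v. to_torus v = x - y}" norm e] assms unfolding dist_torus_def by auto
  then show ?thesis by (intro that[of v]) auto
qed

lemma to_torus_diff: "to_torus (v - w) = to_torus v - to_torus (w :: real ^ 'd::finite)"
  using to_torus_add[of v "- w"] by (simp add: to_torus_minus)

lemma dist_to_torus_le: "dist (to_torus v) (to_torus w) \<le> dist v (w :: real ^ 'd::finite)"
  by (rule dist_torus_le[THEN order_trans, of "v - w"])
    (simp_all add: dist_norm to_torus_diff)

lemma continuous_on_to_torus [continuous_intros]:
  "continuous_on S f \<Longrightarrow> continuous_on S (\<lambda>x. to_torus (f x :: real ^ 'd::finite))"
proof -
  have "continuous_on UNIV (to_torus :: real ^ 'd \<Rightarrow> _)"
    unfolding continuous_on_iff using dist_to_torus_le by (metis order_le_less_trans)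
  then show "continuous_on S f \<Longrightarrow> continuous_on S (\<lambda>x. to_torus (f x :: real ^ 'd))"
    by (rule continuous_on_compose2) auto
qed

lemma dist_torus_add_le:
  "dist (x + u) (y + v) \<le> dist x y + dist u (v :: 'd::finite torus)"
proof (rule field_le_epsilon)
  fix e :: real assume e: "e > 0"
  obtain p where p: "x = y + to_torus p" "norm p < dist x y + e / 2"
    using dist_torus_approx[of x y "dist x y + e / 2"] e by auto
  obtain q where q: "u = v + to_torus q" "norm q < dist u v + e / 2"
    using dist_torus_approx[of u v "dist u v + e / 2"] e by auto
  have "dist (x + u) (y + v) \<le> norm (p + q)"
    by (rule dist_torus_le) (simp add: p q to_torus_add algebra_simps)
  also have "\<dots> \<le> norm p + norm q" by (rule norm_triangle_ineq)
  finally show "dist (x + u) (y + v) \<le> dist x y + dist u v + e"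
    using p(2) q(2) by linarith
qed

lemma continuous_on_torus_add [continuous_intros]:
  fixes f g :: "'a::topological_space \<Rightarrow> 'd::finite torus"
  assumes "continuous_on S f" "continuous_on S g"
  shows "continuous_on S (\<lambda>x. f x + g x)"
  unfolding continuous_on_def
proof
  fix x assume x: "x \<in> S"
  have "((\<lambda>y. dist (f y) (f x) + dist (g y) (g x)) \<longlongrightarrow> 0 + 0) (at x within S)"
    using assms x by (intro tendsto_add) (auto simp: continuous_on_def tendsto_dist_iff[symmetric])
  then have "((\<lambda>y. dist (f y + g y) (f x + g x)) \<longlongrightarrow> 0) (at x within S)"
    by (rule Lim_null_comparison[rotated, OF tendsto_eq_rhs]) (auto simp: dist_torus_add_le)
  then show "((\<lambda>y. f y + g y) \<longlongrightarrow> f x + g x) (at x within S)"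
    by (simp add: tendsto_dist_iff[symmetric])
qed

lemma to_torus_of_int [simp]: "(\<And>i. n $ i \<in> \<int>) \<Longrightarrow> to_torus n = 0"
  unfolding to_torus_zero[symmetric] to_torus_eq_iff by simp

lemma range_to_torus_cbox:
  "(UNIV :: 'd::finite torus set) = to_torus ` cbox 0 (\<chi> i. 1)"
proof -
  have "x \<in> to_torus ` cbox 0 (\<chi> i. 1)" for x :: "'d torus"
  proof -
    obtain v where v: "x = to_torus v" by (rule to_torus_cases)
    have "x = to_torus (\<chi> i. frac (v $ i))"
      unfolding v to_torus_eq_iff by (simp add: frac_def)
    moreover have "(\<chi> i. frac (v $ i)) \<in> cbox 0 (\<chi> i. 1)"
      by (simp add: mem_box_cart frac_ge_0 less_imp_le frac_lt_1)
    ultimately show ?thesis by blast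
  qed
  then show ?thesis by blast
qed

lemma compact_UNIV_torus: "compact (UNIV :: 'd::finite torus set)"
  unfolding range_to_torus_cbox
  by (intro compact_continuous_image continuous_intros compact_cbox)

text \<open>Continuity descends to the quotient because the torus distance is realised upstairs: a
  point within d of \<open>to_torus v\<close> has the form \<open>to_torus (v + u)\<close> with
  \<open>norm u < d\<close>, so a modulus of the lift at one representative serves
  downstairs.\<close>

lemma continuous_on_torus_lift:
  fixes f :: "'d::finite torus \<Rightarrow> 'b::metric_space"
  assumes "continuous_on UNIV (\<lambda>v. f (to_torus v))"
  shows "continuous_on UNIV f"
  unfolding continuous_on_iff
proof (intro ballI allI impI)
  fix x :: "'d torus" and e :: real assume "e > 0"
  obtain v where v: "x = to_torus v" by (rule to_torus_cases)
  obtain d where d: "d > 0" "\<And>w. dist w v < d \<Longrightarrow> dist (f (to_torus w)) (f x) < e"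
    using assms \<open>e > 0\<close> unfolding continuous_on_iff v by (metis UNIV_I)
  have "dist (f y) (f x) < e" if y: "dist y x < d" for y
  proof -
    obtain u where "y = x + to_torus u" "norm u < d" by (rule dist_torus_approx[OF y])
    then show ?thesis using d(2)[of "v + u"] by (simp add: v to_torus_add dist_norm)
  qed
  then show "\<exists>d>0. \<forall>y\<in>UNIV. dist y x < d \<longrightarrow> dist (f y) (f x) < e" using d(1) by blast
qed

lemma C1_torus_continuous: "C1_torus b \<Longrightarrow> continuous_on UNIV b"
  unfolding C1_torus_def
  by (intro continuous_on_torus_lift continuous_at_imp_continuous_on)
    (blast intro: has_derivative_continuous)

text \<open>Balls of rational radius around the images of a countable dense set form a basis. Second
  countability makes product sigma-algebras with torus factors Borel (\<open>borel_prod\<close>),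
  and so turns continuity of the kernel map and of \<open>rho\<close> into the product measurability
  needed below.\<close>

instance torus :: (finite) second_countable_topology
proof
  obtain D :: "(real ^ 'a) set" where D: "countable D" "\<And>X. open X \<Longrightarrow> X \<noteq> {} \<Longrightarrow> \<exists>d\<in>D. d \<in> X"
    by (rule countable_dense_setE) blast
  define B where "B = (\<lambda>(q, r). ball (to_torus q :: 'a torus) r) ` (D \<times> \<rat>)"
  have "countable B" unfolding B_def using D(1) countable_rat by blast
  moreover have "topological_basis B"
  proof (rule topological_basisI)
    show "open b" if "b \<in> B" for b using that by (auto simp: B_def)
    fix U :: "'a torus set" and x assume U: "open U" "x \<in> U"
    then obtain e where e: "e > 0" "ball x e \<subseteq> U" by (auto simp: open_contains_ball)
    obtain v where v: "x = to_torus v" by (rule to_torus_cases)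
    obtain r where r: "r \<in> \<rat>" "0 < r" "r < e / 2" using Rats_dense_in_real[of 0 "e / 2"] e by auto
    obtain q where q: "q \<in> D" "dist q v < r"
      using D(2)[of "ball v r"] r by (auto simp: dist_commute)
    have d: "dist (to_torus q) x < r" using dist_to_torus_le[of q v] q unfolding v by linarith
    have "ball (to_torus q) r \<subseteq> U"
    proof
      fix y assume "y \<in> ball (to_torus q) r"
      then have "dist x y < e"
        using d r dist_triangle[of x y "to_torus q"] by (simp add: dist_commute)
      then show "y \<in> U" using e by auto
    qed
    then show "\<exists>b\<in>B. x \<in> b \<and> b \<subseteq> U"
      using d q r by (intro bexI[of _ "ball (to_torus q) r"]) (auto simp: B_def)
  qed
  ultimately show "\<exists>B :: 'a torus set set. countable B \<and> open = generate_topology B"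
    using topological_basis_imp_subbasis by blast
qed

subsection \<open>The Gaussian kernel on the torus\<close>


text \<open>The density splits into one-dimensional normal densities over the coordinates. General
  \<sigma> is kept since normalising \<open>std_gaussian\<close> takes \<sigma> = 1 and the
  comparison of periodic integrals takes \<sigma> = 2.\<close>

lemma nn_integral_gaussian:
  assumes "\<sigma> > 0"
  shows "(\<integral>\<^sup>+y. ennreal (exp (- (norm (y :: real ^ 'd::finite))\<^sup>2 / (2 * \<sigma>\<^sup>2))) \<partial>lborel)
    = ennreal (sqrt (2 * pi * \<sigma>\<^sup>2) ^ CARD('d))"
proof -
  have one: "(\<integral>\<^sup>+t. ennreal (exp (- t\<^sup>2 / (2 * \<sigma>\<^sup>2))) \<partial>lborel) = ennreal (sqrt (2 * pi * \<sigma>\<^sup>2))"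
  proof -
    have "(\<integral>\<^sup>+t. ennreal (exp (- t\<^sup>2 / (2 * \<sigma>\<^sup>2))) \<partial>lborel)
      = (\<integral>\<^sup>+t. ennreal (sqrt (2 * pi * \<sigma>\<^sup>2)) * ennreal (normal_density 0 \<sigma> t) \<partial>lborel)"
      using assms by (intro nn_integral_cong) (simp add: normal_density_def ennreal_mult[symmetric])
    also have "\<dots> = ennreal (sqrt (2 * pi * \<sigma>\<^sup>2)) * (\<integral>\<^sup>+t. ennreal (normal_density 0 \<sigma> t) \<partial>lborel)"
      by (intro nn_integral_cmult) simp
    also have "(\<integral>\<^sup>+t. ennreal (normal_density 0 \<sigma> t) \<partial>lborel) = 1"
      using assms by (subst nn_integral_eq_integral) auto
    finally show ?thesis by simp
  qed
  have "(\<integral>\<^sup>+y. ennreal (exp (- (norm (y :: real ^ 'd))\<^sup>2 / (2 * \<sigma>\<^sup>2))) \<partial>lborel)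
    = (\<integral>\<^sup>+y. (\<Prod>i\<in>Basis. ennreal (exp (- ((y :: real ^ 'd) \<bullet> i)\<^sup>2 / (2 * \<sigma>\<^sup>2)))) \<partial>lborel)"
  proof (intro nn_integral_cong)
    fix y :: "real ^ 'd"
    have "(norm y)\<^sup>2 = (\<Sum>i\<in>Basis. (y \<bullet> i)\<^sup>2)"
      unfolding power2_norm_eq_inner by (subst euclidean_inner) (simp add: power2_eq_square)
    then have "exp (- (norm y)\<^sup>2 / (2 * \<sigma>\<^sup>2)) = (\<Prod>i\<in>Basis. exp (- (y \<bullet> i)\<^sup>2 / (2 * \<sigma>\<^sup>2)))"
      by (simp add: exp_sum[symmetric] sum_negf sum_divide_distrib)
    then show "ennreal (exp (- (norm y)\<^sup>2 / (2 * \<sigma>\<^sup>2)))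
        = (\<Prod>i\<in>Basis. ennreal (exp (- (y \<bullet> i)\<^sup>2 / (2 * \<sigma>\<^sup>2))))"
      by (simp add: prod_ennreal)
  qed
  also have "\<dots> = (\<Prod>i\<in>(Basis :: (real ^ 'd) set). \<integral>\<^sup>+t. ennreal (exp (- t\<^sup>2 / (2 * \<sigma>\<^sup>2))) \<partial>lborel)"
    by (intro nn_integral_lborel_prod) auto
  also have "\<dots> = ennreal (sqrt (2 * pi * \<sigma>\<^sup>2)) ^ CARD('d)"
    unfolding one by simp
  also have "\<dots> = ennreal (sqrt (2 * pi * \<sigma>\<^sup>2) ^ CARD('d))"
    by (rule ennreal_power) simp
  finally show ?thesis .
qed

lemma sets_std_gaussian [simp, measurable_cong]: "sets std_gaussian = sets borel"
  by (simp add: std_gaussian_def)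

lemma space_std_gaussian [simp]: "space std_gaussian = UNIV"
  by (simp add: std_gaussian_def)

lemma prob_space_std_gaussian: "prob_space (std_gaussian :: (real ^ 'd::finite) measure)"
proof
  let ?c = "(2 * pi) powr (- real CARD('d) / 2)"
  have "emeasure (std_gaussian :: (real ^ 'd) measure) (space std_gaussian)
     = (\<integral>\<^sup>+y. ennreal ?c * ennreal (exp (- (norm (y :: real ^ 'd))\<^sup>2 / (2 * 1\<^sup>2))) \<partial>lborel)"
    unfolding std_gaussian_def by (simp add: emeasure_density ennreal_mult)
  also have "\<dots> = ennreal (?c * sqrt (2 * pi) ^ CARD('d))"
    by (subst nn_integral_cmult) (simp_all add: nn_integral_gaussian[of 1, simplified] ennreal_mult)
  also have "sqrt (2 * pi) ^ CARD('d) = (2 * pi) powr (real CARD('d) / 2)"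
    by (simp add: powr_half_sqrt[symmetric] powr_realpow[symmetric] powr_powr)
  also have "?c * (2 * pi) powr (real CARD('d) / 2) = 1"
    by (simp add: powr_add[symmetric])
  finally show "emeasure (std_gaussian :: (real ^ 'd) measure) (space std_gaussian) = 1" by simp
qed

lemma measurable_K_aux:
  assumes [continuous_intros]: "continuous_on UNIV b"
  shows "(\<lambda>(x, y). x + to_torus (\<gamma> *\<^sub>R b x + sqrt \<gamma> *\<^sub>R y)) \<in> borel \<Otimes>\<^sub>M borel \<rightarrow>\<^sub>M borel"
  unfolding borel_prod case_prod_beta
  by (intro borel_measurable_continuous_onI continuous_intros
      continuous_on_compose2[OF assms continuous_on_fst]) auto

lemma measurable_K:
  assumes "continuous_on UNIV b"
  shows "K \<gamma> b \<in> borel \<rightarrow>\<^sub>M prob_algebra borel"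
proof (rule measurable_prob_algebraI)
  have [measurable]: "(\<lambda>y. x + to_torus (\<gamma> *\<^sub>R b x + sqrt \<gamma> *\<^sub>R y)) \<in> borel \<rightarrow>\<^sub>M borel" for x
    by (intro borel_measurable_continuous_onI continuous_intros)
  show "prob_space (K \<gamma> b x)" for x
    unfolding K_def by (intro prob_space.prob_space_distr prob_space_std_gaussian) simp
  have "std_gaussian \<in> space (subprob_algebra (borel :: (real ^ 'a) measure))"
    by (simp add: space_subprob_algebra prob_space_imp_subprob_space prob_space_std_gaussian)
  then show "K \<gamma> b \<in> borel \<rightarrow>\<^sub>M subprob_algebra borel"
    unfolding K_def
    by (intro measurable_distr2[where M=borel] measurable_K_aux assms measurable_const)
qed

lemma nn_integral_lborel_translate:
  fixes f :: "'a::euclidean_space \<Rightarrow> ennreal"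
  assumes [measurable]: "f \<in> borel_measurable borel"
  shows "(\<integral>\<^sup>+y. f (c + y) \<partial>lborel) = (\<integral>\<^sup>+y. f y \<partial>lborel)"
  by (subst lborel_distr_plus[of c, symmetric], subst nn_integral_distr) simp_all

text \<open>A lattice vector brings \<open>w\<close> into the first cell, where the translate of the
  cube stays inside the cube of twice the side. Losing a factor this way spares cutting the
  translated cube into pieces and reassembling a period cell exactly.\<close>

lemma nn_integral_periodic_cube_le:
  fixes H :: "real ^ 'd::finite \<Rightarrow> ennreal"
  assumes [measurable]: "H \<in> borel_measurable borel" and s: "s > 0"
    and periodic: "\<And>y n. (\<And>i. n $ i \<in> \<int>) \<Longrightarrow> H (y + s *\<^sub>R n) = H y"
  shows "(\<integral>\<^sup>+u. H (w + u) * indicator (cbox 0 (\<chi> i. s)) u \<partial>lborel)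
    \<le> (\<integral>\<^sup>+y. H y * indicator (cbox 0 (\<chi> i. 2 * s)) y \<partial>lborel)"
proof -
  define n :: "real ^ 'd" where "n = (\<chi> i. of_int \<lfloor>w $ i / s\<rfloor>)"
  define z where "z = w - s *\<^sub>R n"
  have z: "0 \<le> z $ i \<and> z $ i \<le> s" for i
  proof -
    have "of_int \<lfloor>w $ i / s\<rfloor> * s \<le> w $ i" "w $ i \<le> (of_int \<lfloor>w $ i / s\<rfloor> + 1) * s"
      using s by (simp_all add: pos_le_divide_eq[symmetric] pos_divide_le_eq[symmetric])
    then show ?thesis by (simp add: z_def n_def algebra_simps)
  qed
  have "H (w + u) = H (z + u)" for u
    using periodic[of n "z + u"] by (simp add: z_def n_def algebra_simps)
  then have "(\<integral>\<^sup>+u. H (w + u) * indicator (cbox 0 (\<chi> i. s)) u \<partial>lborel)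
    \<le> (\<integral>\<^sup>+u. H (z + u) * indicator (cbox 0 (\<chi> i. 2 * s)) (z + u) \<partial>lborel)"
    using z s by (intro nn_integral_mono)
      (auto simp: indicator_def mem_box_cart intro!: add_nonneg_nonneg intro: order_trans[OF add_mono])
  also have "\<dots> = (\<integral>\<^sup>+y. H y * indicator (cbox 0 (\<chi> i. 2 * s)) y \<partial>lborel)"
    by (rule nn_integral_lborel_translate) simp
  finally show ?thesis .
qed

text \<open>Over the lattice of periods the wide Gaussian has a bounded sum, which is expressed here
  without a sum: averaging over a period cell reduces both sides to the integral over a cell.\<close>

lemma periodic_gaussian_comparison:
  fixes s :: real
  assumes s: "s > 0"
  obtains C :: real where "C \<ge> 0" and
    "\<And>H :: real ^ 'd::finite \<Rightarrow> ennreal. H \<in> borel_measurable borel \<Longrightarrow>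
      (\<And>y n. (\<And>i. n $ i \<in> \<int>) \<Longrightarrow> H (y + s *\<^sub>R n) = H y) \<Longrightarrow>
      (\<integral>\<^sup>+y. H y * ennreal (exp (- (norm y)\<^sup>2 / 4)) \<partial>lborel)
        \<le> ennreal C * (\<integral>\<^sup>+y. H y * ennreal (exp (- (norm y)\<^sup>2 / 2)) \<partial>lborel)"
proof -
  define Q1 Q2 :: "(real ^ 'd) set" where "Q1 = cbox 0 (\<chi> i. s)" and "Q2 = cbox 0 (\<chi> i. 2 * s)"
  have [measurable]: "Q1 \<in> sets borel" "Q2 \<in> sets borel" by (simp_all add: Q1_def Q2_def)
  have "bounded (Q1 \<union> Q2)" by (simp add: Q1_def Q2_def bounded_cbox)
  then obtain M where M: "\<And>u. u \<in> Q1 \<union> Q2 \<Longrightarrow> norm u \<le> M" unfolding bounded_iff by blast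
  define V where "V = measure lborel Q1"
  have "0 < s ^ CARD('d)" using s by simp
  also have "s ^ CARD('d) = V"
    using s unfolding V_def Q1_def by (subst content_cbox_cart) (auto simp: interval_eq_empty_cart not_less)
  finally have V: "V > 0" .
  have emV: "emeasure lborel Q1 = ennreal V"
    unfolding V_def Q1_def
    using emeasure_lborel_cbox_finite[of "0 :: real ^ 'd" "\<chi> i. s"]
    by (intro emeasure_eq_ennreal_measure) auto
  define J where "J = sqrt (2 * pi * 2\<^sup>2) ^ CARD('d)"
  have J: "(\<integral>\<^sup>+y. ennreal (exp (- (norm (y :: real ^ 'd))\<^sup>2 / 8)) \<partial>lborel) = ennreal J" "J \<ge> 0"
    using nn_integral_gaussian[of 2, where 'd='d] unfolding J_def by simp_all
  show ?thesis
  proof (rule that)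
    show "exp (M\<^sup>2 / 4) * J * exp (M\<^sup>2 / 2) / V \<ge> 0" using J V by simp
    fix H :: "real ^ 'd \<Rightarrow> ennreal"
    assume H[measurable]: "H \<in> borel_measurable borel"
      and periodic: "\<And>y n. (\<And>i. n $ i \<in> \<int>) \<Longrightarrow> H (y + s *\<^sub>R n) = H y"
    define I where "I = (\<integral>\<^sup>+y. H y * ennreal (exp (- (norm y)\<^sup>2 / 2)) \<partial>lborel)"
    \<comment> \<open>On the bounded set \<open>Q2\<close> the weight exp(-|y|^2/2) is at least
      exp(-M^2/2).\<close>
    have cell: "(\<integral>\<^sup>+y. H y * indicator Q2 y \<partial>lborel) \<le> ennreal (exp (M\<^sup>2 / 2)) * I"
    proof -
      have "H y * indicator Q2 y \<le> ennreal (exp (M\<^sup>2 / 2)) * (H y * ennreal (exp (- (norm y)\<^sup>2 / 2)))" for y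
      proof (cases "y \<in> Q2")
        case True
        have "(norm y)\<^sup>2 \<le> M\<^sup>2" using M[of y] True by (intro power_mono) auto
        then have "1 \<le> exp (M\<^sup>2 / 2) * exp (- (norm y)\<^sup>2 / 2)"
          by (simp add: exp_add[symmetric])
        then have "H y * 1 \<le> H y * ennreal (exp (M\<^sup>2 / 2) * exp (- (norm y)\<^sup>2 / 2))"
          by (intro mult_left_mono) auto
        then show ?thesis using True by (simp add: ennreal_mult ac_simps)
      qed simp
      then show ?thesis unfolding I_def
        by (subst nn_integral_cmult[symmetric]) (auto intro!: nn_integral_mono)
    qed
    have shifted_cell: "(\<integral>\<^sup>+u. H (w + u) * indicator Q1 u \<partial>lborel) \<le> ennreal (exp (M\<^sup>2 / 2)) * I" for w
      using nn_integral_periodic_cube_le[OF H s periodic, of w] cell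
      unfolding Q1_def Q2_def by (meson order_trans)
    \<comment> \<open>Since |y - u|^2 <= 2|y|^2 + 2|u|^2, the Gaussian of variance 2 at y is bounded
      by a multiple of that of variance 4 at any y - u with u in the cell. The extra width is what
      pays for the averaging over u.\<close>
    have wide: "ennreal (exp (- (norm y)\<^sup>2 / 4)) * indicator Q1 u
        \<le> ennreal (exp (M\<^sup>2 / 4)) * (ennreal (exp (- (norm (y - u))\<^sup>2 / 8)) * indicator Q1 u)"
      for y u :: "real ^ 'd"
    proof (cases "u \<in> Q1")
      case True
      have u: "(norm u)\<^sup>2 \<le> M\<^sup>2" using M[of u] True by (intro power_mono) auto
      have "(norm (y - u))\<^sup>2 \<le> (norm y + norm u)\<^sup>2"
        by (intro power_mono norm_triangle_ineq4) auto
      also have "\<dots> \<le> 2 * (norm y)\<^sup>2 + 2 * (norm u)\<^sup>2"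
        using sum_squares_bound[of "norm y" "norm u"] by (simp add: power2_sum)
      finally have "exp (- (norm y)\<^sup>2 / 4) \<le> exp (M\<^sup>2 / 4) * exp (- (norm (y - u))\<^sup>2 / 8)"
        using u by (simp add: exp_add[symmetric])
      then show ?thesis using True by (simp add: ennreal_mult[symmetric])
    qed simp
    have inner: "(\<integral>\<^sup>+u. ennreal (exp (- (norm y)\<^sup>2 / 4)) * indicator Q1 u \<partial>lborel)
        = ennreal (exp (- (norm y)\<^sup>2 / 4)) * ennreal V" for y :: "real ^ 'd"
      by (subst nn_integral_cmult_indicator) (simp_all add: emV)
    \<comment> \<open>Inserting the average over u in \<open>Q1\<close> and exchanging integrals
      twice, with the translation y = u + w in between, leaves for each w an integral of the
      periodic \<open>H\<close> over a translated cell, bounded uniformly in w. The Gaussian of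
      variance 4 in w then integrates to \<open>J\<close>.\<close>
    have "ennreal V * (\<integral>\<^sup>+y. H y * ennreal (exp (- (norm y)\<^sup>2 / 4)) \<partial>lborel)
      = (\<integral>\<^sup>+y. H y * (\<integral>\<^sup>+u. ennreal (exp (- (norm y)\<^sup>2 / 4)) * indicator Q1 u \<partial>lborel) \<partial>lborel)"
      unfolding inner by (subst nn_integral_cmult[symmetric]) (simp_all add: ac_simps)
    also have "\<dots> \<le> (\<integral>\<^sup>+y. H y * (\<integral>\<^sup>+u. ennreal (exp (M\<^sup>2 / 4)) *
        (ennreal (exp (- (norm (y - u))\<^sup>2 / 8)) * indicator Q1 u) \<partial>lborel) \<partial>lborel)"
      by (intro nn_integral_mono mult_left_mono wide) simp_all
    also have "\<dots> = (\<integral>\<^sup>+y. \<integral>\<^sup>+u. ennreal (exp (M\<^sup>2 / 4)) *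
        (indicator Q1 u * (H y * ennreal (exp (- (norm (y - u))\<^sup>2 / 8)))) \<partial>lborel \<partial>lborel)"
      by (intro nn_integral_cong, subst nn_integral_cmult[symmetric])
        (auto intro!: nn_integral_cong simp: ac_simps)
    also have "\<dots> = (\<integral>\<^sup>+u. \<integral>\<^sup>+y. ennreal (exp (M\<^sup>2 / 4)) *
        (indicator Q1 u * (H y * ennreal (exp (- (norm (y - u))\<^sup>2 / 8)))) \<partial>lborel \<partial>lborel)"
      by (rule lborel_pair.Fubini') measurable
    also have "\<dots> = ennreal (exp (M\<^sup>2 / 4)) * (\<integral>\<^sup>+u. indicator Q1 u *
        (\<integral>\<^sup>+y. H y * ennreal (exp (- (norm (y - u))\<^sup>2 / 8)) \<partial>lborel) \<partial>lborel)"
      by (simp add: nn_integral_cmult)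
    also have "(\<lambda>u. \<integral>\<^sup>+y. H y * ennreal (exp (- (norm (y - u))\<^sup>2 / 8)) \<partial>lborel)
      = (\<lambda>u. \<integral>\<^sup>+w. H (u + w) * ennreal (exp (- (norm w)\<^sup>2 / 8)) \<partial>lborel)"
    proof
      fix u
      show "(\<integral>\<^sup>+y. H y * ennreal (exp (- (norm (y - u))\<^sup>2 / 8)) \<partial>lborel)
        = (\<integral>\<^sup>+w. H (u + w) * ennreal (exp (- (norm w)\<^sup>2 / 8)) \<partial>lborel)"
        using nn_integral_lborel_translate[of "\<lambda>y. H y * ennreal (exp (- (norm (y - u))\<^sup>2 / 8))" u]
        by simp
    qed
    also have "(\<integral>\<^sup>+u. indicator Q1 u * (\<integral>\<^sup>+w. H (u + w) * ennreal (exp (- (norm w)\<^sup>2 / 8)) \<partial>lborel) \<partial>lborel)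
      = (\<integral>\<^sup>+u. \<integral>\<^sup>+w. indicator Q1 u * (H (u + w) * ennreal (exp (- (norm w)\<^sup>2 / 8))) \<partial>lborel \<partial>lborel)"
      by (simp add: nn_integral_cmult)
    also have "\<dots> = (\<integral>\<^sup>+w. \<integral>\<^sup>+u. indicator Q1 u * (H (u + w) * ennreal (exp (- (norm w)\<^sup>2 / 8))) \<partial>lborel \<partial>lborel)"
      by (rule lborel_pair.Fubini') measurable
    also have "\<dots> = (\<integral>\<^sup>+w. ennreal (exp (- (norm w)\<^sup>2 / 8)) * (\<integral>\<^sup>+u. H (w + u) * indicator Q1 u \<partial>lborel) \<partial>lborel)"
      by (intro nn_integral_cong, subst nn_integral_cmult[symmetric])
        (auto intro!: nn_integral_cong simp: ac_simps)
    also have "\<dots> \<le> (\<integral>\<^sup>+w. ennreal (exp (- (norm (w :: real ^ 'd))\<^sup>2 / 8)) * (ennreal (exp (M\<^sup>2 / 2)) * I) \<partial>lborel)"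
      by (intro nn_integral_mono mult_left_mono shifted_cell) simp_all
    also have "\<dots> = ennreal J * (ennreal (exp (M\<^sup>2 / 2)) * I)"
      unfolding J(1)[symmetric] by (rule nn_integral_multc) simp
    finally have le: "ennreal V * (\<integral>\<^sup>+y. H y * ennreal (exp (- (norm y)\<^sup>2 / 4)) \<partial>lborel)
      \<le> ennreal (exp (M\<^sup>2 / 4)) * (ennreal J * (ennreal (exp (M\<^sup>2 / 2)) * I))"
      by (simp add: mult_left_mono)
    have "(\<integral>\<^sup>+y. H y * ennreal (exp (- (norm y)\<^sup>2 / 4)) \<partial>lborel)
      = ennreal (1 / V) * (ennreal V * (\<integral>\<^sup>+y. H y * ennreal (exp (- (norm y)\<^sup>2 / 4)) \<partial>lborel))"
      using V by (simp add: mult.assoc[symmetric] ennreal_mult[symmetric])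
    also have "\<dots> \<le> ennreal (1 / V) * (ennreal (exp (M\<^sup>2 / 4)) * (ennreal J * (ennreal (exp (M\<^sup>2 / 2)) * I)))"
      by (intro mult_left_mono le) simp
    also have "\<dots> = ennreal (exp (M\<^sup>2 / 4) * J * exp (M\<^sup>2 / 2) / V) * I"
      using V J by (simp add: ennreal_mult[symmetric] mult.assoc[symmetric])
    finally show "(\<integral>\<^sup>+y. H y * ennreal (exp (- (norm y)\<^sup>2 / 4)) \<partial>lborel)
      \<le> ennreal (exp (M\<^sup>2 / 4) * J * exp (M\<^sup>2 / 2) / V) * I" .
  qed
qed

text \<open>For a nonzero shift the ratio to the original Gaussian is unbounded, so no pointwise
  bound with a factor close to 1 is available; the error is instead additive and carried by a wider
  Gaussian. Expanding the square leaves exp t with t = |y||w|, and exp t <= 1 + t exp t with t <=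
  |w| exp |y| isolates the small factor |w|.\<close>

lemma exp_gaussian_shift_le:
  fixes y w :: "'a::real_inner"
  assumes "norm w \<le> 1"
  shows "exp (- (norm (y - w))\<^sup>2 / 2)
    \<le> exp (- (norm y)\<^sup>2 / 2) + norm w * exp 4 * exp (- (norm y)\<^sup>2 / 4)"
proof -
  define q t where "q = norm y" and "t = norm y * norm w"
  have t: "0 \<le> t" "t \<le> q" "q \<ge> 0"
    using assms by (auto simp: t_def q_def intro: mult_left_le)
  have "(norm (y - w))\<^sup>2 = q\<^sup>2 - 2 * (y \<bullet> w) + (norm w)\<^sup>2"
    by (simp add: power2_norm_eq_inner inner_diff_left inner_diff_right inner_commute q_def)
  then have "q\<^sup>2 - 2 * t \<le> (norm (y - w))\<^sup>2"
    using norm_cauchy_schwarz[of y w] zero_le_power2[of "norm w"] unfolding t_def by linarith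
  then have "exp (- (norm (y - w))\<^sup>2 / 2) \<le> exp (- q\<^sup>2 / 2) * exp t"
    by (simp add: exp_add[symmetric])
  also have "exp t \<le> 1 + t * exp t"
  proof -
    have "(1 - t) * exp t \<le> exp (- t) * exp t"
      using exp_ge_add_one_self[of "- t"] by (intro mult_right_mono) auto
    then show ?thesis by (simp add: algebra_simps exp_add[symmetric])
  qed
  also have "t * exp t \<le> (norm w * exp q) * exp q"
  proof -
    have "norm w * q \<le> norm w * exp q"
      using exp_ge_add_one_self[of q] by (intro mult_left_mono) (linarith, simp)
    then show ?thesis using t by (intro mult_mono) (auto simp: t_def q_def mult.commute)
  qed
  finally have "exp (- (norm (y - w))\<^sup>2 / 2) \<le> exp (- q\<^sup>2 / 2) + norm w * exp (- q\<^sup>2 / 2 + q + q)"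
    unfolding exp_add by (simp add: algebra_simps)
  \<comment> \<open>Completing the square: 2q <= 4 + q^2/4 because (q/2 - 2)^2 >= 0, which is where
    exp 4 comes from.\<close>
  also have "- q\<^sup>2 / 2 + q + q \<le> 4 + - q\<^sup>2 / 4"
    using zero_le_power2[of "q / 2 - 2"] by (simp add: power2_diff power_divide)
  then have "norm w * exp (- q\<^sup>2 / 2 + q + q) \<le> norm w * exp 4 * exp (- q\<^sup>2 / 4)"
    by (simp only: mult.assoc exp_add[symmetric] exp_le_cancel_iff mult_left_mono norm_ge_zero)
  finally show ?thesis by (simp add: q_def)
qed

lemma emeasure_K:
  assumes "continuous_on UNIV b" and [measurable]: "A \<in> sets borel"
  shows "emeasure (K \<gamma> b x) A = ennreal ((2 * pi) powr (- real CARD('d) / 2)) *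
    (\<integral>\<^sup>+y. indicator A (x + to_torus (\<gamma> *\<^sub>R b x + sqrt \<gamma> *\<^sub>R y)) *
      ennreal (exp (- (norm (y :: real ^ 'd::finite))\<^sup>2 / 2)) \<partial>lborel)"
proof -
  have [measurable]: "(\<lambda>y. x + to_torus (\<gamma> *\<^sub>R b x + sqrt \<gamma> *\<^sub>R y)) \<in> borel \<rightarrow>\<^sub>M borel"
    by (intro borel_measurable_continuous_onI continuous_intros)
  have "emeasure (K \<gamma> b x) A
    = (\<integral>\<^sup>+y. indicator A (x + to_torus (\<gamma> *\<^sub>R b x + sqrt \<gamma> *\<^sub>R y)) \<partial>std_gaussian)"
    unfolding K_def
    by (subst nn_integral_indicator[symmetric], simp, subst nn_integral_distr) simp_all
  also have "\<dots> = (\<integral>\<^sup>+y. ennreal ((2 * pi) powr (- real CARD('d) / 2)) *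
     (indicator A (x + to_torus (\<gamma> *\<^sub>R b x + sqrt \<gamma> *\<^sub>R y)) *
      ennreal (exp (- (norm (y :: real ^ 'd))\<^sup>2 / 2))) \<partial>lborel)"
    unfolding std_gaussian_def
    by (subst nn_integral_density) (auto simp: ennreal_mult ac_simps intro!: nn_integral_cong)
  also have "\<dots> = ennreal ((2 * pi) powr (- real CARD('d) / 2)) *
    (\<integral>\<^sup>+y. indicator A (x + to_torus (\<gamma> *\<^sub>R b x + sqrt \<gamma> *\<^sub>R y)) *
      ennreal (exp (- (norm (y :: real ^ 'd))\<^sup>2 / 2)) \<partial>lborel)"
    by (intro nn_integral_cmult) simp
  finally show ?thesis .
qed

text \<open>Read as a function of the Gaussian variable y, the event has period s = 1 / sqrt
  \<gamma>, because sqrt \<gamma> * s * n is an integer vector. The wide Gaussian in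
  \<open>exp_gaussian_shift_le\<close> therefore costs only a constant \<open>C\<close> by
  \<open>periodic_gaussian_comparison\<close>, and the additive error becomes a relative
  one.\<close>

lemma K_harnack:
  fixes b :: "'d::finite torus \<Rightarrow> real ^ 'd"
  assumes b: "continuous_on UNIV b" and \<gamma>: "\<gamma> > 0" and \<theta>: "\<theta> > 0"
  obtains \<delta> where "\<delta> > 0" and
    "\<And>x x' A. dist x' x < \<delta> \<Longrightarrow> A \<in> sets borel \<Longrightarrow>
      emeasure (K \<gamma> b x') A \<le> ennreal (1 + \<theta>) * emeasure (K \<gamma> b x) A"
proof -
  define s where "s = 1 / sqrt \<gamma>"
  have s: "s > 0" using \<gamma> by (simp add: s_def)
  obtain C :: real where C: "C \<ge> 0"
    "\<And>H :: real ^ 'd \<Rightarrow> ennreal. H \<in> borel_measurable borel \<Longrightarrow>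
      (\<And>y n. (\<And>i. n $ i \<in> \<int>) \<Longrightarrow> H (y + s *\<^sub>R n) = H y) \<Longrightarrow>
      (\<integral>\<^sup>+y. H y * ennreal (exp (- (norm y)\<^sup>2 / 4)) \<partial>lborel)
        \<le> ennreal C * (\<integral>\<^sup>+y. H y * ennreal (exp (- (norm y)\<^sup>2 / 2)) \<partial>lborel)"
    using periodic_gaussian_comparison[OF s] by blast
  \<comment> \<open>\<tau> bounds the admissible shift of y: at most 1 for
    \<open>exp_gaussian_shift_le\<close>, and small enough that the error \<tau> exp 4 C stays below
    \<theta>. The summand 1 keeps the denominator positive if C = 0.\<close>
  define \<tau> where "\<tau> = min 1 (\<theta> / (exp 4 * C + 1))"
  have \<tau>: "\<tau> > 0" "\<tau> \<le> 1" "\<tau> * exp 4 * C \<le> \<theta>"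
  proof -
    show "\<tau> > 0" "\<tau> \<le> 1" using \<theta> C(1) by (auto simp: \<tau>_def intro!: divide_pos_pos add_nonneg_pos)
    have "\<tau> * exp 4 * C \<le> (\<theta> / (exp 4 * C + 1)) * (exp 4 * C + 1)"
      unfolding mult.assoc using \<theta> C(1) by (intro mult_mono) (auto simp: \<tau>_def)
    also have "\<dots> = \<theta>"
      using add_nonneg_pos[of "exp 4 * C" 1] C(1) by (simp del: exp_gt_zero)
    finally show "\<tau> * exp 4 * C \<le> \<theta>" .
  qed
  have "uniformly_continuous_on UNIV b"
    by (rule compact_uniformly_continuous[OF b compact_UNIV_torus])
  moreover have "sqrt \<gamma> * \<tau> / (2 * \<gamma>) > 0" using \<gamma> \<tau> by simp
  ultimately obtain d where d: "d > 0" "\<And>x x'. dist x' x < d \<Longrightarrow> dist (b x') (b x) < sqrt \<gamma> * \<tau> / (2 * \<gamma>)"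
    unfolding uniformly_continuous_on_def by (metis UNIV_I)
  show ?thesis
  proof (rule that)
    show "min d (sqrt \<gamma> * \<tau> / 2) > 0" using d \<gamma> \<tau> by simp
    fix x x' :: "'d torus" and A
    assume dist: "dist x' x < min d (sqrt \<gamma> * \<tau> / 2)" and A[measurable]: "A \<in> sets (borel :: 'd torus measure)"
    obtain u where u: "x' = x + to_torus u" "norm u < sqrt \<gamma> * \<tau> / 2"
      using dist by (elim dist_torus_approx[of x' x "sqrt \<gamma> * \<tau> / 2", rotated]) auto
    \<comment> \<open>Starting at x' instead of x amounts to shifting the Gaussian variable by
      \<open>w\<close>. The displacement u and the change of the drift each contribute at most
      \<tau>/2; uniform continuity of b makes this uniform in x.\<close>
    define w where "w = (1 / sqrt \<gamma>) *\<^sub>R (u + \<gamma> *\<^sub>R (b x' - b x))"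
    have w: "norm w \<le> \<tau>"
    proof -
      have "norm (u + \<gamma> *\<^sub>R (b x' - b x)) \<le> norm u + \<gamma> * norm (b x' - b x)"
        using \<gamma> by (intro norm_triangle_ineq[THEN order_trans]) simp
      also have "\<dots> \<le> sqrt \<gamma> * \<tau> / 2 + \<gamma> * (sqrt \<gamma> * \<tau> / (2 * \<gamma>))"
        using u d(2)[of x' x] dist \<gamma> by (intro add_mono mult_left_mono) (auto simp: dist_norm)
      also have "\<dots> = sqrt \<gamma> * \<tau>" using \<gamma> by simp
      finally show ?thesis using \<gamma> by (simp add: w_def divide_le_eq mult.commute)
    qed
    define H where "H y = (indicator A (x + to_torus (\<gamma> *\<^sub>R b x + sqrt \<gamma> *\<^sub>R y)) :: ennreal)" for y
    have [measurable]: "H \<in> borel_measurable borel"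
    proof -
      have [measurable]: "(\<lambda>y. x + to_torus (\<gamma> *\<^sub>R b x + sqrt \<gamma> *\<^sub>R y)) \<in> borel \<rightarrow>\<^sub>M borel"
        by (intro borel_measurable_continuous_onI continuous_intros)
      show ?thesis unfolding H_def by measurable
    qed
    have periodic: "H (y + s *\<^sub>R n) = H y" if "\<And>i. n $ i \<in> \<int>" for y n
    proof -
      have "\<gamma> *\<^sub>R b x + sqrt \<gamma> *\<^sub>R (y + s *\<^sub>R n) = (\<gamma> *\<^sub>R b x + sqrt \<gamma> *\<^sub>R y) + n"
        using \<gamma> by (simp add: s_def algebra_simps)
      then show ?thesis
        unfolding H_def by (simp only: to_torus_add[of _ n] to_torus_of_int[OF that] add_0_right)
    qed
    have shift: "indicator A (x' + to_torus (\<gamma> *\<^sub>R b x' + sqrt \<gamma> *\<^sub>R y)) = H (w + y)" for y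
    proof -
      have "u + (\<gamma> *\<^sub>R b x' + sqrt \<gamma> *\<^sub>R y) = \<gamma> *\<^sub>R b x + sqrt \<gamma> *\<^sub>R (w + y)"
        using \<gamma> by (simp add: w_def algebra_simps)
      then have "x' + to_torus (\<gamma> *\<^sub>R b x' + sqrt \<gamma> *\<^sub>R y) = x + to_torus (\<gamma> *\<^sub>R b x + sqrt \<gamma> *\<^sub>R (w + y))"
        unfolding u(1) by (metis add.assoc to_torus_add)
      then show ?thesis by (simp add: H_def)
    qed
    let ?c = "ennreal ((2 * pi) powr (- real CARD('d) / 2))"
    let ?I = "\<integral>\<^sup>+y. H y * ennreal (exp (- (norm y)\<^sup>2 / 2)) \<partial>lborel"
    have "(\<integral>\<^sup>+y. H (w + y) * ennreal (exp (- (norm y)\<^sup>2 / 2)) \<partial>lborel)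
      = (\<integral>\<^sup>+y. H y * ennreal (exp (- (norm (y - w))\<^sup>2 / 2)) \<partial>lborel)"
      using nn_integral_lborel_translate[of "\<lambda>y. H y * ennreal (exp (- (norm (y - w))\<^sup>2 / 2))" w] by simp
    also have "\<dots> \<le> (\<integral>\<^sup>+y. H y * ennreal (exp (- (norm y)\<^sup>2 / 2)) +
        ennreal (\<tau> * exp 4) * (H y * ennreal (exp (- (norm y)\<^sup>2 / 4))) \<partial>lborel)"
    proof (intro nn_integral_mono)
      fix y
      have "exp (- (norm (y - w))\<^sup>2 / 2)
        \<le> exp (- (norm y)\<^sup>2 / 2) + norm w * exp 4 * exp (- (norm y)\<^sup>2 / 4)"
        using w \<tau> by (intro exp_gaussian_shift_le) simp
      also have "\<dots> \<le> exp (- (norm y)\<^sup>2 / 2) + \<tau> * exp 4 * exp (- (norm y)\<^sup>2 / 4)"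
        using w by (intro add_left_mono mult_right_mono) auto
      finally have "H y * ennreal (exp (- (norm (y - w))\<^sup>2 / 2))
        \<le> H y * ennreal (exp (- (norm y)\<^sup>2 / 2) + \<tau> * exp 4 * exp (- (norm y)\<^sup>2 / 4))"
        by (intro mult_left_mono ennreal_leI) auto
      then show "H y * ennreal (exp (- (norm (y - w))\<^sup>2 / 2)) \<le> H y * ennreal (exp (- (norm y)\<^sup>2 / 2)) +
        ennreal (\<tau> * exp 4) * (H y * ennreal (exp (- (norm y)\<^sup>2 / 4)))"
        using \<tau> by (simp add: ennreal_mult distrib_left ac_simps)
    qed
    also have "\<dots> = ?I + ennreal (\<tau> * exp 4) * (\<integral>\<^sup>+y. H y * ennreal (exp (- (norm y)\<^sup>2 / 4)) \<partial>lborel)"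
      by (subst nn_integral_add) (auto simp: nn_integral_cmult)
    also have "\<dots> \<le> ?I + ennreal (\<tau> * exp 4) * (ennreal C * ?I)"
      using periodic by (intro add_left_mono mult_left_mono C(2)) auto
    also have "\<dots> = ennreal (1 + \<tau> * exp 4 * C) * ?I"
      using \<tau> C(1) by (simp add: ennreal_mult distrib_right mult.assoc)
    also have "\<dots> \<le> ennreal (1 + \<theta>) * ?I"
      using \<tau> by (intro mult_right_mono ennreal_leI) auto
    finally have "?c * (\<integral>\<^sup>+y. H (w + y) * ennreal (exp (- (norm y)\<^sup>2 / 2)) \<partial>lborel)
      \<le> ?c * (ennreal (1 + \<theta>) * ?I)" by (intro mult_left_mono) auto
    then show "emeasure (K \<gamma> b x') A \<le> ennreal (1 + \<theta>) * emeasure (K \<gamma> b x) A"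
      unfolding emeasure_K[OF b A] shift H_def[symmetric] by (simp add: ac_simps)
  qed
qed

subsection \<open>The selection step\<close>


text \<open>\<open>D\<close> is failure of a trial and \<open>E\<close> success with a prescribed
  outcome, so they are disjoint without being complementary. Summing over the index of the first
  success gives a geometric series in the failure probability of the later trials; the trial of
  index 0 is split off since it has its own law.\<close>

lemma emeasure_first_success:
  fixes M :: "nat \<Rightarrow> 'a measure"
  assumes prob: "\<And>i. prob_space (M i)"
    and M: "M 0 = M0" "\<And>i. M (Suc i) = M1"
    and sets: "D \<in> sets M0" "E \<in> sets M0" "D \<in> sets M1" "E \<in> sets M1"
    and disjoint: "D \<inter> E = {}"
  shows "emeasure (PiM UNIV M) (\<Union>k. {\<omega>\<in>space (PiM UNIV M). (\<forall>j<k. \<omega> j \<in> D) \<and> \<omega> k \<in> E})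
    = emeasure M0 E + emeasure M0 D * (emeasure M1 E * (\<Sum>k. emeasure M1 D ^ k))"
proof -
  interpret product_prob_space M UNIV by (rule product_prob_spaceI) (rule prob)
  define F where "F k = {\<omega>\<in>space (PiM UNIV M). (\<forall>j<k. \<omega> j \<in> D) \<and> \<omega> k \<in> E}" for k
  define X where "X k j = (if j < k then D else E)" for k j :: nat
  have Xs: "X k j \<in> sets (M j)" for k j
    using sets M by (cases j) (auto simp: X_def)
  have F: "F k = {\<omega>\<in>space (PiM UNIV M). \<forall>j\<in>{..k}. \<omega> j \<in> X k j}" for k
    unfolding F_def X_def by (auto simp: le_less)
  have emF: "emeasure (PiM UNIV M) (F k) = (\<Prod>j\<le>k. emeasure (M j) (X k j))" for k
    unfolding F by (rule emeasure_PiM_Collect) (auto simp: Xs)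
  have F0: "emeasure (PiM UNIV M) (F 0) = emeasure M0 E"
    unfolding emF by (simp add: M X_def)
  have FS: "emeasure (PiM UNIV M) (F (Suc k)) = emeasure M0 D * (emeasure M1 E * emeasure M1 D ^ k)" for k
  proof -
    have "emeasure (PiM UNIV M) (F (Suc k)) = emeasure M0 D * (\<Prod>j\<le>k. emeasure M1 (X (Suc k) (Suc j)))"
      unfolding emF by (subst prod.atMost_Suc_shift) (simp add: M X_def)
    also have "(\<Prod>j\<le>k. emeasure M1 (X (Suc k) (Suc j))) = emeasure M1 D ^ k * emeasure M1 E"
      unfolding lessThan_Suc_atMost[symmetric] by (simp add: X_def)
    finally show ?thesis by (simp add: mult.commute)
  qed
  have "F k \<in> sets (PiM UNIV M)" for k
  proof -
    have "F k = (\<Inter>j\<in>{..k}. (\<lambda>\<omega>. \<omega> j) -` X k j \<inter> space (PiM UNIV M))"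
      unfolding F by auto
    then show ?thesis
      using Xs by (auto intro!: sets.finite_INT measurable_sets[OF measurable_component_singleton])
  qed
  moreover have "disjoint_family F"
    unfolding disjoint_family_on_def F_def using disjoint by (auto simp: nat_neq_iff)
  ultimately have "emeasure (PiM UNIV M) (\<Union>k. F k) = (\<Sum>k. emeasure (PiM UNIV M) (F k))"
    by (subst suminf_emeasure) auto
  also have "\<dots> = emeasure (PiM UNIV M) (F 0) + (\<Sum>k. emeasure (PiM UNIV M) (F (Suc k)))"
    by (subst suminf_offset[of _ 1]) (simp_all add: add.commute)
  also have "\<dots> = emeasure M0 E + emeasure M0 D * (emeasure M1 E * (\<Sum>k. emeasure M1 D ^ k))"
    unfolding F0 FS by simp
  finally show ?thesis by (simp add: F_def)
qed

lemma suminf_power_ennreal: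
  assumes "q + z = 1" "z > 0"
  shows "(\<Sum>k. q ^ k) = 1 / (z :: ennreal)"
proof -
  have "q \<noteq> \<top>" "z \<noteq> \<top>" using assms(1) by (auto simp: top_add)
  then obtain a b where ab: "q = ennreal a" "z = ennreal b" "a \<ge> 0" "b \<ge> 0"
    by (metis ennreal_cases)
  have "a + b = 1" "b > 0"
    using assms ab by (simp_all add: ennreal_plus[symmetric] del: ennreal_plus)
  moreover from this have "1 - a = b" by linarith
  ultimately have "(\<lambda>k. a ^ k) sums (1 / b)" using geometric_sums[of a] ab by simp
  then have "(\<Sum>k. ennreal (a ^ k)) = ennreal (1 / b)"
    using ab(3) by (intro suminf_ennreal_eq) auto
  also have "\<dots> = ennreal 1 / ennreal b"
    using \<open>b > 0\<close> by (intro divide_ennreal[symmetric]) auto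
  finally show ?thesis unfolding ab(1,2) ennreal_power[OF ab(3)] by simp
qed

text \<open>Left unnormalised: the part of the law \<nu> that survives selection. For a probability
  measure its total mass is 1 minus \<open>loss\<close>, and the conditioned law is obtained later
  by an explicit division.\<close>

definition tilt :: "real \<Rightarrow> ('d::finite torus \<Rightarrow> real) \<Rightarrow> 'd torus measure \<Rightarrow> 'd torus measure" where
  "tilt \<gamma> l \<nu> = density \<nu> (\<lambda>z. ennreal (exp (- \<gamma> * l z)))"

definition loss :: "real \<Rightarrow> ('d::finite torus \<Rightarrow> real) \<Rightarrow> 'd torus measure \<Rightarrow> ennreal" where
  "loss \<gamma> l \<nu> = (\<integral>\<^sup>+z. ennreal (death_prob \<gamma> l z) \<partial>\<nu>)"

lemma prob_space_uniform_unit: "prob_space (uniform_measure lborel {0..1 :: real})"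
  by (rule prob_space_uniform_measure) simp_all

lemma emeasure_uniform_unit:
  assumes "A \<in> sets borel"
  shows "emeasure (uniform_measure lborel {0..1 :: real}) A = emeasure lborel ({0..1} \<inter> A)"
  using assms by (subst emeasure_uniform_measure) (simp_all add: divide_ennreal_def)

lemma death_prob_bounds:
  assumes "\<gamma> \<ge> 0" "0 \<le> l z"
  shows "0 \<le> death_prob \<gamma> l z" "death_prob \<gamma> l z < 1" "death_prob \<gamma> l z + exp (- \<gamma> * l z) = 1"
  using assms by (simp_all add: death_prob_def)

lemma death_prob_measurable [measurable]:
  "l \<in> borel_measurable borel \<Longrightarrow> death_prob \<gamma> l \<in> borel_measurable borel"
  unfolding death_prob_def[abs_def] by measurable

context
  fixes \<gamma> :: real and l :: "'d::finite torus \<Rightarrow> real"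
  assumes \<gamma>: "\<gamma> > 0" and l_nonneg: "\<And>x. 0 \<le> l x" and l_meas[measurable]: "l \<in> borel_measurable borel"
begin

text \<open>The uniform variable is integrated out first: since p(z) lies in [0,1), it falls below
  p(z) with probability exactly p(z), and the complementary probability is
  \<open>exp (- \<gamma> * l z)\<close>. The surviving mass is positive because this integrand
  vanishes nowhere.\<close>

lemma
  fixes \<nu> :: "'d torus measure"
  assumes "\<nu> \<in> space (prob_algebra borel)"
  shows emeasure_death_event:
      "emeasure (\<nu> \<Otimes>\<^sub>M uniform_measure lborel {0..1}) {w. snd w < death_prob \<gamma> l (fst w)} = loss \<gamma> l \<nu>"
    and emeasure_survival_event: "A \<in> sets borel \<Longrightarrow>
      emeasure (\<nu> \<Otimes>\<^sub>M uniform_measure lborel {0..1}) {w. fst w \<in> A \<and> death_prob \<gamma> l (fst w) \<le> snd w}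
        = emeasure (tilt \<gamma> l \<nu>) A"
    and loss_add_tilt: "loss \<gamma> l \<nu> + emeasure (tilt \<gamma> l \<nu>) UNIV = 1"
    and emeasure_tilt_pos: "emeasure (tilt \<gamma> l \<nu>) UNIV > 0"
proof -
  let ?U = "uniform_measure lborel {0..1 :: real}"
  interpret U: prob_space ?U by (rule prob_space_uniform_unit)
  have sets_\<nu>[measurable_cong]: "sets \<nu> = sets borel" and prob: "prob_space \<nu>"
    using assms by (auto simp: space_prob_algebra)
  have sets_pair[measurable_cong]: "sets (\<nu> \<Otimes>\<^sub>M ?U) = sets (borel \<Otimes>\<^sub>M borel)"
    by (intro sets_pair_measure_cong) (simp_all add: sets_\<nu>)
  have space_\<nu>: "space \<nu> = UNIV" using sets_\<nu> by (metis sets_eq_imp_space_eq space_borel)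
  note p = death_prob_bounds[of \<gamma> l, OF less_imp_le[OF \<gamma>] l_nonneg]
  have "{w \<in> space (borel \<Otimes>\<^sub>M borel :: ('d torus \<times> real) measure). snd w < death_prob \<gamma> l (fst w)} \<in> sets (borel \<Otimes>\<^sub>M borel)"
    by measurable
  then have "emeasure (\<nu> \<Otimes>\<^sub>M ?U) {w. snd w < death_prob \<gamma> l (fst w)}
    = (\<integral>\<^sup>+z. emeasure ?U {..<death_prob \<gamma> l z} \<partial>\<nu>)"
    by (subst U.emeasure_pair_measure_alt)
      (auto simp: sets_pair space_pair_measure lessThan_def atLeast_def intro!: nn_integral_cong arg_cong2[where f=emeasure])
  also have "\<dots> = loss \<gamma> l \<nu>"
    unfolding loss_def
  proof (intro nn_integral_cong)
    fix z
    have "{0..1} \<inter> {..<death_prob \<gamma> l z} = {0..<death_prob \<gamma> l z}" using p(2)[of z] by auto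
    then show "emeasure ?U {..<death_prob \<gamma> l z} = ennreal (death_prob \<gamma> l z)"
      using p(1)[of z] by (subst emeasure_uniform_unit) auto
  qed
  finally show "emeasure (\<nu> \<Otimes>\<^sub>M ?U) {w. snd w < death_prob \<gamma> l (fst w)} = loss \<gamma> l \<nu>" .
  show "emeasure (\<nu> \<Otimes>\<^sub>M ?U) {w. fst w \<in> A \<and> death_prob \<gamma> l (fst w) \<le> snd w}
      = emeasure (tilt \<gamma> l \<nu>) A" if A[measurable]: "A \<in> sets borel" for A
  proof -
    have "{w \<in> space (borel \<Otimes>\<^sub>M borel :: ('d torus \<times> real) measure). fst w \<in> A \<and> death_prob \<gamma> l (fst w) \<le> snd w} \<in> sets (borel \<Otimes>\<^sub>M borel)"
      by measurable
    then have "emeasure (\<nu> \<Otimes>\<^sub>M ?U) {w. fst w \<in> A \<and> death_prob \<gamma> l (fst w) \<le> snd w}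
      = (\<integral>\<^sup>+z. emeasure ?U (if z \<in> A then {death_prob \<gamma> l z..} else {}) \<partial>\<nu>)"
      by (subst U.emeasure_pair_measure_alt)
        (auto simp: sets_pair space_pair_measure lessThan_def atLeast_def intro!: nn_integral_cong arg_cong2[where f=emeasure])
    also have "\<dots> = (\<integral>\<^sup>+z. ennreal (exp (- \<gamma> * l z)) * indicator A z \<partial>\<nu>)"
    proof (intro nn_integral_cong)
      fix z
      have "{0..1} \<inter> {death_prob \<gamma> l z..} = {death_prob \<gamma> l z..1}" using p(1)[of z] by auto
      moreover have "1 - death_prob \<gamma> l z = exp (- \<gamma> * l z)" by (simp add: death_prob_def)
      ultimately show "emeasure ?U (if z \<in> A then {death_prob \<gamma> l z..} else {})
          = ennreal (exp (- \<gamma> * l z)) * indicator A z"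
        using p(2)[of z] by (simp add: emeasure_uniform_unit divide_ennreal_def)
    qed
    also have "\<dots> = emeasure (tilt \<gamma> l \<nu>) A"
      unfolding tilt_def by (subst emeasure_density) (simp_all add: sets_\<nu>)
    finally show ?thesis .
  qed
  have tilt_UNIV: "emeasure (tilt \<gamma> l \<nu>) UNIV = (\<integral>\<^sup>+z. ennreal (exp (- \<gamma> * l z)) \<partial>\<nu>)"
    unfolding tilt_def by (subst emeasure_density) (simp_all add: sets_\<nu>)
  have "loss \<gamma> l \<nu> + emeasure (tilt \<gamma> l \<nu>) UNIV
    = (\<integral>\<^sup>+z. ennreal (death_prob \<gamma> l z) + ennreal (exp (- \<gamma> * l z)) \<partial>\<nu>)"
    unfolding loss_def tilt_UNIV by (subst nn_integral_add) simp_all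
  also have "\<dots> = (\<integral>\<^sup>+z. 1 \<partial>\<nu>)"
    using p by (intro nn_integral_cong) (simp add: ennreal_plus[symmetric] del: ennreal_plus)
  also have "\<dots> = 1" using prob by (simp add: prob_space.emeasure_space_1)
  finally show "loss \<gamma> l \<nu> + emeasure (tilt \<gamma> l \<nu>) UNIV = 1" .
  show "emeasure (tilt \<gamma> l \<nu>) UNIV > 0"
  proof (rule ccontr)
    assume "\<not> ?thesis"
    then have "(\<integral>\<^sup>+z. ennreal (exp (- \<gamma> * l z)) \<partial>\<nu>) = 0" unfolding tilt_UNIV by simp
    then have "AE z in \<nu>. False" by (subst (asm) nn_integral_0_iff_AE) auto
    then show False using prob prob_space.AE_False by metis
  qed
qed

end


lemma prob_algebra_bind:
  "\<mu> \<in> space (prob_algebra M) \<Longrightarrow> k \<in> M \<rightarrow>\<^sub>M prob_algebra N \<Longrightarrow> \<mu> \<bind> k \<in> space (prob_algebra N)"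
  by (simp add: space_prob_algebra prob_space_bind' sets_bind')

lemma sets_K [simp]: "sets (K \<gamma> b x) = sets borel"
  by (simp add: K_def)

lemma sets_Q [simp]: "sets (Q \<gamma> b l \<mu> x) = sets borel"
  by (simp add: Q_def)

context
  fixes \<gamma> :: real and l :: "'d::finite torus \<Rightarrow> real" and b :: "'d torus \<Rightarrow> real ^ 'd"
  assumes \<gamma>: "\<gamma> > 0" and l_nonneg: "\<And>x. 0 \<le> l x" and l_meas[measurable]: "l \<in> borel_measurable borel"
    and b: "continuous_on UNIV b"
begin

text \<open>Only a lower bound is computed: the events that trial k is the first survivor and lands
  in A are disjoint and contained in the preimage of A, and their probabilities add up to the
  right-hand side. That side has total mass 1, and so has \<open>Q\<close>, so the lower bounds for
  A and its complement force equality. The value of \<open>survivor\<close> when no trial survives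
  thus never has to be examined.\<close>

lemma
  assumes \<mu>: "\<mu> \<in> space (prob_algebra borel)"
  shows prob_space_Q: "prob_space (Q \<gamma> b l \<mu> x)"
    and emeasure_Q: "A \<in> sets borel \<Longrightarrow> emeasure (Q \<gamma> b l \<mu> x) A =
      emeasure (tilt \<gamma> l (K \<gamma> b x)) A + loss \<gamma> l (K \<gamma> b x) *
        (emeasure (tilt \<gamma> l (\<mu> \<bind> K \<gamma> b)) A / emeasure (tilt \<gamma> l (\<mu> \<bind> K \<gamma> b)) UNIV)"
proof -
  let ?U = "uniform_measure lborel {0..1 :: real}"
  note [measurable] = death_prob_measurable[OF l_meas]
  define M where "M k = (if k = 0 then K \<gamma> b x else \<mu> \<bind> K \<gamma> b) \<Otimes>\<^sub>M ?U" for k :: nat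
  define \<nu> where "\<nu> = \<mu> \<bind> K \<gamma> b"
  have Kx: "K \<gamma> b x \<in> space (prob_algebra borel)"
    using measurable_space[OF measurable_K[OF b]] by simp
  have \<nu>: "\<nu> \<in> space (prob_algebra borel)"
    unfolding \<nu>_def by (rule prob_algebra_bind[OF \<mu> measurable_K[OF b]])
  note tilt_props = loss_add_tilt[OF \<gamma> l_nonneg l_meas] emeasure_tilt_pos[OF \<gamma> l_nonneg l_meas]
  have prob: "prob_space (M k)" for k
    using Kx \<nu> unfolding M_def \<nu>_def[symmetric]
    by (auto simp: space_prob_algebra intro!: prob_space_pair prob_space_uniform_unit)
  have sets_M: "sets (M k) = sets (borel \<Otimes>\<^sub>M borel)" for k
    using \<nu> unfolding M_def \<nu>_def[symmetric]
    by (intro sets_pair_measure_cong) (auto simp: space_prob_algebra)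
  have trials: "trials \<gamma> b \<mu> x = PiM UNIV M"
    unfolding trials_def M_def by simp
  have sets_trials: "sets (PiM UNIV M) = sets (PiM UNIV (\<lambda>_. borel \<Otimes>\<^sub>M borel))"
    by (intro sets_PiM_cong) (simp_all add: sets_M)
  have space_trials: "space (PiM UNIV M) = UNIV"
    using sets_eq_imp_space_eq[OF sets_trials] by (simp add: space_PiM space_pair_measure)
  have prob_trials: "prob_space (PiM UNIV M)" by (intro prob_space_PiM prob)
  have survivor: "survivor \<gamma> l = (\<lambda>\<omega>. LEAST k. death_prob \<gamma> l (fst (\<omega> k)) \<le> snd (\<omega> k))"
    by (auto simp: survivor_def Inf_nat_def)
  have "(\<lambda>\<omega>. fst (\<omega> (survivor \<gamma> l \<omega>))) \<in> PiM UNIV (\<lambda>_. borel \<Otimes>\<^sub>M borel) \<rightarrow>\<^sub>M borel"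
  proof (rule measurable_compose_countable)
    show "(\<lambda>\<omega>. fst (\<omega> i)) \<in> PiM UNIV (\<lambda>_. borel \<Otimes>\<^sub>M borel) \<rightarrow>\<^sub>M (borel :: 'd torus measure)" for i :: nat
      by measurable
    show "survivor \<gamma> l \<in> PiM UNIV (\<lambda>_. borel \<Otimes>\<^sub>M borel) \<rightarrow>\<^sub>M count_space UNIV"
      unfolding survivor by measurable
  qed
  then have X[measurable]: "(\<lambda>\<omega>. fst (\<omega> (survivor \<gamma> l \<omega>))) \<in> PiM UNIV M \<rightarrow>\<^sub>M borel"
    using measurable_cong_sets[OF sets_trials refl] by blast
  show prob_Q: "prob_space (Q \<gamma> b l \<mu> x)"
    unfolding Q_def trials by (intro prob_space.prob_space_distr prob_trials X)
  define R where "R A = emeasure (tilt \<gamma> l (K \<gamma> b x)) A + loss \<gamma> l (K \<gamma> b x) *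
      (emeasure (tilt \<gamma> l \<nu>) A / emeasure (tilt \<gamma> l \<nu>) UNIV)" for A
  have lower: "R A \<le> emeasure (Q \<gamma> b l \<mu> x) A" if A[measurable]: "A \<in> sets borel" for A
  proof -
    let ?D = "{w :: 'd torus \<times> real. snd w < death_prob \<gamma> l (fst w)}"
    let ?E = "{w :: 'd torus \<times> real. fst w \<in> A \<and> death_prob \<gamma> l (fst w) \<le> snd w}"
    have "{w \<in> space (borel \<Otimes>\<^sub>M borel :: ('d torus \<times> real) measure). snd w < death_prob \<gamma> l (fst w)}
        \<in> sets (borel \<Otimes>\<^sub>M borel)"
      "{w \<in> space (borel \<Otimes>\<^sub>M borel :: ('d torus \<times> real) measure). fst w \<in> A \<and> death_prob \<gamma> l (fst w) \<le> snd w}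
        \<in> sets (borel \<Otimes>\<^sub>M borel)"
      by measurable
    then have DE: "?D \<in> sets (M k)" "?E \<in> sets (M k)" for k
      by (simp_all add: sets_M space_pair_measure)
    have "emeasure (PiM UNIV M) (\<Union>k. {\<omega>\<in>space (PiM UNIV M). (\<forall>j<k. \<omega> j \<in> ?D) \<and> \<omega> k \<in> ?E})
      = emeasure (M 0) ?E + emeasure (M 0) ?D * (emeasure (M 1) ?E * (\<Sum>k. emeasure (M 1) ?D ^ k))"
      by (rule emeasure_first_success) (auto simp: prob DE, simp add: M_def)
    also have "\<dots> = R A"
      using emeasure_death_event[OF \<gamma> l_nonneg l_meas Kx] emeasure_survival_event[OF \<gamma> l_nonneg l_meas Kx A]
        emeasure_death_event[OF \<gamma> l_nonneg l_meas \<nu>] emeasure_survival_event[OF \<gamma> l_nonneg l_meas \<nu> A]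
        suminf_power_ennreal[OF tilt_props[OF \<nu>]]
      unfolding R_def M_def \<nu>_def[symmetric] by (simp add: ennreal_times_divide)
    finally have "R A = emeasure (PiM UNIV M) (\<Union>k. {\<omega>\<in>space (PiM UNIV M). (\<forall>j<k. \<omega> j \<in> ?D) \<and> \<omega> k \<in> ?E})"
      by simp
    also have "\<dots> \<le> emeasure (PiM UNIV M) ((\<lambda>\<omega>. fst (\<omega> (survivor \<gamma> l \<omega>))) -` A \<inter> space (PiM UNIV M))"
    proof (intro emeasure_mono subsetI)
      fix \<omega> assume "\<omega> \<in> (\<Union>k. {\<omega>\<in>space (PiM UNIV M). (\<forall>j<k. \<omega> j \<in> ?D) \<and> \<omega> k \<in> ?E})"
      then obtain k where k: "\<And>j. j < k \<Longrightarrow> \<omega> j \<in> ?D" "\<omega> k \<in> ?E" by blast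
      have "survivor \<gamma> l \<omega> = k"
        unfolding survivor using k by (intro Least_equality) (auto simp: not_less[symmetric])
      then show "\<omega> \<in> (\<lambda>\<omega>. fst (\<omega> (survivor \<gamma> l \<omega>))) -` A \<inter> space (PiM UNIV M)"
        using k by (simp add: space_trials)
    qed (rule measurable_sets[OF X A])
    also have "\<dots> = emeasure (Q \<gamma> b l \<mu> x) A"
      unfolding Q_def trials by (rule emeasure_distr[symmetric]) (rule X, rule A)
    finally show ?thesis .
  qed
  show "emeasure (Q \<gamma> b l \<mu> x) A =
      emeasure (tilt \<gamma> l (K \<gamma> b x)) A + loss \<gamma> l (K \<gamma> b x) *
        (emeasure (tilt \<gamma> l (\<mu> \<bind> K \<gamma> b)) A / emeasure (tilt \<gamma> l (\<mu> \<bind> K \<gamma> b)) UNIV)"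
    if A[measurable]: "A \<in> sets borel" for A
  proof -
    have sets_tilt: "sets (tilt \<gamma> l (K \<gamma> b x)) = sets borel" "sets (tilt \<gamma> l \<nu>) = sets borel"
      using \<nu> by (auto simp: tilt_def space_prob_algebra)
    have fin: "emeasure (tilt \<gamma> l \<nu>) UNIV \<noteq> \<top>"
      using tilt_props(1)[OF \<nu>] by (auto simp: top_add add_top)
    have split: "emeasure N UNIV = emeasure N A + emeasure N (- A)"
      if "sets N = sets borel" for N :: "'d torus measure"
      using that A by (subst plus_emeasure) (auto simp: Compl_partition)
    have Q1: "emeasure (Q \<gamma> b l \<mu> x) UNIV = 1"
      using prob_space.emeasure_space_1[OF prob_Q] by (simp add: Q_def)
    have "R A + R (- A) = emeasure (tilt \<gamma> l (K \<gamma> b x)) UNIV + loss \<gamma> l (K \<gamma> b x) *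
        (emeasure (tilt \<gamma> l \<nu>) UNIV / emeasure (tilt \<gamma> l \<nu>) UNIV)"
      unfolding R_def split[OF sets_tilt(1)] split[OF sets_tilt(2)]
      by (simp add: add_divide_distrib_ennreal distrib_left ac_simps)
    also have "\<dots> = 1"
      using tilt_props(1)[OF Kx] tilt_props(2)[OF \<nu>] fin
      by (simp add: ennreal_divide_self less_top[symmetric] add.commute)
    finally have R1: "R A + R (- A) = 1" .
    \<comment> \<open>\<open>R (- A)\<close> is finite, being a summand of 1, and may be
      cancelled.\<close>
    have "emeasure (Q \<gamma> b l \<mu> x) A + R (- A) \<le> emeasure (Q \<gamma> b l \<mu> x) A + emeasure (Q \<gamma> b l \<mu> x) (- A)"
      by (intro add_left_mono lower) (use A in auto)
    also have "\<dots> = R A + R (- A)"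
      unfolding split[OF sets_Q, symmetric] Q1 R1 by simp
    finally have "emeasure (Q \<gamma> b l \<mu> x) A \<le> R A"
      using R1 by (auto simp: add.commute[of _ "R (- A)"] ennreal_add_left_cancel_le add_top top_add)
    then show ?thesis using lower[OF A] unfolding R_def \<nu>_def by simp
  qed
qed

lemma emeasure_tilt:
  assumes "sets \<nu> = sets borel" "A \<in> sets borel"
  shows "emeasure (tilt \<gamma> l \<nu>) A = (\<integral>\<^sup>+z. ennreal (exp (- \<gamma> * l z)) * indicator A z \<partial>\<nu>)"
  unfolding tilt_def using assms by (subst emeasure_density) (auto cong: measurable_cong_sets)

lemma measurable_tilt_aux:
  assumes N: "N \<in> M \<rightarrow>\<^sub>M prob_algebra borel"
  shows "A \<in> sets borel \<Longrightarrow> (\<lambda>x. emeasure (tilt \<gamma> l (N x)) A) \<in> borel_measurable M"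
    and "(\<lambda>x. loss \<gamma> l (N x)) \<in> borel_measurable M"
proof -
  note [measurable] = death_prob_measurable[OF l_meas] measurable_prob_algebraD[OF N]
  have "sets (N x) = sets borel" if "x \<in> space M" for x
    using measurable_space[OF N that] by (simp add: space_prob_algebra)
  then have "(\<lambda>x. emeasure (tilt \<gamma> l (N x)) A) \<in> borel_measurable M \<longleftrightarrow>
      (\<lambda>x. \<integral>\<^sup>+z. ennreal (exp (- \<gamma> * l z)) * indicator A z \<partial>N x) \<in> borel_measurable M"
    if "A \<in> sets borel" for A
    using that by (intro measurable_cong emeasure_tilt) auto
  then show "A \<in> sets borel \<Longrightarrow> (\<lambda>x. emeasure (tilt \<gamma> l (N x)) A) \<in> borel_measurable M" by simp
  show "(\<lambda>x. loss \<gamma> l (N x)) \<in> borel_measurable M"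
    unfolding loss_def by measurable
qed

text \<open>Both arguments vary because \<open>R\<close> evaluates \<open>Q\<close> at the empirical
  measure of the very configuration that supplies the starting points. Measurability is read off the
  closed formula \<open>emeasure_Q\<close> rather than from the infinite product.\<close>

lemma measurable_Q:
  assumes N: "N \<in> M \<rightarrow>\<^sub>M prob_algebra borel" and f: "f \<in> M \<rightarrow>\<^sub>M borel"
  shows "(\<lambda>x. Q \<gamma> b l (N x) (f x)) \<in> M \<rightarrow>\<^sub>M prob_algebra borel"
proof (rule measurable_prob_algebraI)
  have N': "N x \<in> space (prob_algebra borel)" if "x \<in> space M" for x
    using measurable_space[OF N that] .
  show "prob_space (Q \<gamma> b l (N x) (f x))" if "x \<in> space M" for x
    by (rule prob_space_Q[OF N'[OF that]])
  show "(\<lambda>x. Q \<gamma> b l (N x) (f x)) \<in> M \<rightarrow>\<^sub>M subprob_algebra borel"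
  proof (rule measurable_subprob_algebra)
    show "subprob_space (Q \<gamma> b l (N x) (f x))" if "x \<in> space M" for x
      by (rule prob_space_imp_subprob_space[OF prob_space_Q[OF N'[OF that]]])
    fix A :: "'d torus set" assume A: "A \<in> sets borel"
    have Kf: "(\<lambda>x. K \<gamma> b (f x)) \<in> M \<rightarrow>\<^sub>M prob_algebra borel"
      by (rule measurable_compose[OF f measurable_K[OF b]])
    have NK: "(\<lambda>x. N x \<bind> K \<gamma> b) \<in> M \<rightarrow>\<^sub>M prob_algebra borel"
      by (rule measurable_bind_prob_space[OF N measurable_K[OF b]])
    show "(\<lambda>x. emeasure (Q \<gamma> b l (N x) (f x)) A) \<in> borel_measurable M"
      using A measurable_tilt_aux[OF Kf] measurable_tilt_aux[OF NK]
      by (subst measurable_cong[OF emeasure_Q[OF N' A]]) (auto intro!: borel_measurable_times_ennreal borel_measurable_divide_ennreal borel_measurable_add)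
  qed simp
qed

lemma measurable_Q_const:
  assumes "\<mu> \<in> space (prob_algebra borel)"
  shows "Q \<gamma> b l \<mu> \<in> borel \<rightarrow>\<^sub>M prob_algebra borel"
  using measurable_Q[OF measurable_const[OF assms] measurable_ident] by (simp add: id_def)

text \<open>When the start is drawn from \<mu>, the first candidate has the same law \<mu>K as all
  later ones. With surviving mass Z and loss 1 - Z, the two terms t and (1 - Z) t/Z add up to t/Z,
  which is conditioning on survival.\<close>

lemma emeasure_bind_Q:
  assumes \<mu>: "\<mu> \<in> space (prob_algebra borel)" and A[measurable]: "A \<in> sets borel"
  shows "emeasure (\<mu> \<bind> Q \<gamma> b l \<mu>) A =
    emeasure (tilt \<gamma> l (\<mu> \<bind> K \<gamma> b)) A / emeasure (tilt \<gamma> l (\<mu> \<bind> K \<gamma> b)) UNIV"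
proof -
  define \<nu> where "\<nu> = \<mu> \<bind> K \<gamma> b"
  note [measurable] = death_prob_measurable[OF l_meas]
  have sets_\<mu>: "sets \<mu> = sets borel" using \<mu> by (simp add: space_prob_algebra)
  have K: "K \<gamma> b \<in> borel \<rightarrow>\<^sub>M prob_algebra borel" by (rule measurable_K[OF b])
  have K': "K \<gamma> b \<in> \<mu> \<rightarrow>\<^sub>M subprob_algebra borel"
    using measurable_prob_algebraD[OF K] measurable_cong_sets[OF sets_\<mu> refl] by blast
  have \<nu>: "\<nu> \<in> space (prob_algebra borel)" unfolding \<nu>_def by (rule prob_algebra_bind[OF \<mu> K])
  have t: "(\<integral>\<^sup>+x. emeasure (tilt \<gamma> l (K \<gamma> b x)) A \<partial>\<mu>) = emeasure (tilt \<gamma> l \<nu>) A"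
    using \<nu> unfolding \<nu>_def
    by (simp add: emeasure_tilt space_prob_algebra nn_integral_bind[OF _ K'])
  have p: "(\<integral>\<^sup>+x. loss \<gamma> l (K \<gamma> b x) \<partial>\<mu>) = loss \<gamma> l \<nu>"
    unfolding \<nu>_def loss_def by (simp add: nn_integral_bind[OF _ K'])
  have meas: "(\<lambda>x. emeasure (tilt \<gamma> l (K \<gamma> b x)) A) \<in> borel_measurable \<mu>"
    "(\<lambda>x. loss \<gamma> l (K \<gamma> b x)) \<in> borel_measurable \<mu>"
    using measurable_tilt_aux[OF K] A by (simp_all cong: measurable_cong_sets add: sets_\<mu>)
  let ?t = "emeasure (tilt \<gamma> l \<nu>) A" and ?Z = "emeasure (tilt \<gamma> l \<nu>) UNIV"
  have Z: "loss \<gamma> l \<nu> + ?Z = 1" "?Z > 0"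
    using loss_add_tilt[OF \<gamma> l_nonneg l_meas \<nu>] emeasure_tilt_pos[OF \<gamma> l_nonneg l_meas \<nu>] by auto
  then have fin: "?Z \<noteq> \<top>" by (auto simp: top_add add_top)
  have "emeasure (\<mu> \<bind> Q \<gamma> b l \<mu>) A = (\<integral>\<^sup>+x. emeasure (Q \<gamma> b l \<mu> x) A \<partial>\<mu>)"
    by (rule emeasure_bind_prob_algebra[OF \<mu> measurable_Q_const[OF \<mu>] A])
  also have "\<dots> = (\<integral>\<^sup>+x. emeasure (tilt \<gamma> l (K \<gamma> b x)) A + loss \<gamma> l (K \<gamma> b x) * (?t / ?Z) \<partial>\<mu>)"
    unfolding emeasure_Q[OF \<mu> A] \<nu>_def ..
  also have "\<dots> = ?t + loss \<gamma> l \<nu> * (?t / ?Z)"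
    using meas by (subst nn_integral_add) (auto simp: nn_integral_multc t p)
  also have "\<dots> = (?Z + loss \<gamma> l \<nu>) * (?t / ?Z)"
  proof -
    have "?Z * (?t / ?Z) = ?t"
      using Z fin by (simp add: ennreal_times_divide mult.commute[of ?Z] mult_divide_eq_ennreal)
    then show ?thesis by (simp only: distrib_right)
  qed
  also have "\<dots> = ?t / ?Z" using Z by (simp add: add.commute)
  finally show ?thesis by (simp add: \<nu>_def)
qed

end

subsection \<open>Couplings and particle systems\<close>


lemma couplingsD:
  assumes "P \<in> couplings M \<mu> \<nu>"
  shows "prob_space P" "sets P = sets (M \<Otimes>\<^sub>M M)" "distr P M fst = \<mu>" "distr P M snd = \<nu>"
  using assms by (auto simp: couplings_def space_prob_algebra)

lemma pair_measure_in_couplings: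
  assumes "\<mu> \<in> space (prob_algebra M)" "\<nu> \<in> space (prob_algebra M)"
  shows "\<mu> \<Otimes>\<^sub>M \<nu> \<in> couplings M \<mu> \<nu>"
proof -
  have prob: "prob_space \<mu>" "prob_space \<nu>" and sets: "sets \<mu> = sets M" "sets \<nu> = sets M"
    using assms by (auto simp: space_prob_algebra)
  interpret \<mu>: prob_space \<mu> by fact
  interpret \<nu>: prob_space \<nu> by fact
  have sets_pair: "sets (\<mu> \<Otimes>\<^sub>M \<nu>) = sets (M \<Otimes>\<^sub>M M)"
    by (rule sets_pair_measure_cong) (fact sets)+
  have meas: "fst \<in> \<mu> \<Otimes>\<^sub>M \<nu> \<rightarrow>\<^sub>M M" "snd \<in> \<mu> \<Otimes>\<^sub>M \<nu> \<rightarrow>\<^sub>M M"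
    by (simp_all cong: measurable_cong_sets add: sets_pair)
  have "distr (\<mu> \<Otimes>\<^sub>M \<nu>) M fst = \<mu>"
  proof (rule measure_eqI)
    fix A assume "A \<in> sets (distr (\<mu> \<Otimes>\<^sub>M \<nu>) M fst)"
    then have A: "A \<in> sets M" "A \<in> sets \<mu>" by (simp_all add: sets)
    have "fst -` A \<inter> space (\<mu> \<Otimes>\<^sub>M \<nu>) = A \<times> space \<nu>"
      using sets.sets_into_space[OF A(2)] by (auto simp: space_pair_measure)
    then show "emeasure (distr (\<mu> \<Otimes>\<^sub>M \<nu>) M fst) A = emeasure \<mu> A"
      using A meas by (simp add: emeasure_distr \<nu>.emeasure_pair_measure_Times \<nu>.emeasure_space_1)
  qed (simp add: sets)
  moreover have "distr (\<mu> \<Otimes>\<^sub>M \<nu>) M snd = \<nu>"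
  proof (rule measure_eqI)
    fix A assume "A \<in> sets (distr (\<mu> \<Otimes>\<^sub>M \<nu>) M snd)"
    then have A: "A \<in> sets M" "A \<in> sets \<nu>" by (simp_all add: sets)
    have "snd -` A \<inter> space (\<mu> \<Otimes>\<^sub>M \<nu>) = space \<mu> \<times> A"
      using sets.sets_into_space[OF A(2)] by (auto simp: space_pair_measure)
    then show "emeasure (distr (\<mu> \<Otimes>\<^sub>M \<nu>) M snd) A = emeasure \<nu> A"
      using A meas by (simp add: emeasure_distr \<nu>.emeasure_pair_measure_Times \<mu>.emeasure_space_1)
  qed (simp add: sets)
  ultimately show ?thesis
    using prob sets_pair by (simp add: couplings_def space_prob_algebra prob_space_pair)
qed

lemma wasserstein_le:
  assumes "P \<in> couplings M \<mu> \<nu>" "\<And>x y. 0 \<le> r x y"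
  shows "wasserstein M r \<mu> \<nu> \<le> (\<integral>z. r (fst z) (snd z) \<partial>P)"
  unfolding wasserstein_def using assms
  by (intro cINF_lower bdd_belowI[of _ 0]) auto

lemma wasserstein_greatest:
  assumes "\<mu> \<in> space (prob_algebra M)" "\<nu> \<in> space (prob_algebra M)"
    and "\<And>P. P \<in> couplings M \<mu> \<nu> \<Longrightarrow> c \<le> (\<integral>z. r (fst z) (snd z) \<partial>P)"
  shows "c \<le> wasserstein M r \<mu> \<nu>"
  unfolding wasserstein_def using pair_measure_in_couplings[OF assms(1,2)] assms(3)
  by (intro cINF_greatest) auto

lemma wasserstein_nonneg:
  assumes "\<mu> \<in> space (prob_algebra M)" "\<nu> \<in> space (prob_algebra M)" "\<And>x y. 0 \<le> r x y"
  shows "0 \<le> wasserstein M r \<mu> \<nu>"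
  using assms by (intro wasserstein_greatest) auto

text \<open>\<open>wasserstein\<close> is stated with the Bochner integral, while mixtures are
  computed with the nonnegative one; boundedness of the cost gives integrability and allows passing
  between the two.\<close>

lemma coupling_cost:
  assumes P: "P \<in> couplings M \<mu> \<nu>" and r: "(\<lambda>z. r (fst z) (snd z)) \<in> borel_measurable (M \<Otimes>\<^sub>M M)"
    and nonneg: "\<And>x y. 0 \<le> r x y" and bound: "\<And>x y. r x y \<le> B"
  shows "ennreal (\<integral>z. r (fst z) (snd z) \<partial>P) = (\<integral>\<^sup>+z. ennreal (r (fst z) (snd z)) \<partial>P)"
proof -
  interpret prob_space P by (rule couplingsD[OF P])
  have "(\<lambda>z. r (fst z) (snd z)) \<in> borel_measurable P"
    using r measurable_cong_sets[OF couplingsD(2)[OF P] refl] by blast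
  then have "integrable P (\<lambda>z. r (fst z) (snd z))"
    using nonneg bound by (intro integrable_const_bound[of _ B]) auto
  then show ?thesis using nonneg by (intro nn_integral_eq_integral[symmetric]) auto
qed

lemma wasserstein_return_le:
  assumes "x \<in> space M" "y \<in> space M" and r: "(\<lambda>z. r (fst z) (snd z)) \<in> borel_measurable (M \<Otimes>\<^sub>M M)"
    and nonneg: "\<And>x y. 0 \<le> r x y"
  shows "wasserstein M r (return M x) (return M y) \<le> r x y"
proof -
  have "return (M \<Otimes>\<^sub>M M) (x, y) \<in> couplings M (return M x) (return M y)"
    using assms(1,2) by (simp add: couplings_def space_prob_algebra prob_space_return space_pair_measure distr_return)
  from wasserstein_le[of _ M _ _ r, OF this nonneg]
  show ?thesis using assms by (simp add: integral_return space_pair_measure)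
qed

text \<open>A coupling of two Dirac masses is concentrated on the single point (x, y); measurable
  singletons are needed to express this. The bound makes the distance between two distinct
  configurations strictly positive, which decides the sign of the contraction factor in the
  end.\<close>

lemma wasserstein_return_ge:
  assumes "x \<in> space M" "y \<in> space M" and sing: "{x} \<in> sets M" "{y} \<in> sets M"
    and r: "(\<lambda>z. r (fst z) (snd z)) \<in> borel_measurable (M \<Otimes>\<^sub>M M)"
  shows "r x y \<le> wasserstein M r (return M x) (return M y)"
proof (rule wasserstein_greatest)
  fix P assume P: "P \<in> couplings M (return M x) (return M y)"
  note P = couplingsD[OF P]
  interpret prob_space P by (rule P)
  have meas: "fst \<in> P \<rightarrow>\<^sub>M M" "snd \<in> P \<rightarrow>\<^sub>M M"
    by (simp_all cong: measurable_cong_sets add: P(2))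
  have "AE u in distr P M fst. u = x" unfolding P(3)
    using assms by (subst AE_return) (auto simp: pred_def Collect_conv_if)
  then have 1: "AE z in P. fst z = x" by (rule AE_distrD[OF meas(1)])
  have "AE u in distr P M snd. u = y" unfolding P(4)
    using assms by (subst AE_return) (auto simp: pred_def Collect_conv_if)
  then have 2: "AE z in P. snd z = y" by (rule AE_distrD[OF meas(2)])
  have "(\<integral>z. r (fst z) (snd z) \<partial>P) = (\<integral>z. r x y \<partial>P)"
  proof (rule integral_cong_AE)
    show "(\<lambda>z. r (fst z) (snd z)) \<in> borel_measurable P"
      using r measurable_cong_sets[OF P(2) refl] by blast
    show "AE z in P. r (fst z) (snd z) = r x y" using 1 2 by eventually_elim simp
  qed simp
  also have "\<dots> = r x y" by (simp add: prob_space)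
  finally show "r x y \<le> (\<integral>z. r (fst z) (snd z) \<partial>P)" by simp
qed (use assms in \<open>simp_all add: space_prob_algebra prob_space_return\<close>)

lemma rho_nonneg: "a > 0 \<Longrightarrow> 0 \<le> rho a x y"
  by (simp add: rho_def)

lemma rho_le: "a > 0 \<Longrightarrow> rho a x y \<le> 1 / a"
  by (simp add: rho_def divide_right_mono)

lemma rho_pos: "a > 0 \<Longrightarrow> x \<noteq> y \<Longrightarrow> 0 < rho a x y"
  by (simp add: rho_def)

text \<open>The function (1 - exp(-a s))/a of s >= 0 has slope at most 1, so the bounded cost
  inherits the perturbation estimate that the triangle inequality gives for
  \<open>dist\<close>.\<close>

lemma rho_perturb:
  assumes "a > 0"
  shows "rho a x y \<le> rho a x' y' + (dist x x' + dist y y')"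
proof -
  define h where "h = dist x x' + dist y y'"
  define t where "t = dist x' y'"
  have h: "h \<ge> 0" and t: "t \<ge> 0" by (simp_all add: h_def t_def)
  have "dist x y \<le> t + h"
    using dist_triangle[of x y x'] dist_triangle[of x' y y'] unfolding h_def t_def
    by (simp add: dist_commute)
  then have "a * dist x y \<le> a * (t + h)" using assms by (intro mult_left_mono) auto
  then have "exp (- a * t) * exp (- a * h) \<le> exp (- a * dist x y)"
    unfolding exp_add[symmetric] exp_le_cancel_iff by (simp add: distrib_left)
  then have "1 - exp (- a * dist x y) \<le> 1 - exp (- a * t) * exp (- a * h)" by linarith
  also have "\<dots> \<le> 1 - exp (- a * t) + a * h"
  proof -
    have "exp (- a * t) * (1 - exp (- a * h)) \<le> 1 * (a * h)"
      using assms h t exp_ge_add_one_self[of "- a * h"] by (intro mult_mono) auto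
    then show ?thesis by (simp add: algebra_simps)
  qed
  finally have "(1 - exp (- a * dist x y)) / a \<le> (1 - exp (- a * t) + a * h) / a"
    using assms by (intro divide_right_mono) auto
  also have "\<dots> = (1 - exp (- a * t)) / a + h"
    using assms by (simp add: add_divide_distrib)
  finally show ?thesis by (simp only: rho_def h_def t_def)
qed

lemma measurable_rho:
  "(\<lambda>z. rho a (fst z) (snd z)) \<in> borel_measurable (borel \<Otimes>\<^sub>M borel :: ('d::finite torus \<times> 'd torus) measure)"
  unfolding rho_def borel_prod divide_inverse
  by (intro borel_measurable_continuous_onI continuous_intros)

lemma rhoN_nonneg: "a > 0 \<Longrightarrow> 0 \<le> rhoN a N x y"
  by (simp add: rhoN_def sum_nonneg rho_nonneg)

lemma rhoN_le:
  assumes "a > 0"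
  shows "rhoN a N x y \<le> real N * (1 / a)"
  unfolding rhoN_def
  using sum_bounded_above[of "{..<N}" "\<lambda>i. rho a (x i) (y i)" "1 / a", OF rho_le[OF assms]] by simp

lemma measurable_rhoN:
  "(\<lambda>z. rhoN a N (fst z) (snd z)) \<in> borel_measurable (config_space N \<Otimes>\<^sub>M config_space N)"
  unfolding rhoN_def
proof (intro borel_measurable_sum)
  fix i assume "i \<in> {..<N}"
  then have "(\<lambda>z. (fst z i, snd z i)) \<in> config_space N \<Otimes>\<^sub>M config_space N \<rightarrow>\<^sub>M borel \<Otimes>\<^sub>M borel" by simp
  from measurable_compose[OF this measurable_rho]
  show "(\<lambda>z. rho a (fst z i) (snd z i)) \<in> borel_measurable (config_space N \<Otimes>\<^sub>M config_space N)" by simp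
qed

lemma nn_integral_uniform_count_measure:
  assumes "finite A"
  shows "(\<integral>\<^sup>+i. g i \<partial>uniform_count_measure A) = ennreal (1 / card A) * (\<Sum>i\<in>A. g i)"
  unfolding uniform_count_measure_def
  using assms by (simp add: nn_integral_point_measure_finite sum_distrib_left)

lemma nn_integral_empirical:
  assumes "g \<in> borel_measurable borel"
  shows "(\<integral>\<^sup>+z. g z \<partial>empirical N x) = ennreal (1 / real N) * (\<Sum>i<N. g (x i))"
  unfolding empirical_def using assms
  by (subst nn_integral_distr) (auto simp: nn_integral_uniform_count_measure)

lemma empirical_in_prob_algebra:
  assumes "N \<ge> 1"
  shows "empirical N x \<in> space (prob_algebra borel)"
proof -
  have "prob_space (uniform_count_measure {..<N})"
    using assms by (intro prob_space_uniform_count_measure) (auto simp: lessThan_empty_iff)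
  then show ?thesis
    unfolding empirical_def space_prob_algebra
    by (auto intro!: prob_space.prob_space_distr)
qed

lemma measurable_empirical:
  assumes "N \<ge> 1"
  shows "empirical N \<in> config_space N \<rightarrow>\<^sub>M prob_algebra (borel :: 'd::finite torus measure)"
proof (rule measurable_prob_algebraI)
  show "prob_space (empirical N x)" for x :: "nat \<Rightarrow> 'd torus"
    using empirical_in_prob_algebra[OF assms, of x] by (simp add: space_prob_algebra)
  then show "empirical N \<in> config_space N \<rightarrow>\<^sub>M subprob_algebra (borel :: 'd torus measure)"
  proof (intro measurable_subprob_algebra)
    fix A :: "'d torus set" assume [measurable]: "A \<in> sets borel"
    have "emeasure (empirical N x) A = ennreal (1 / real N) * (\<Sum>i<N. indicator A (x i))" for x
      using nn_integral_empirical[of "indicator A" N x] by (simp add: empirical_def)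
    then show "(\<lambda>x. emeasure (empirical N x) A) \<in> borel_measurable (config_space N)"
      by simp
  qed (auto simp: empirical_def intro: prob_space_imp_subprob_space)
qed

context
  fixes \<gamma> :: real and l :: "'d::finite torus \<Rightarrow> real" and b :: "'d torus \<Rightarrow> real ^ 'd"
  assumes \<gamma>: "\<gamma> > 0" and l_nonneg: "\<And>x. 0 \<le> l x" and l_meas[measurable]: "l \<in> borel_measurable borel"
    and b: "continuous_on UNIV b"
begin

text \<open>Boxes generate the product sigma-algebra and are stable under intersection, so it is
  enough that the mass of a box depends measurably on the configuration; that mass is a finite
  product of values of \<open>Q\<close>.\<close>

lemma measurable_R:
  assumes N: "N \<ge> 1"
  shows "R N \<gamma> b l \<in> config_space N \<rightarrow>\<^sub>M prob_algebra (config_space N)"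
proof (rule measurable_prob_algebra_generated)
  let ?Q = "\<lambda>x i. Q \<gamma> b l (empirical N x) (x i)"
  have Q: "?Q x i \<in> space (prob_algebra borel)" for x i
    using prob_space_Q[OF \<gamma> l_nonneg l_meas b empirical_in_prob_algebra[OF N]]
    by (simp add: space_prob_algebra)
  have Qm: "(\<lambda>x. ?Q x i) \<in> config_space N \<rightarrow>\<^sub>M prob_algebra borel" if "i < N" for i
    using that by (intro measurable_Q[OF \<gamma> l_nonneg l_meas b measurable_empirical[OF N]]) simp
  show "sets (config_space N) = sigma_sets (\<Pi>\<^sub>E i\<in>{..<N}. space borel)
      (prod_algebra {..<N} (\<lambda>_. borel :: 'd torus measure))"
    by (rule sets_PiM)
  show "Int_stable (prod_algebra {..<N} (\<lambda>_. borel :: 'd torus measure))"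
    by (rule Int_stable_prod_algebra)
  show "prod_algebra {..<N} (\<lambda>_. borel :: 'd torus measure) \<subseteq> Pow (\<Pi>\<^sub>E i\<in>{..<N}. space borel)"
    by (rule prod_algebra_sets_into_space)
  show "prob_space (R N \<gamma> b l x)" for x
    unfolding R_def using Q by (intro prob_space_PiM) (simp add: space_prob_algebra)
  show "sets (R N \<gamma> b l x) = sets (config_space N)" for x
    unfolding R_def using Q by (intro sets_PiM_cong) (simp_all add: space_prob_algebra)
  fix A assume "A \<in> prod_algebra {..<N} (\<lambda>_. borel :: 'd torus measure)"
  then obtain E where A: "A = Pi\<^sub>E {..<N} E" and E': "E \<in> (\<Pi> i\<in>{..<N}. sets (borel :: 'd torus measure))"
    by (rule prod_algebraE_all)
  from E' have E: "E i \<in> sets borel" if "i < N" for i using that by auto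
  have "emeasure (R N \<gamma> b l x) A = (\<Prod>i<N. emeasure (?Q x i) (E i))" for x
  proof -
    interpret product_prob_space "?Q x" "{..<N}"
      using Q by (intro product_prob_spaceI) (simp add: space_prob_algebra)
    show ?thesis unfolding R_def A
      using E Q by (intro emeasure_PiM) (auto simp: space_prob_algebra)
  qed
  moreover have "(\<lambda>x. \<Prod>i<N. emeasure (?Q x i) (E i)) \<in> borel_measurable (config_space N)"
    using E by (intro borel_measurable_prod_ennreal measurable_emeasure_kernel[OF measurable_prob_algebraD[OF Qm]]) auto
  ultimately show "(\<lambda>x. emeasure (R N \<gamma> b l x) A) \<in> borel_measurable (config_space N)" by simp
qed

lemma distr_R_component:
  assumes N: "N \<ge> 1" and i: "i < N"
  shows "distr (R N \<gamma> b l x) borel (\<lambda>\<omega>. \<omega> i) = Q \<gamma> b l (empirical N x) (x i)"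
proof -
  have "prob_space (Q \<gamma> b l (empirical N x) (x i))" for i
    by (rule prob_space_Q[OF \<gamma> l_nonneg l_meas b empirical_in_prob_algebra[OF N]])
  then have "distr (R N \<gamma> b l x) (Q \<gamma> b l (empirical N x) (x i)) (\<lambda>\<omega>. \<omega> i) = Q \<gamma> b l (empirical N x) (x i)"
    unfolding R_def using i by (intro distr_PiM_component) auto
  moreover have "distr (R N \<gamma> b l x) borel (\<lambda>\<omega>. \<omega> i)
    = distr (R N \<gamma> b l x) (Q \<gamma> b l (empirical N x) (x i)) (\<lambda>\<omega>. \<omega> i)"
    by (rule distr_cong) simp_all
  ultimately show ?thesis by simp
qed

text \<open>Drawing a uniform label turns a coupling of the two particle systems into a coupling of
  the nonlinear updates of their empirical measures.\<close>

lemma wasserstein_empirical_le: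
  fixes x y :: "nat \<Rightarrow> 'd torus"
  assumes N: "N \<ge> 1" and a: "a > 0"
    and xy: "x \<in> space (config_space N)" "y \<in> space (config_space N)"
  shows "wasserstein borel (rho a) (empirical N x \<bind> Q \<gamma> b l (empirical N x))
      (empirical N y \<bind> Q \<gamma> b l (empirical N y))
    \<le> wasserstein (config_space N) (rhoN a N) (R N \<gamma> b l x) (R N \<gamma> b l y) / N"
proof -
  let ?U = "uniform_count_measure {..<N}"
  let ?S = "\<lambda>x. empirical N x \<bind> Q \<gamma> b l (empirical N x)"
  let ?C = "config_space N :: (nat \<Rightarrow> 'd torus) measure"
  let ?B = "borel \<Otimes>\<^sub>M borel :: ('d torus \<times> 'd torus) measure"
  have U: "prob_space ?U"
    using N by (intro prob_space_uniform_count_measure) (auto simp: lessThan_empty_iff)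
  have U_ne: "space ?U \<noteq> {}" using N by (auto simp: space_uniform_count_measure lessThan_empty_iff)
  have "N * wasserstein borel (rho a) (?S x) (?S y) \<le> wasserstein ?C (rhoN a N) (R N \<gamma> b l x) (R N \<gamma> b l y)"
  proof (rule wasserstein_greatest)
    show "R N \<gamma> b l x \<in> space (prob_algebra ?C)" "R N \<gamma> b l y \<in> space (prob_algebra ?C)"
      using measurable_space[OF measurable_R[OF N]] xy by auto
    fix P assume P: "P \<in> couplings ?C (R N \<gamma> b l x) (R N \<gamma> b l y)"
    note cP = couplingsD[OF P]
    interpret P: prob_space P by (rule cP)
    have comp: "(\<lambda>z. (fst z i, snd z i)) \<in> P \<rightarrow>\<^sub>M ?B" if "i < N" for i
      using that by (simp cong: measurable_cong_sets add: cP(2))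
    define k where "k i = distr P ?B (\<lambda>z. (fst z i, snd z i))" for i
    have k_in: "k i \<in> space (prob_algebra ?B)" if "i < N" for i
      unfolding k_def space_prob_algebra using comp[OF that] by (auto intro: P.prob_space_distr)
    have k: "k \<in> ?U \<rightarrow>\<^sub>M prob_algebra ?B"
      using k_in unfolding measurable_cong_sets[OF sets_uniform_count_measure_count_space refl]
      by (simp add: measurable_count_space_eq1 Pi_iff)
    have bind_in: "?U \<bind> k \<in> space (prob_algebra ?B)"
      using U by (intro prob_algebra_bind[OF _ k]) (simp add: space_prob_algebra)
    \<comment> \<open>\<open>p\<close> is \<open>fst\<close> or \<open>snd\<close>, so both
      marginals are covered. The mixture over labels is a bind over the empirical measure because
      the latter is the image of the uniform law on labels.\<close>
    have marginal: "?U \<bind> (\<lambda>i. distr (k i) borel p) = ?S w"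
      if p: "p \<in> ?B \<rightarrow>\<^sub>M borel" and pk: "\<And>i. i < N \<Longrightarrow> distr (k i) borel p = Q \<gamma> b l (empirical N w) (w i)" for p w
    proof -
      have "?U \<bind> (\<lambda>i. distr (k i) borel p) = ?U \<bind> (\<lambda>i. Q \<gamma> b l (empirical N w) (w i))"
        using pk by (intro bind_cong) (auto simp: space_uniform_count_measure)
      also have "\<dots> = ?S w"
        unfolding empirical_def[of N w]
        by (rule bind_distr[symmetric, OF _ measurable_prob_algebraD[OF measurable_Q_const[OF \<gamma> l_nonneg l_meas b]] U_ne])
          (use empirical_in_prob_algebra[OF N, of w] in \<open>auto simp: empirical_def\<close>)
      finally show ?thesis .
    qed
    have m1: "fst \<in> P \<rightarrow>\<^sub>M ?C" and m2: "snd \<in> P \<rightarrow>\<^sub>M ?C"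
      by (simp_all cong: measurable_cong_sets add: cP(2))
    have "distr (?U \<bind> k) borel fst = ?S x"
      unfolding distr_bind[OF measurable_prob_algebraD[OF k] U_ne measurable_fst]
    proof (rule marginal[OF measurable_fst])
      fix i assume i: "i < N"
      have "distr (k i) borel fst = distr (distr P ?C fst) borel (\<lambda>\<omega>. \<omega> i)"
        using i m1 comp[OF i] unfolding k_def by (simp add: distr_distr comp_def)
      then show "distr (k i) borel fst = Q \<gamma> b l (empirical N x) (x i)"
        by (simp add: cP(3) distr_R_component[OF N i])
    qed
    moreover have "distr (?U \<bind> k) borel snd = ?S y"
      unfolding distr_bind[OF measurable_prob_algebraD[OF k] U_ne measurable_snd]
    proof (rule marginal[OF measurable_snd])
      fix i assume i: "i < N"
      have "distr (k i) borel snd = distr (distr P ?C snd) borel (\<lambda>\<omega>. \<omega> i)"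
        using i m2 comp[OF i] unfolding k_def by (simp add: distr_distr comp_def)
      then show "distr (k i) borel snd = Q \<gamma> b l (empirical N y) (y i)"
        by (simp add: cP(4) distr_R_component[OF N i])
    qed
    ultimately have bind_coup: "?U \<bind> k \<in> couplings borel (?S x) (?S y)"
      using bind_in by (simp add: couplings_def)
    have rho_meas: "(\<lambda>z. ennreal (rho a (fst z) (snd z))) \<in> borel_measurable ?B"
      using measurable_rho by measurable
    note rhoN_meas = measurable_rhoN and rhoN = rhoN_nonneg[OF a] rhoN_le[OF a]
    have "ennreal (\<integral>z. rho a (fst z) (snd z) \<partial>(?U \<bind> k))
      = (\<integral>\<^sup>+z. ennreal (rho a (fst z) (snd z)) \<partial>(?U \<bind> k))"
      by (rule coupling_cost[OF bind_coup measurable_rho rho_nonneg[OF a] rho_le[OF a]])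
    also have "\<dots> = (\<integral>\<^sup>+i. \<integral>\<^sup>+z. ennreal (rho a (fst z) (snd z)) \<partial>k i \<partial>?U)"
      by (rule nn_integral_bind[OF rho_meas measurable_prob_algebraD[OF k]])
    also have "\<dots> = ennreal (1 / N) * (\<Sum>i<N. \<integral>\<^sup>+z. ennreal (rho a (fst z) (snd z)) \<partial>k i)"
      by (simp add: nn_integral_uniform_count_measure)
    also have "(\<Sum>i<N. \<integral>\<^sup>+z. ennreal (rho a (fst z) (snd z)) \<partial>k i)
      = (\<Sum>i<N. \<integral>\<^sup>+z. ennreal (rho a (fst z i) (snd z i)) \<partial>P)"
      unfolding k_def using comp rho_meas by (intro sum.cong refl) (subst nn_integral_distr, auto)
    also have "\<dots> = (\<integral>\<^sup>+z. ennreal (rhoN a N (fst z) (snd z)) \<partial>P)"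
    proof -
      have "(\<lambda>z. ennreal (rho a (fst z i) (snd z i))) \<in> borel_measurable P" if "i < N" for i
        using measurable_compose[OF comp[OF that] rho_meas] by simp
      then show ?thesis
        unfolding rhoN_def
        by (subst nn_integral_sum[symmetric])
          (auto intro!: nn_integral_cong simp: sum_ennreal rho_nonneg[OF a])
    qed
    also have "\<dots> = ennreal (\<integral>z. rhoN a N (fst z) (snd z) \<partial>P)"
      by (rule coupling_cost[OF P rhoN_meas rhoN, symmetric])
    finally have "ennreal (\<integral>z. rho a (fst z) (snd z) \<partial>(?U \<bind> k))
      = ennreal (1 / N * (\<integral>z. rhoN a N (fst z) (snd z) \<partial>P))"
      by (subst ennreal_mult) (simp_all add: rhoN)
    then have "(\<integral>z. rho a (fst z) (snd z) \<partial>(?U \<bind> k)) = 1 / N * (\<integral>z. rhoN a N (fst z) (snd z) \<partial>P)"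
      by (subst (asm) ennreal_inj) (auto simp: rho_nonneg[OF a] rhoN)
    moreover have "wasserstein borel (rho a) (?S x) (?S y) \<le> (\<integral>z. rho a (fst z) (snd z) \<partial>(?U \<bind> k))"
      by (rule wasserstein_le[OF bind_coup rho_nonneg[OF a]])
    ultimately have "wasserstein borel (rho a) (?S x) (?S y) \<le> (\<integral>z. rhoN a N (fst z) (snd z) \<partial>P) / N"
      by simp
    then show "N * wasserstein borel (rho a) (?S x) (?S y) \<le> (\<integral>z. rhoN a N (fst z) (snd z) \<partial>P)"
      using N by (simp add: field_simps)
  qed
  then show ?thesis using N by (simp add: field_simps)
qed

end

subsection \<open>Quantization and mixtures of couplings\<close>


text \<open>A cell of probability q receives the ceiling of M q points, all equal to one
  representative, and their total number N >= M normalises. Rounding up adds at most one point,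
  which is at most \<theta> M q once M exceeds 1/(\<theta> w), w being the smallest positive cell
  probability: hence the factor 1 + \<theta>. The quantifiers over h and g belong to the conclusion
  so that the same points serve both the comparison of kernels and the estimate of the cost.\<close>

lemma finite_quantization:
  fixes P :: "'a measure" and \<phi> :: "'a \<Rightarrow> 'b"
  assumes "prob_space P" and J: "finite J" and \<phi>: "\<phi> \<in> P \<rightarrow>\<^sub>M count_space J" and \<theta>: "\<theta> > 0"
  obtains N z where "N \<ge> 1"
    "\<forall>h g :: 'a \<Rightarrow> ennreal. g \<in> borel_measurable P \<longrightarrow>
      (\<forall>u\<in>space P. \<forall>v\<in>space P. \<phi> u = \<phi> v \<longrightarrow> h u \<le> g v) \<longrightarrow>
      ennreal (1 / real N) * (\<Sum>i<N. h (z i)) \<le> ennreal (1 + \<theta>) * (\<integral>\<^sup>+v. g v \<partial>P)"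
proof -
  interpret prob_space P by fact
  define cell where "cell j = \<phi> -` {j} \<inter> space P" for j
  have cell_sets: "cell j \<in> sets P" if "j \<in> J" for j
    unfolding cell_def using that by (intro measurable_sets[OF \<phi>]) auto
  \<comment> \<open>Null cells are dropped: they may be empty, and the minimum \<open>w\<close>
    below must be positive.\<close>
  define I where "I = {j\<in>J. prob (cell j) > 0}"
  have I: "finite I" "\<And>j. j \<in> I \<Longrightarrow> prob (cell j) > 0" "\<And>j. j \<in> I \<Longrightarrow> cell j \<in> sets P"
    using J cell_sets by (auto simp: I_def)
  have disj: "disjoint_family_on cell X" for X
    by (auto simp: disjoint_family_on_def cell_def)
  have "1 = prob (\<Union>j\<in>J. cell j)"
  proof -
    have "(\<Union>j\<in>J. cell j) = space P"
      using measurable_space[OF \<phi>] by (auto simp: cell_def)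
    then show ?thesis by (simp add: prob_space)
  qed
  also have "\<dots> = (\<Sum>j\<in>J. prob (cell j))"
    using J cell_sets by (intro finite_measure_finite_Union disj) auto
  also have "\<dots> = (\<Sum>j\<in>I. prob (cell j))"
    using J by (intro sum.mono_neutral_right) (auto simp: I_def zero_less_measure_iff)
  finally have sum1: "(\<Sum>j\<in>I. prob (cell j)) = 1" by simp
  then have I_ne: "I \<noteq> {}" by auto
  have "\<exists>u. u \<in> cell j" if "j \<in> I" for j using I(2)[OF that] by (metis all_not_in_conv measure_empty less_irrefl)
  then obtain p where p: "\<And>j. j \<in> I \<Longrightarrow> p j \<in> cell j" by metis
  define w where "w = Min ((\<lambda>j. prob (cell j)) ` I)"
  have w: "w > 0" "\<And>j. j \<in> I \<Longrightarrow> w \<le> prob (cell j)"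
    using I I_ne by (auto simp: w_def)
  obtain M :: nat where M: "1 / (\<theta> * w) < real M" using reals_Archimedean2 by blast
  have "0 < real M" by (rule less_trans[OF _ M]) (use \<theta> w in auto)
  have M1: "1 \<le> \<theta> * prob (cell j) * M" if "j \<in> I" for j
  proof -
    have "1 \<le> \<theta> * w * M" using M \<theta> w by (simp add: divide_less_eq mult.commute)
    also have "\<dots> \<le> \<theta> * prob (cell j) * M"
      using \<theta> w(2)[OF that] by (intro mult_right_mono mult_left_mono) auto
    finally show ?thesis .
  qed
  define n where "n j = nat \<lceil>real M * prob (cell j)\<rceil>" for j
  have n: "real M * prob (cell j) \<le> n j" "n j \<le> real M * prob (cell j) + 1" for j
  proof -
    have "0 \<le> real M * prob (cell j)" by simp
    then show "real M * prob (cell j) \<le> n j" "n j \<le> real M * prob (cell j) + 1"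
      unfolding n_def by linarith+
  qed
  define N where "N = (\<Sum>j\<in>I. n j)"
  have MN: "real M \<le> N"
  proof -
    have "real M = (\<Sum>j\<in>I. real M * prob (cell j))" using sum1 by (simp add: sum_distrib_left[symmetric])
    also have "\<dots> \<le> N" unfolding N_def by (simp add: sum_mono n)
    finally show ?thesis .
  qed
  with \<open>0 < real M\<close> have N1: "N \<ge> 1" by linarith
  have nN: "real (n j) / N \<le> (1 + \<theta>) * prob (cell j)" if "j \<in> I" for j
  proof -
    have "real (n j) \<le> (1 + \<theta>) * prob (cell j) * M"
      using n(2)[of j] M1[OF that] by (simp add: algebra_simps)
    also have "\<dots> \<le> (1 + \<theta>) * prob (cell j) * N" using MN \<theta> by (intro mult_left_mono) auto
    finally show ?thesis using N1 by (simp add: divide_le_eq)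
  qed
  \<comment> \<open>Pairs of a cell and the number of a copy of its representative, to be enumerated
    by the labels below N.\<close>
  let ?S = "SIGMA j:I. {..<n j}"
  have "finite ?S" "card ?S = N" using I by (auto simp: N_def card_SigmaI)
  then obtain e where e: "bij_betw e {..<N} ?S"
    using ex_bij_betw_nat_finite[of ?S] by (auto simp: atLeast0LessThan)
  define z where "z i = p (fst (e i))" for i
  show ?thesis
  proof (rule that[OF N1], intro allI impI)
    fix h g :: "'a \<Rightarrow> ennreal"
    assume g[measurable]: "g \<in> borel_measurable P"
      and hg: "\<forall>u\<in>space P. \<forall>v\<in>space P. \<phi> u = \<phi> v \<longrightarrow> h u \<le> g v"
    have cell_le: "ennreal (prob (cell j)) * h (p j) \<le> (\<integral>\<^sup>+v. g v * indicator (cell j) v \<partial>P)" if j: "j \<in> I" for j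
    proof -
      have "ennreal (prob (cell j)) * h (p j) = (\<integral>\<^sup>+v. h (p j) * indicator (cell j) v \<partial>P)"
        using I(3)[OF j] by (simp add: nn_integral_cmult_indicator emeasure_eq_measure mult.commute)
      also have "\<dots> \<le> (\<integral>\<^sup>+v. g v * indicator (cell j) v \<partial>P)"
        using p[OF j] by (intro nn_integral_mono) (use hg in \<open>auto simp: indicator_def cell_def\<close>)
      finally show ?thesis .
    qed
    have "(\<Sum>i<N. h (z i)) = (\<Sum>s\<in>?S. h (p (fst s)))"
      unfolding z_def by (rule sum.reindex_bij_betw[OF e, of "\<lambda>s. h (p (fst s))"])
    also have "\<dots> = (\<Sum>j\<in>I. \<Sum>k<n j. h (p j))"
      using I by (subst sum.Sigma) (auto simp: split_def)
    also have "\<dots> = (\<Sum>j\<in>I. ennreal (n j) * h (p j))"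
      by (simp add: ennreal_of_nat_eq_real_of_nat)
    finally have "ennreal (1 / N) * (\<Sum>i<N. h (z i)) = (\<Sum>j\<in>I. ennreal (n j / N) * h (p j))"
      by (simp add: sum_distrib_left mult.assoc[symmetric] ennreal_mult[symmetric])
    also have "\<dots> \<le> (\<Sum>j\<in>I. ennreal ((1 + \<theta>) * prob (cell j)) * h (p j))"
      by (intro sum_mono mult_right_mono ennreal_leI nN) auto
    also have "\<dots> = ennreal (1 + \<theta>) * (\<Sum>j\<in>I. ennreal (prob (cell j)) * h (p j))"
      using \<theta> by (simp add: ennreal_mult sum_distrib_left mult.assoc)
    also have "\<dots> \<le> ennreal (1 + \<theta>) * (\<Sum>j\<in>I. \<integral>\<^sup>+v. g v * indicator (cell j) v \<partial>P)"
      by (intro mult_left_mono sum_mono cell_le) auto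
    also have "(\<Sum>j\<in>I. \<integral>\<^sup>+v. g v * indicator (cell j) v \<partial>P) = (\<integral>\<^sup>+v. g v * indicator (\<Union>j\<in>I. cell j) v \<partial>P)"
    proof -
      have "(\<Sum>j\<in>I. \<integral>\<^sup>+v. g v * indicator (cell j) v \<partial>P) = (\<integral>\<^sup>+v. (\<Sum>j\<in>I. g v * indicator (cell j) v) \<partial>P)"
        using I by (subst nn_integral_sum) auto
      then show ?thesis
        using I(1) by (simp add: sum_distrib_left[symmetric] indicator_UN_disjoint[OF _ disj])
    qed
    also have "\<dots> \<le> (\<integral>\<^sup>+v. g v \<partial>P)"
      by (intro nn_integral_mono) (auto simp: indicator_def)
    finally show "ennreal (1 / N) * (\<Sum>i<N. h (z i)) \<le> ennreal (1 + \<theta>) * (\<integral>\<^sup>+v. g v \<partial>P)"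
      by (simp add: mult_left_mono)
  qed
qed

text \<open>Finitely many balls of radius \<delta>/2 cover the space, and the label of a point is
  the set of centres whose ball contains it, so the balls need not be made disjoint. A label is
  never empty, and two points with equal labels lie in a common ball.\<close>

lemma compact_small_cells:
  fixes \<delta> :: real
  assumes "compact (UNIV :: 'a::metric_space set)" "\<delta> > 0"
  obtains J :: "'a::metric_space set set" and \<phi> :: "'a \<Rightarrow> 'a set" where "finite J" "\<phi> \<in> borel \<rightarrow>\<^sub>M count_space J"
    "\<And>u v. \<phi> u = \<phi> v \<Longrightarrow> dist u v < \<delta>"
proof -
  have "\<exists>C. finite C \<and> C \<subseteq> UNIV \<and> (UNIV :: 'a set) \<subseteq> (\<Union>c\<in>C. ball c (\<delta> / 2))"
    using assms unfolding compact_eq_totally_bounded by auto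
  then obtain C :: "'a set" where C: "finite C" "\<And>u. \<exists>c\<in>C. u \<in> ball c (\<delta> / 2)" by blast
  define B where "B c = ball c (\<delta> / 2)" for c :: 'a
  define \<phi> where "\<phi> u = {c\<in>C. u \<in> B c}" for u
  show ?thesis
  proof (rule that)
    show fin: "finite (Pow C)" using C by simp
    have "\<phi> -` {S} \<inter> space borel \<in> sets borel" if S: "S \<subseteq> C" for S
    proof -
      have "\<phi> -` {S} \<inter> space borel = (\<Inter>c\<in>C. if c \<in> S then B c else - B c)"
      proof (intro set_eqI)
        fix u
        have "\<phi> u = S \<longleftrightarrow> (\<forall>c\<in>C. u \<in> B c \<longleftrightarrow> c \<in> S)" using S unfolding \<phi>_def by blast
        then show "u \<in> \<phi> -` {S} \<inter> space borel \<longleftrightarrow> u \<in> (\<Inter>c\<in>C. if c \<in> S then B c else - B c)"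
          by auto
      qed
      also have "\<dots> \<in> sets borel"
        using C by (intro sets.finite_INT) (auto simp: B_def)
      finally show ?thesis .
    qed
    moreover have "\<phi> u \<in> Pow C" for u by (auto simp: \<phi>_def)
    ultimately show "\<phi> \<in> borel \<rightarrow>\<^sub>M count_space (Pow C)"
      using fin by (simp add: measurable_count_space_eq2)
    fix u v :: 'a assume eq: "\<phi> u = \<phi> v"
    obtain c where "c \<in> \<phi> u" using C(2)[of u] by (auto simp: \<phi>_def B_def)
    then have "dist c u < \<delta> / 2" "dist c v < \<delta> / 2" using eq by (auto simp: \<phi>_def B_def)
    then show "dist u v < \<delta>" by (rule dist_triangle_half_r)
  qed
qed

lemma nn_integral_le_scale:
  assumes "sets M = sets N" "\<And>A. A \<in> sets N \<Longrightarrow> emeasure M A \<le> c * emeasure N A"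
    and "f \<in> borel_measurable N"
  shows "(\<integral>\<^sup>+x. f x \<partial>M) \<le> c * (\<integral>\<^sup>+x. f x \<partial>N)"
proof -
  have "M \<le> scale_measure c N" using assms by (subst le_measure) auto
  then have "(\<integral>\<^sup>+x. f x \<partial>M) \<le> (\<integral>\<^sup>+x. f x \<partial>scale_measure c N)"
    using assms(1) by (intro nn_integral_mono_measure) auto
  then show ?thesis using assms(3) by (simp add: nn_integral_scale_measure)
qed

text \<open>The residual (\<alpha> - (1 - \<epsilon>) \<alpha>')/\<epsilon> is nonnegative by
  domination and has mass (1 - (1 - \<epsilon>))/\<epsilon> = 1.\<close>

lemma residual_measure:
  assumes \<alpha>: "\<alpha> \<in> space (prob_algebra M)" and \<alpha>': "\<alpha>' \<in> space (prob_algebra M)"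
    and \<epsilon>: "0 < \<epsilon>" "\<epsilon> < 1"
    and le: "\<And>A. A \<in> sets M \<Longrightarrow> ennreal (1 - \<epsilon>) * emeasure \<alpha>' A \<le> emeasure \<alpha> A"
  obtains \<rho> where "\<rho> \<in> space (prob_algebra M)"
    "\<And>A. A \<in> sets M \<Longrightarrow> emeasure \<alpha> A = ennreal (1 - \<epsilon>) * emeasure \<alpha>' A + ennreal \<epsilon> * emeasure \<rho> A"
proof -
  have prob: "prob_space \<alpha>" "prob_space \<alpha>'" and sets: "sets \<alpha> = sets M" "sets \<alpha>' = sets M"
    using \<alpha> \<alpha>' by (auto simp: space_prob_algebra)
  have space: "space \<alpha> = space M" "space \<alpha>' = space M" using sets by (auto dest: sets_eq_imp_space_eq)
  interpret \<alpha>: prob_space \<alpha> by fact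
  interpret \<alpha>': prob_space \<alpha>' by fact
  let ?m = "scale_measure (ennreal (1 - \<epsilon>)) \<alpha>'"
  define \<rho> where "\<rho> = scale_measure (ennreal (1 / \<epsilon>)) (diff_measure \<alpha> ?m)"
  have fin: "finite_measure ?m"
    by (rule finite_measureI) (simp add: space_scale_measure \<alpha>'.emeasure_space_1)
  have diff: "emeasure (diff_measure \<alpha> ?m) A = emeasure \<alpha> A - ennreal (1 - \<epsilon>) * emeasure \<alpha>' A" if "A \<in> sets M" for A
    using that sets le fin by (subst emeasure_diff_measure) (auto intro: \<alpha>.finite_measure_axioms)
  have eq: "emeasure \<alpha> A = ennreal (1 - \<epsilon>) * emeasure \<alpha>' A + ennreal \<epsilon> * emeasure \<rho> A" if A: "A \<in> sets M" for A
  proof -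
    have "ennreal \<epsilon> * emeasure \<rho> A = emeasure \<alpha> A - ennreal (1 - \<epsilon>) * emeasure \<alpha>' A"
      using \<epsilon> unfolding \<rho>_def by (simp add: diff[OF A] mult.assoc[symmetric] ennreal_mult[symmetric])
    then show ?thesis using le[OF A] by (simp add: add_diff_inverse_ennreal)
  qed
  have "prob_space \<rho>"
  proof
    have "emeasure \<rho> (space \<rho>) = ennreal (1 / \<epsilon>) * (1 - ennreal (1 - \<epsilon>))"
      using diff[OF sets.top] space \<alpha>.emeasure_space_1 \<alpha>'.emeasure_space_1
      by (simp add: \<rho>_def space_scale_measure)
    also have "1 - ennreal (1 - \<epsilon>) = ennreal \<epsilon>"
      using \<epsilon> ennreal_minus[of "1 - \<epsilon>" 1] by simp
    finally show "emeasure \<rho> (space \<rho>) = 1" using \<epsilon> by (simp add: ennreal_mult[symmetric])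
  qed
  moreover have "sets \<rho> = sets M" by (simp add: \<rho>_def sets)
  ultimately show ?thesis using that eq by (simp add: space_prob_algebra)
qed

text \<open>Comparing measures up to a factor, rather than in the Wasserstein distance, makes the gluing
  lemma unnecessary: a coupling of the smaller measures is completed by a product of residuals.\<close>

lemma wasserstein_mixture:
  assumes \<alpha>: "\<alpha> \<in> space (prob_algebra M)" "\<alpha>' \<in> space (prob_algebra M)"
    and \<beta>: "\<beta> \<in> space (prob_algebra M)" "\<beta>' \<in> space (prob_algebra M)"
    and \<epsilon>: "0 < \<epsilon>" "\<epsilon> < 1"
    and le_\<alpha>: "\<And>A. A \<in> sets M \<Longrightarrow> ennreal (1 - \<epsilon>) * emeasure \<alpha>' A \<le> emeasure \<alpha> A"
    and le_\<beta>: "\<And>A. A \<in> sets M \<Longrightarrow> ennreal (1 - \<epsilon>) * emeasure \<beta>' A \<le> emeasure \<beta> A"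
    and r: "(\<lambda>z. r (fst z) (snd z)) \<in> borel_measurable (M \<Otimes>\<^sub>M M)"
      "\<And>x y. 0 \<le> r x y" "\<And>x y. r x y \<le> B"
  shows "wasserstein M r \<alpha> \<beta> \<le> (1 - \<epsilon>) * wasserstein M r \<alpha>' \<beta>' + \<epsilon> * B"
proof -
  obtain \<rho>\<alpha> where \<rho>\<alpha>: "\<rho>\<alpha> \<in> space (prob_algebra M)"
    "\<And>A. A \<in> sets M \<Longrightarrow> emeasure \<alpha> A = ennreal (1 - \<epsilon>) * emeasure \<alpha>' A + ennreal \<epsilon> * emeasure \<rho>\<alpha> A"
    using residual_measure[OF \<alpha> \<epsilon> le_\<alpha>] by blast
  obtain \<rho>\<beta> where \<rho>\<beta>: "\<rho>\<beta> \<in> space (prob_algebra M)"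
    "\<And>A. A \<in> sets M \<Longrightarrow> emeasure \<beta> A = ennreal (1 - \<epsilon>) * emeasure \<beta>' A + ennreal \<epsilon> * emeasure \<rho>\<beta> A"
    using residual_measure[OF \<beta> \<epsilon> le_\<beta>] by blast
  note S = pair_measure_in_couplings[OF \<rho>\<alpha>(1) \<rho>\<beta>(1)]
  \<comment> \<open>Solved for the distance on the right, so that a lower bound valid for every
    coupling of \<alpha>' and \<beta>' passes to the infimum.\<close>
  have "(wasserstein M r \<alpha> \<beta> - \<epsilon> * B) / (1 - \<epsilon>) \<le> wasserstein M r \<alpha>' \<beta>'"
  proof (rule wasserstein_greatest[OF \<alpha>(2) \<beta>(2)])
    fix P assume P: "P \<in> couplings M \<alpha>' \<beta>'"
    \<comment> \<open>A coin of bias 1 - \<epsilon>: binding it to \<open>k\<close> gives the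
      mixture of P and the product of the residuals.\<close>
    define T where "T = measure_pmf (bernoulli_pmf (1 - \<epsilon>))"
    define k where "k t = (if t then P else \<rho>\<alpha> \<Otimes>\<^sub>M \<rho>\<beta>)" for t
    have T: "T \<in> space (prob_algebra (count_space UNIV))"
      by (simp add: T_def space_prob_algebra measure_pmf.prob_space_axioms)
    have k: "k \<in> count_space UNIV \<rightarrow>\<^sub>M prob_algebra (M \<Otimes>\<^sub>M M)"
      using couplingsD(1,2)[OF P] couplingsD(1,2)[OF S] by (auto simp: k_def space_prob_algebra)
    have k': "k \<in> T \<rightarrow>\<^sub>M subprob_algebra (M \<Otimes>\<^sub>M M)"
      using measurable_prob_algebraD[OF k] by (simp add: T_def)
    have T_int: "(\<integral>\<^sup>+t. f t \<partial>T) = ennreal (1 - \<epsilon>) * f True + ennreal \<epsilon> * f False" for f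
      using \<epsilon> unfolding T_def by (subst nn_integral_bernoulli_pmf) (simp_all add: mult.commute)
    have marginal: "distr (T \<bind> k) M p = \<sigma>"
      if p: "p \<in> M \<Otimes>\<^sub>M M \<rightarrow>\<^sub>M M" and pP: "distr P M p = \<sigma>'" and pS: "distr (\<rho>\<alpha> \<Otimes>\<^sub>M \<rho>\<beta>) M p = \<tau>"
        and \<sigma>: "\<sigma> \<in> space (prob_algebra M)"
        and eq: "\<And>A. A \<in> sets M \<Longrightarrow> emeasure \<sigma> A = ennreal (1 - \<epsilon>) * emeasure \<sigma>' A + ennreal \<epsilon> * emeasure \<tau> A"
      for p \<sigma> \<sigma>' \<tau>
    proof (rule measure_eqI)
      fix A assume "A \<in> sets (distr (T \<bind> k) M p)"
      then have A: "A \<in> sets M" by simp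
      have sets: "sets (T \<bind> k) = sets (M \<Otimes>\<^sub>M M)" by (rule sets_bind'[OF T k])
      have "emeasure (distr (T \<bind> k) M p) A = emeasure (T \<bind> k) (p -` A \<inter> space (M \<Otimes>\<^sub>M M))"
        using p A sets sets_eq_imp_space_eq[OF sets] by (subst emeasure_distr) (auto cong: measurable_cong_sets)
      also have "\<dots> = (\<integral>\<^sup>+t. emeasure (k t) (p -` A \<inter> space (M \<Otimes>\<^sub>M M)) \<partial>T)"
        by (rule emeasure_bind_prob_algebra[OF T k measurable_sets[OF p A]])
      also have "\<dots> = (\<integral>\<^sup>+t. emeasure (distr (k t) M p) A \<partial>T)"
      proof (intro nn_integral_cong)
        fix t
        have "sets (k t) = sets (M \<Otimes>\<^sub>M M)"
          using couplingsD(2)[OF P] couplingsD(2)[OF S] by (simp add: k_def)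
        then show "emeasure (k t) (p -` A \<inter> space (M \<Otimes>\<^sub>M M)) = emeasure (distr (k t) M p) A"
          using p A sets_eq_imp_space_eq[of "k t" "M \<Otimes>\<^sub>M M"]
          by (subst emeasure_distr) (auto cong: measurable_cong_sets)
      qed
      also have "\<dots> = emeasure \<sigma> A" unfolding T_int eq[OF A] by (simp add: k_def pP pS)
      finally show "emeasure (distr (T \<bind> k) M p) A = emeasure \<sigma> A" .
    qed (use \<sigma> in \<open>simp add: space_prob_algebra\<close>)
    have bind_coup: "T \<bind> k \<in> couplings M \<alpha> \<beta>"
      using prob_algebra_bind[OF T k]
        marginal[OF measurable_fst couplingsD(3)[OF P] couplingsD(3)[OF S] \<alpha>(1) \<rho>\<alpha>(2)]
        marginal[OF measurable_snd couplingsD(4)[OF P] couplingsD(4)[OF S] \<beta>(1) \<rho>\<beta>(2)]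
      by (simp add: couplings_def)
    let ?c = "\<lambda>P. \<integral>z. r (fst z) (snd z) \<partial>P"
    have "ennreal (?c (T \<bind> k)) = (\<integral>\<^sup>+z. ennreal (r (fst z) (snd z)) \<partial>(T \<bind> k))"
      by (rule coupling_cost[OF bind_coup r])
    also have "\<dots> = (\<integral>\<^sup>+t. \<integral>\<^sup>+z. ennreal (r (fst z) (snd z)) \<partial>k t \<partial>T)"
      using r(1) by (intro nn_integral_bind[OF _ k']) measurable
    also have "\<dots> = ennreal (1 - \<epsilon>) * ennreal (?c P) + ennreal \<epsilon> * ennreal (?c (\<rho>\<alpha> \<Otimes>\<^sub>M \<rho>\<beta>))"
      unfolding T_int coupling_cost[OF P r] coupling_cost[OF S r] by (simp add: k_def)
    also have "\<dots> = ennreal ((1 - \<epsilon>) * ?c P + \<epsilon> * ?c (\<rho>\<alpha> \<Otimes>\<^sub>M \<rho>\<beta>))"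
      using \<epsilon> r(2) by (simp add: ennreal_mult)
    finally have "?c (T \<bind> k) = (1 - \<epsilon>) * ?c P + \<epsilon> * ?c (\<rho>\<alpha> \<Otimes>\<^sub>M \<rho>\<beta>)"
      using \<epsilon> r(2) by (subst (asm) ennreal_inj) auto
    moreover have "?c (\<rho>\<alpha> \<Otimes>\<^sub>M \<rho>\<beta>) \<le> B"
    proof -
      interpret prob_space "\<rho>\<alpha> \<Otimes>\<^sub>M \<rho>\<beta>" by (rule couplingsD[OF S])
      have "ennreal (?c (\<rho>\<alpha> \<Otimes>\<^sub>M \<rho>\<beta>)) \<le> (\<integral>\<^sup>+z. ennreal B \<partial>(\<rho>\<alpha> \<Otimes>\<^sub>M \<rho>\<beta>))"
        unfolding coupling_cost[OF S r] by (intro nn_integral_mono ennreal_leI r)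
      then have "ennreal (?c (\<rho>\<alpha> \<Otimes>\<^sub>M \<rho>\<beta>)) \<le> ennreal B" by (simp add: emeasure_space_1)
      moreover have "0 \<le> B" using r(2,3) order_trans by blast
      ultimately show ?thesis by simp
    qed
    ultimately have "?c (T \<bind> k) \<le> (1 - \<epsilon>) * ?c P + \<epsilon> * B" using \<epsilon> by simp
    then have "wasserstein M r \<alpha> \<beta> \<le> (1 - \<epsilon>) * ?c P + \<epsilon> * B"
      using wasserstein_le[of _ _ _ _ r, OF bind_coup r(2)] by linarith
    then show "(wasserstein M r \<alpha> \<beta> - \<epsilon> * B) / (1 - \<epsilon>) \<le> ?c P"
      using \<epsilon> by (simp add: divide_le_eq mult.commute)
  qed
  then show ?thesis using \<epsilon> by (simp add: divide_le_eq mult.commute)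
qed

subsection \<open>Contraction of the nonlinear step\<close>


lemma bounded_lipschitz_torus:
  assumes "L-lipschitz_on UNIV (l :: 'd::finite torus \<Rightarrow> real)"
  obtains B where "\<And>x. l x \<le> B"
proof -
  have "bounded (range l)"
    using compact_continuous_image[OF lipschitz_on_continuous_on[OF assms] compact_UNIV_torus]
    by (rule compact_imp_bounded)
  then show ?thesis using that unfolding bounded_iff by (metis abs_le_D1 rangeI real_norm_def)
qed

text \<open>t, Z and p stand for the surviving mass in a set, the total surviving mass and the lost
  mass. Upper bounds alone suffice because p + Z = 1: from p' <= (1 + \<theta>) p follows Z' >= Z -
  \<theta>, and Z >= f makes this error relative, Z' >= (1 - \<theta>/f) Z. The second \<theta>/f in
  the conclusion absorbs the factor 1 + \<theta> of the numerator, using f <= 1.\<close>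

lemma conditioning_comparison:
  fixes t t' Z Z' p p' f \<theta> :: real
  assumes "p + Z = 1" "p' + Z' = 1" "t' \<le> (1 + \<theta>) * t" "p' \<le> (1 + \<theta>) * p"
    and "f \<le> Z" "f > 0" "0 \<le> p" "0 \<le> t'" "0 < \<theta>" "\<theta> / f < 1 / 2"
  shows "(1 - 2 * \<theta> / f) * (t' / Z') \<le> t / Z"
proof -
  have Z: "0 < Z" "Z \<le> 1" "f \<le> 1" using assms by linarith+
  have "Z - \<theta> \<le> Z'"
  proof -
    have "\<theta> * p \<le> \<theta> * 1" using assms Z by (intro mult_left_mono) auto
    moreover have "p' \<le> p + \<theta> * p" using assms(4) by (simp add: algebra_simps)
    ultimately show ?thesis using assms(1,2) by linarith
  qed
  moreover have \<theta>f: "\<theta> \<le> \<theta> / f * Z" using assms by (simp add: field_simps)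
  ultimately have Z': "(1 - \<theta> / f) * Z \<le> Z'" by (simp add: algebra_simps)
  have "\<theta> / f * Z < 1 / 2 * Z" using assms Z by (intro mult_strict_right_mono) auto
  then have pos: "0 < Z'" using Z' Z unfolding left_diff_distrib by linarith
  have "(1 - 2 * \<theta> / f) * (1 + \<theta>) \<le> 1 - \<theta> / f"
  proof -
    have "\<theta> \<le> \<theta> / f" using assms Z by (simp add: field_simps)
    moreover have "0 \<le> 2 * (\<theta> / f) * \<theta>" using assms by simp
    moreover have "(1 - 2 * \<theta> / f) * (1 + \<theta>) = 1 - 2 * (\<theta> / f) + \<theta> - 2 * (\<theta> / f) * \<theta>"
      by (simp add: algebra_simps add_divide_distrib)
    ultimately show ?thesis by linarith
  qed
  then have "(1 - 2 * \<theta> / f) * (1 + \<theta>) * Z \<le> Z'"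
    using Z Z' mult_right_mono[of "(1 - 2 * \<theta> / f) * (1 + \<theta>)" "1 - \<theta> / f" Z] by linarith
  moreover have t: "0 \<le> t" using assms by (smt (verit) mult_pos_neg)
  ultimately have "t * ((1 - 2 * \<theta> / f) * (1 + \<theta>) * Z) \<le> t * Z'" by (intro mult_left_mono)
  moreover have "(1 - 2 * \<theta> / f) * Z * t' \<le> (1 - 2 * \<theta> / f) * Z * ((1 + \<theta>) * t)"
    using assms Z by (intro mult_left_mono) auto
  ultimately have "(1 - 2 * \<theta> / f) * t' * Z \<le> t * Z'" by (simp add: ac_simps)
  then show ?thesis using Z pos by (simp add: field_simps)
qed

text \<open>Supplies two Dirac masses at positive distance. The index type is nonempty, so the point
  with all coordinates 1/2 differs from 0.\<close>

lemma nonconstant_torus: "\<exists>u v :: 'd::finite torus. u \<noteq> v"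
proof (intro exI)
  have "(1 / 2 :: real) \<notin> \<int>" by (auto elim!: Ints_cases simp: field_simps)
  then show "to_torus (\<chi> i. (1 / 2 :: real)) \<noteq> to_torus 0"
    unfolding to_torus_eq_iff by simp
qed

context
  fixes \<gamma> :: real and l :: "'d::finite torus \<Rightarrow> real" and b :: "'d torus \<Rightarrow> real ^ 'd"
  assumes \<gamma>: "\<gamma> > 0" and l_nonneg: "\<And>x. 0 \<le> l x" and l_meas[measurable]: "l \<in> borel_measurable borel"
    and b: "continuous_on UNIV b"
begin

lemma bind_Q_in_prob_algebra:
  "\<mu> \<in> space (prob_algebra borel) \<Longrightarrow> \<mu> \<bind> Q \<gamma> b l \<mu> \<in> space (prob_algebra borel)"
  by (rule prob_algebra_bind[OF _ measurable_Q_const[OF \<gamma> l_nonneg l_meas b]])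

text \<open>\<open>tilt\<close> and \<open>loss\<close> are both integrals of nonnegative functions,
  so one domination bounds both, which is the input of \<open>conditioning_comparison\<close>. The
  inequality turns round: an upper bound on \<mu>' K becomes a lower bound on the update of
  \<mu>.\<close>

lemma bind_Q_comparison:
  assumes \<mu>: "\<mu> \<in> space (prob_algebra borel)" and \<mu>': "\<mu>' \<in> space (prob_algebra borel)"
    and le: "\<And>A. A \<in> sets borel \<Longrightarrow>
      emeasure (\<mu>' \<bind> K \<gamma> b) A \<le> ennreal (1 + \<theta>) * emeasure (\<mu> \<bind> K \<gamma> b) A"
    and f: "f > 0" "\<And>z. f \<le> exp (- \<gamma> * l z)" and \<theta>: "0 < \<theta>" "\<theta> / f < 1 / 2"
    and A[measurable]: "A \<in> sets borel"
  shows "ennreal (1 - 2 * \<theta> / f) * emeasure (\<mu>' \<bind> Q \<gamma> b l \<mu>') A \<le> emeasure (\<mu> \<bind> Q \<gamma> b l \<mu>) A"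
proof -
  define \<nu> \<nu>' where "\<nu> = \<mu> \<bind> K \<gamma> b" and "\<nu>' = \<mu>' \<bind> K \<gamma> b"
  have \<nu>: "\<nu> \<in> space (prob_algebra borel)" "\<nu>' \<in> space (prob_algebra borel)"
    unfolding \<nu>_def \<nu>'_def using \<mu> \<mu>' by (auto intro: prob_algebra_bind[OF _ measurable_K[OF b]])
  have sets: "sets \<nu> = sets borel" "sets \<nu>' = sets borel" and prob: "prob_space \<nu>"
    using \<nu> by (auto simp: space_prob_algebra)
  note props = loss_add_tilt[OF \<gamma> l_nonneg l_meas] emeasure_tilt_pos[OF \<gamma> l_nonneg l_meas]
  have le_int: "(\<integral>\<^sup>+z. g z \<partial>\<nu>') \<le> ennreal (1 + \<theta>) * (\<integral>\<^sup>+z. g z \<partial>\<nu>)" if "g \<in> borel_measurable borel" for g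
    using that le sets unfolding \<nu>_def[symmetric] \<nu>'_def[symmetric]
    by (intro nn_integral_le_scale) (auto cong: measurable_cong_sets)
  have tilt: "emeasure (tilt \<gamma> l \<nu>) A = (\<integral>\<^sup>+z. ennreal (exp (- \<gamma> * l z)) * indicator A z \<partial>\<nu>)"
    "emeasure (tilt \<gamma> l \<nu>') A = (\<integral>\<^sup>+z. ennreal (exp (- \<gamma> * l z)) * indicator A z \<partial>\<nu>')" if "A \<in> sets borel" for A
    using emeasure_tilt[OF \<gamma> l_nonneg l_meas b _ that] sets by auto
  have tilt_fin: "emeasure (tilt \<gamma> l N) A \<noteq> \<top>" and loss_fin: "loss \<gamma> l N \<noteq> \<top>"
    if "N \<in> space (prob_algebra borel)" for N A
  proof -
    have "emeasure (tilt \<gamma> l N) A \<le> emeasure (tilt \<gamma> l N) (space (tilt \<gamma> l N))"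
      by (rule emeasure_space)
    also have "space (tilt \<gamma> l N) = UNIV"
      using that by (auto simp: tilt_def space_prob_algebra dest: sets_eq_imp_space_eq)
    also have "emeasure (tilt \<gamma> l N) UNIV \<le> 1"
      using props(1)[OF that(1)] by (metis add.commute le_iff_add)
    finally show "emeasure (tilt \<gamma> l N) A \<noteq> \<top>" by (auto simp: top_unique)
    have "loss \<gamma> l N \<le> 1" using props(1)[OF that(1)] by (metis le_iff_add)
    then show "loss \<gamma> l N \<noteq> \<top>" by (auto simp: top_unique)
  qed
  define t t' Z Z' p p' where d: "t = enn2real (emeasure (tilt \<gamma> l \<nu>) A)" "t' = enn2real (emeasure (tilt \<gamma> l \<nu>') A)"
    "Z = enn2real (emeasure (tilt \<gamma> l \<nu>) UNIV)" "Z' = enn2real (emeasure (tilt \<gamma> l \<nu>') UNIV)"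
    "p = enn2real (loss \<gamma> l \<nu>)" "p' = enn2real (loss \<gamma> l \<nu>')"
  have e: "emeasure (tilt \<gamma> l \<nu>) A = ennreal t" "emeasure (tilt \<gamma> l \<nu>') A = ennreal t'"
    "emeasure (tilt \<gamma> l \<nu>) UNIV = ennreal Z" "emeasure (tilt \<gamma> l \<nu>') UNIV = ennreal Z'"
    "loss \<gamma> l \<nu> = ennreal p" "loss \<gamma> l \<nu>' = ennreal p'"
    unfolding d using tilt_fin loss_fin \<nu> by (simp_all add: less_top)
  have nonneg: "0 \<le> t" "0 \<le> t'" "0 \<le> Z" "0 \<le> Z'" "0 \<le> p" "0 \<le> p'" by (simp_all add: d)
  have "0 < Z'" using props(2)[OF \<nu>(2)] by (simp add: e)
  have sum: "p + Z = 1" "p' + Z' = 1"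
    using props(1)[OF \<nu>(1)] props(1)[OF \<nu>(2)] nonneg by (simp_all add: e flip: ennreal_plus)
  have "ennreal t' \<le> ennreal (1 + \<theta>) * ennreal t"
    unfolding e[symmetric] tilt[OF A] by (intro le_int) measurable
  then have tle: "t' \<le> (1 + \<theta>) * t"
    using \<theta> nonneg by (subst (asm) ennreal_mult[symmetric]) (auto simp: ennreal_le_iff)
  have "ennreal p' \<le> ennreal (1 + \<theta>) * ennreal p"
    unfolding e[symmetric] loss_def by (intro le_int) measurable
  then have ple: "p' \<le> (1 + \<theta>) * p"
    using \<theta> nonneg by (subst (asm) ennreal_mult[symmetric]) (auto simp: ennreal_le_iff)
  have "ennreal f = (\<integral>\<^sup>+z. ennreal f \<partial>\<nu>)" using prob by (simp add: prob_space.emeasure_space_1)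
  also have "\<dots> \<le> (\<integral>\<^sup>+z. ennreal (exp (- \<gamma> * l z)) \<partial>\<nu>)"
    by (intro nn_integral_mono ennreal_leI f)
  also have "\<dots> = ennreal Z"
    unfolding e[symmetric] by (subst tilt(1)) simp_all
  finally have "f \<le> Z" using nonneg by simp
  have "(1 - 2 * \<theta> / f) * (t' / Z') \<le> t / Z"
    using sum tle ple \<open>f \<le> Z\<close> f(1) \<theta> nonneg by (intro conditioning_comparison[of p Z p' Z']) auto
  then have le_final: "ennreal ((1 - 2 * \<theta> / f) * (t' / Z')) \<le> ennreal (t / Z)" by (rule ennreal_leI)
  have "0 \<le> 1 - 2 * \<theta> / f"
    using \<theta>(2) unfolding times_divide_eq_right[symmetric] by linarith
  then have "ennreal ((1 - 2 * \<theta> / f) * (t' / Z')) = ennreal (1 - 2 * \<theta> / f) * ennreal (t' / Z')"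
    using nonneg by (intro ennreal_mult divide_nonneg_nonneg)
  moreover have "ennreal t' / ennreal Z' = ennreal (t' / Z')"
    using nonneg \<open>0 < Z'\<close> by (intro divide_ennreal)
  moreover have "ennreal t / ennreal Z = ennreal (t / Z)"
    using nonneg \<open>f \<le> Z\<close> f(1) by (intro divide_ennreal) auto
  ultimately have "ennreal (1 - 2 * \<theta> / f) * (ennreal t' / ennreal Z') \<le> ennreal t / ennreal Z"
    using le_final by simp
  then show ?thesis
    unfolding emeasure_bind_Q[OF \<gamma> l_nonneg l_meas b \<mu> A] emeasure_bind_Q[OF \<gamma> l_nonneg l_meas b \<mu>' A]
      \<nu>_def[symmetric] \<nu>'_def[symmetric] e .
qed

text \<open>The three errors have separate origins: the factor 1 + \<epsilon> is the rounding of the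
  weights, 2 \<epsilon> the motion of both coordinates inside a cell, and \<epsilon>/a the product
  of residuals at maximal cost.\<close>

lemma wasserstein_bind_Q_approx:
  assumes a: "a > 0" and l_bound: "\<And>z. l z \<le> B" and c: "c \<ge> 0"
    and contraction: "\<And>N x y. N \<ge> 1 \<Longrightarrow> x \<in> space (config_space N) \<Longrightarrow> y \<in> space (config_space N) \<Longrightarrow>
      wasserstein (config_space N) (rhoN a N) (R N \<gamma> b l x) (R N \<gamma> b l y) \<le> c * rhoN a N x y"
    and \<mu>: "\<mu> \<in> space (prob_algebra borel)" and \<nu>: "\<nu> \<in> space (prob_algebra borel)"
    and P: "P \<in> couplings borel \<mu> \<nu>" and \<epsilon>: "0 < \<epsilon>" "\<epsilon> < 1"
  shows "wasserstein borel (rho a) (\<mu> \<bind> Q \<gamma> b l \<mu>) (\<nu> \<bind> Q \<gamma> b l \<nu>)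
    \<le> c * ((1 + \<epsilon>) * ((\<integral>z. rho a (fst z) (snd z) \<partial>P) + 2 * \<epsilon>)) + \<epsilon> * (1 / a)"
proof -
  \<comment> \<open>A lower bound on the survival probability, uniform over the torus.\<close>
  define f where "f = exp (- \<gamma> * B)"
  have f: "f > 0" "f \<le> exp (- \<gamma> * l z)" for z
    using \<gamma> l_bound[of z] by (auto simp: f_def)
  have "exp (- \<gamma> * l undefined) \<le> 1" using \<gamma> l_nonneg[of undefined] by simp
  then have f1: "f \<le> 1" using f(2)[of undefined] by linarith
  \<comment> \<open>The domination of kernels will hold with the factor (1 + \<theta>)^2 <= 1 + 3
    \<theta>, one factor from Harnack and one from the rounding. Conditioning then loses 2 (3
    \<theta>)/f, which is 6 \<epsilon>/7, and requires 3 \<theta>/f = 3 \<epsilon>/7 to be below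
    1/2.\<close>
  define \<theta> where "\<theta> = \<epsilon> * f / 7"
  have \<theta>: "0 < \<theta>" "\<theta> \<le> \<epsilon>" "\<theta> < 1" "(1 + \<theta>) * (1 + \<theta>) \<le> 1 + 3 * \<theta>" "2 * (3 * \<theta>) / f \<le> \<epsilon>" "3 * \<theta> / f < 1 / 2"
  proof -
    show pos: "0 < \<theta>" using \<epsilon> f by (simp add: \<theta>_def)
    have "\<epsilon> * f \<le> \<epsilon> * 1" using \<epsilon> f1 by (intro mult_left_mono) auto
    then show "\<theta> \<le> \<epsilon>" using \<epsilon> by (simp add: \<theta>_def)
    then show lt1: "\<theta> < 1" using \<epsilon> by simp
    have "\<theta> * \<theta> \<le> \<theta> * 1" using pos lt1 by (intro mult_left_mono) auto
    then show "(1 + \<theta>) * (1 + \<theta>) \<le> 1 + 3 * \<theta>" by (simp add: algebra_simps)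
    show "2 * (3 * \<theta>) / f \<le> \<epsilon>" "3 * \<theta> / f < 1 / 2" using f(1) \<epsilon> by (simp_all add: \<theta>_def)
  qed
  obtain \<delta> where \<delta>: "\<delta> > 0" and harnack: "\<And>x x' A. dist x' x < \<delta> \<Longrightarrow> A \<in> sets borel \<Longrightarrow>
      emeasure (K \<gamma> b x') A \<le> ennreal (1 + \<theta>) * emeasure (K \<gamma> b x) A"
    using K_harnack[OF b \<gamma> \<theta>(1)] by blast
  \<comment> \<open>The cells must be finer than \<delta> for the Harnack inequality and finer than
    \<epsilon> for the change of the cost.\<close>
  have min_pos: "0 < min \<delta> \<epsilon>" using \<delta> \<epsilon> by simp
  obtain J :: "'d torus set set" and \<phi> :: "'d torus \<Rightarrow> 'd torus set" where J: "finite J" and \<phi>[measurable]: "\<phi> \<in> borel \<rightarrow>\<^sub>M count_space J"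
    and \<phi>_dist: "\<And>u v. \<phi> u = \<phi> v \<Longrightarrow> dist u v < min \<delta> \<epsilon>"
    by (rule compact_small_cells[OF compact_UNIV_torus min_pos], rule that)
  note cP = couplingsD[OF P]
  interpret prob_space P by (rule cP)
  have fst_m: "fst \<in> P \<rightarrow>\<^sub>M borel" and snd_m: "snd \<in> P \<rightarrow>\<^sub>M borel"
    by (simp_all cong: measurable_cong_sets add: cP(2))
  have \<phi>2: "(\<lambda>z. (\<phi> (fst z), \<phi> (snd z))) \<in> P \<rightarrow>\<^sub>M count_space (J \<times> J)"
  proof -
    have "(\<lambda>z. (\<phi> (fst z), \<phi> (snd z))) \<in> P \<rightarrow>\<^sub>M count_space J \<Otimes>\<^sub>M count_space J"
      by (intro measurable_Pair measurable_compose[OF fst_m \<phi>] measurable_compose[OF snd_m \<phi>])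
    then show ?thesis using J by (simp add: pair_measure_count_space)
  qed
  \<comment> \<open>The coupling itself is quantized, on products of cells, so that the points come
    in pairs whose transport cost stays controlled.\<close>
  have fin: "finite (J \<times> J)" using J by simp
  obtain N and z :: "nat \<Rightarrow> 'd torus \<times> 'd torus" where N: "N \<ge> 1" and quant_all:
    "\<forall>h g :: 'd torus \<times> 'd torus \<Rightarrow> ennreal. g \<in> borel_measurable P \<longrightarrow>
      (\<forall>u\<in>space P. \<forall>v\<in>space P. (\<phi> (fst u), \<phi> (snd u)) = (\<phi> (fst v), \<phi> (snd v)) \<longrightarrow> h u \<le> g v) \<longrightarrow>
      ennreal (1 / real N) * (\<Sum>i<N. h (z i)) \<le> ennreal (1 + \<theta>) * (\<integral>\<^sup>+v. g v \<partial>P)"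
    by (rule finite_quantization[OF prob_space_axioms fin \<phi>2 \<theta>(1)], rule that)
  have quant: "ennreal (1 / real N) * (\<Sum>i<N. h (z i)) \<le> ennreal (1 + \<theta>) * (\<integral>\<^sup>+v. g v \<partial>P)"
    if "g \<in> borel_measurable P"
      "\<And>u v. (\<phi> (fst u), \<phi> (snd u)) = (\<phi> (fst v), \<phi> (snd v)) \<Longrightarrow> h u \<le> g v" for h g
    using quant_all that by blast
  define x where "x = restrict (\<lambda>i. fst (z i)) {..<N}"
  define y where "y = restrict (\<lambda>i. snd (z i)) {..<N}"
  have xy: "x \<in> space (config_space N)" "y \<in> space (config_space N)"
    by (auto simp: x_def y_def space_PiM)
  have K: "K \<gamma> b \<in> borel \<rightarrow>\<^sub>M prob_algebra borel" by (rule measurable_K[OF b])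
  \<comment> \<open>\<sigma> is either marginal of P, and \<open>p\<close> the projection that
    produces it.\<close>
  have compare: "ennreal (1 - \<epsilon>) * emeasure (empirical N w \<bind> Q \<gamma> b l (empirical N w)) A
      \<le> emeasure (\<sigma> \<bind> Q \<gamma> b l \<sigma>) A"
    if \<sigma>: "\<sigma> \<in> space (prob_algebra borel)" and p: "p \<in> P \<rightarrow>\<^sub>M borel" "distr P borel p = \<sigma>"
      and pd: "\<And>u v. \<phi> (fst u) = \<phi> (fst v) \<Longrightarrow> \<phi> (snd u) = \<phi> (snd v) \<Longrightarrow> \<phi> (p u) = \<phi> (p v)"
      and w: "\<And>i. i < N \<Longrightarrow> w i = p (z i)" and A: "A \<in> sets borel" for \<sigma> p w A
  proof -
    note emp = empirical_in_prob_algebra[OF N, of w]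
    have "emeasure (empirical N w \<bind> K \<gamma> b) A \<le> ennreal (1 + 3 * \<theta>) * emeasure (\<sigma> \<bind> K \<gamma> b) A"
      if A: "A \<in> sets borel" for A
    proof -
      have KA: "(\<lambda>u. emeasure (K \<gamma> b u) A) \<in> borel_measurable borel"
        by (rule measurable_emeasure_kernel[OF measurable_prob_algebraD[OF K] A])
      have KA_\<sigma>: "(\<lambda>u. emeasure (K \<gamma> b u) A) \<in> borel_measurable \<sigma>"
        using KA \<sigma> by (auto simp: space_prob_algebra cong: measurable_cong_sets)
      have "emeasure (empirical N w \<bind> K \<gamma> b) A = ennreal (1 / real N) * (\<Sum>i<N. emeasure (K \<gamma> b (p (z i))) A)"
        using w by (simp add: emeasure_bind_prob_algebra[OF emp K A] nn_integral_empirical[OF KA])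
      \<comment> \<open>Here h is the kernel started at the representative and g the enlarged kernel
        started at any point of the same cell; Harnack supplies h <= g.\<close>
      also have "\<dots> \<le> ennreal (1 + \<theta>) * (\<integral>\<^sup>+v. ennreal (1 + \<theta>) * emeasure (K \<gamma> b (p v)) A \<partial>P)"
      proof (rule quant)
        show "(\<lambda>v. ennreal (1 + \<theta>) * emeasure (K \<gamma> b (p v)) A) \<in> borel_measurable P"
          by (intro borel_measurable_times_ennreal measurable_compose[OF p(1) KA] measurable_const) simp
        fix u v assume "(\<phi> (fst u), \<phi> (snd u)) = (\<phi> (fst v), \<phi> (snd v))"
        then have "dist (p u) (p v) < \<delta>" using \<phi>_dist[OF pd] by simp
        then show "emeasure (K \<gamma> b (p u)) A \<le> ennreal (1 + \<theta>) * emeasure (K \<gamma> b (p v)) A"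
          by (rule harnack[OF _ A])
      qed
      also have "(\<integral>\<^sup>+v. ennreal (1 + \<theta>) * emeasure (K \<gamma> b (p v)) A \<partial>P)
          = ennreal (1 + \<theta>) * emeasure (\<sigma> \<bind> K \<gamma> b) A"
        using nn_integral_distr[OF p(1), of "\<lambda>u. emeasure (K \<gamma> b u) A", unfolded p(2), OF KA_\<sigma>]
          measurable_compose[OF p(1) KA]
        by (simp add: nn_integral_cmult emeasure_bind_prob_algebra[OF \<sigma> K A])
      also have "ennreal (1 + \<theta>) * (ennreal (1 + \<theta>) * emeasure (\<sigma> \<bind> K \<gamma> b) A)
          = ennreal ((1 + \<theta>) * (1 + \<theta>)) * emeasure (\<sigma> \<bind> K \<gamma> b) A"
        using \<theta> by (simp add: ennreal_mult mult.assoc)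
      also have "\<dots> \<le> ennreal (1 + 3 * \<theta>) * emeasure (\<sigma> \<bind> K \<gamma> b) A"
        using \<theta> by (intro mult_right_mono ennreal_leI) auto
      finally show ?thesis .
    qed
    then have "ennreal (1 - 2 * (3 * \<theta>) / f) * emeasure (empirical N w \<bind> Q \<gamma> b l (empirical N w)) A
        \<le> emeasure (\<sigma> \<bind> Q \<gamma> b l \<sigma>) A"
      using \<theta> f by (intro bind_Q_comparison[OF \<sigma> emp _ _ _ _ _ A]) auto
    moreover have "ennreal (1 - \<epsilon>) \<le> ennreal (1 - 2 * (3 * \<theta>) / f)"
      using \<theta> by (intro ennreal_leI) auto
    ultimately show ?thesis by (meson mult_right_mono order_trans zero_le)
  qed
  let ?c = "\<integral>z. rho a (fst z) (snd z) \<partial>P"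
  have cost: "rhoN a N x y / N \<le> (1 + \<epsilon>) * (?c + 2 * \<epsilon>)"
  proof -
    have c_nonneg: "0 \<le> ?c" using a by (simp add: rho_nonneg)
    have rho_m: "(\<lambda>z. rho a (fst z) (snd z)) \<in> borel_measurable P"
      using measurable_rho by (simp cong: measurable_cong_sets add: cP(2))
    have "ennreal (rhoN a N x y / N) = ennreal (1 / real N) * ennreal (\<Sum>i<N. rho a (fst (z i)) (snd (z i)))"
      using a by (simp add: rhoN_def x_def y_def ennreal_mult[symmetric] sum_nonneg rho_nonneg)
    also have "\<dots> = ennreal (1 / real N) * (\<Sum>i<N. ennreal (rho a (fst (z i)) (snd (z i))))"
      using a by (simp add: rho_nonneg)
    also have "\<dots> \<le> ennreal (1 + \<theta>) * (\<integral>\<^sup>+v. ennreal (rho a (fst v) (snd v) + 2 * \<epsilon>) \<partial>P)"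
    proof (rule quant)
      show "(\<lambda>v. ennreal (rho a (fst v) (snd v) + 2 * \<epsilon>)) \<in> borel_measurable P"
        using rho_m by measurable
      fix u v :: "'d torus \<times> 'd torus" assume "(\<phi> (fst u), \<phi> (snd u)) = (\<phi> (fst v), \<phi> (snd v))"
      then have "dist (fst u) (fst v) + dist (snd u) (snd v) \<le> 2 * \<epsilon>"
        using \<phi>_dist[of "fst u" "fst v"] \<phi>_dist[of "snd u" "snd v"] by simp
      then show "ennreal (rho a (fst u) (snd u)) \<le> ennreal (rho a (fst v) (snd v) + 2 * \<epsilon>)"
        using rho_perturb[OF a, of "fst u" "snd u" "fst v" "snd v"] by (intro ennreal_leI) linarith
    qed
    also have "(\<integral>\<^sup>+v. ennreal (rho a (fst v) (snd v) + 2 * \<epsilon>) \<partial>P) = ennreal (?c + 2 * \<epsilon>)"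
    proof -
      have "(\<integral>\<^sup>+v. ennreal (rho a (fst v) (snd v) + 2 * \<epsilon>) \<partial>P)
        = (\<integral>\<^sup>+v. ennreal (rho a (fst v) (snd v)) + ennreal (2 * \<epsilon>) \<partial>P)"
        using a \<epsilon> by (intro nn_integral_cong ennreal_plus) (simp_all add: rho_nonneg)
      also have "\<dots> = (\<integral>\<^sup>+v. ennreal (rho a (fst v) (snd v)) \<partial>P) + ennreal (2 * \<epsilon>)"
        using rho_m by (subst nn_integral_add) (auto simp: emeasure_space_1)
      also have "\<dots> = ennreal (?c + 2 * \<epsilon>)"
        using c_nonneg \<epsilon> coupling_cost[OF P measurable_rho rho_nonneg[OF a] rho_le[OF a]]
        by (simp add: ennreal_plus)
      finally show ?thesis .
    qed
    also have "ennreal (1 + \<theta>) * ennreal (?c + 2 * \<epsilon>) = ennreal ((1 + \<theta>) * (?c + 2 * \<epsilon>))"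
      using \<theta> \<epsilon> c_nonneg by (simp add: ennreal_mult)
    finally have "rhoN a N x y / N \<le> (1 + \<theta>) * (?c + 2 * \<epsilon>)"
      using \<theta> \<epsilon> c_nonneg by (subst (asm) ennreal_le_iff) auto
    also have "\<dots> \<le> (1 + \<epsilon>) * (?c + 2 * \<epsilon>)"
      using \<theta> \<epsilon> c_nonneg by (intro mult_right_mono) auto
    finally show ?thesis .
  qed
  let ?S = "\<lambda>\<sigma>. \<sigma> \<bind> Q \<gamma> b l \<sigma>"
  have S_emp: "?S (empirical N w) \<in> space (prob_algebra borel)" for w :: "nat \<Rightarrow> 'd torus"
    by (rule bind_Q_in_prob_algebra[OF empirical_in_prob_algebra[OF N]])
  have "wasserstein borel (rho a) (?S \<mu>) (?S \<nu>)
      \<le> (1 - \<epsilon>) * wasserstein borel (rho a) (?S (empirical N x)) (?S (empirical N y)) + \<epsilon> * (1 / a)"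
  proof (rule wasserstein_mixture[OF _ S_emp _ S_emp \<epsilon> _ _ measurable_rho rho_nonneg[OF a] rho_le[OF a]])
    show "ennreal (1 - \<epsilon>) * emeasure (?S (empirical N x)) A \<le> emeasure (?S \<mu>) A" if "A \<in> sets borel" for A
      using that by (intro compare[OF \<mu> fst_m cP(3)]) (auto simp: x_def)
    show "ennreal (1 - \<epsilon>) * emeasure (?S (empirical N y)) A \<le> emeasure (?S \<nu>) A" if "A \<in> sets borel" for A
      using that by (intro compare[OF \<nu> snd_m cP(4)]) (auto simp: y_def)
  qed (use \<mu> \<nu> in \<open>auto intro: bind_Q_in_prob_algebra\<close>)
  also have "(1 - \<epsilon>) * wasserstein borel (rho a) (?S (empirical N x)) (?S (empirical N y))
      \<le> 1 * wasserstein borel (rho a) (?S (empirical N x)) (?S (empirical N y))"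
    using \<epsilon> a by (intro mult_right_mono wasserstein_nonneg S_emp rho_nonneg) auto
  also have "wasserstein borel (rho a) (?S (empirical N x)) (?S (empirical N y))
      \<le> wasserstein (config_space N) (rhoN a N) (R N \<gamma> b l x) (R N \<gamma> b l y) / N"
    by (rule wasserstein_empirical_le[OF \<gamma> l_nonneg l_meas b N a xy])
  also have "\<dots> \<le> c * rhoN a N x y / N"
    by (intro divide_right_mono contraction N xy) simp
  also have "\<dots> \<le> c * ((1 + \<epsilon>) * (?c + 2 * \<epsilon>))"
    using mult_left_mono[OF cost c] by simp
  finally show ?thesis by simp
qed

text \<open>The number of particles depends on \<epsilon>, but the approximate bound does not
  mention it, so \<epsilon> can tend to 0 with the coupling fixed; only then is the infimum taken.
  The case c = 0 is separate because the last passage divides by c.\<close>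

lemma wasserstein_bind_Q_le:
  assumes a: "a > 0" and l_bound: "\<And>z. l z \<le> B" and c: "c \<ge> 0"
    and contraction: "\<And>N x y. N \<ge> 1 \<Longrightarrow> x \<in> space (config_space N) \<Longrightarrow> y \<in> space (config_space N) \<Longrightarrow>
      wasserstein (config_space N) (rhoN a N) (R N \<gamma> b l x) (R N \<gamma> b l y) \<le> c * rhoN a N x y"
    and \<mu>: "\<mu> \<in> space (prob_algebra borel)" and \<nu>: "\<nu> \<in> space (prob_algebra borel)"
  shows "wasserstein borel (rho a) (\<mu> \<bind> Q \<gamma> b l \<mu>) (\<nu> \<bind> Q \<gamma> b l \<nu>) \<le> c * wasserstein borel (rho a) \<mu> \<nu>"
proof -
  let ?W = "wasserstein borel (rho a) (\<mu> \<bind> Q \<gamma> b l \<mu>) (\<nu> \<bind> Q \<gamma> b l \<nu>)"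
  have le: "?W \<le> c * (\<integral>z. rho a (fst z) (snd z) \<partial>P)" if P: "P \<in> couplings borel \<mu> \<nu>" for P
  proof (rule tendsto_lowerbound)
    let ?c = "\<integral>z. rho a (fst z) (snd z) \<partial>P"
    have "((\<lambda>\<epsilon>. c * ((1 + \<epsilon>) * (?c + 2 * \<epsilon>)) + \<epsilon> * (1 / a)) \<longlongrightarrow>
        c * ((1 + 0) * (?c + 2 * 0)) + 0 * (1 / a)) (at_right 0)"
      by (intro tendsto_intros)
    then show "((\<lambda>\<epsilon>. c * ((1 + \<epsilon>) * (?c + 2 * \<epsilon>)) + \<epsilon> * (1 / a)) \<longlongrightarrow> c * ?c) (at_right 0)" by simp
    have "eventually (\<lambda>\<epsilon>::real. \<epsilon> \<in> {0<..<1}) (at_right 0)"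
      by (rule eventually_at_right_real) simp
    then show "\<forall>\<^sub>F \<epsilon> in at_right 0. ?W \<le> c * ((1 + \<epsilon>) * (?c + 2 * \<epsilon>)) + \<epsilon> * (1 / a)"
      by eventually_elim (rule wasserstein_bind_Q_approx[OF a l_bound c contraction \<mu> \<nu> P], auto)
  qed simp
  show ?thesis
  proof (cases "c = 0")
    case True
    then show ?thesis using le[OF pair_measure_in_couplings[OF \<mu> \<nu>]] by simp
  next
    case False
    then have "?W / c \<le> wasserstein borel (rho a) \<mu> \<nu>"
      using c le by (intro wasserstein_greatest[OF \<mu> \<nu>]) (simp add: divide_le_eq mult.commute)
    then show ?thesis using c False by (simp add: divide_le_eq mult.commute)
  qed
qed

end

lemma singleton_config_sets:
  "x \<in> space (config_space N) \<Longrightarrow> {x :: nat \<Rightarrow> 'd::finite torus} \<in> sets (config_space N)"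
proof -
  assume "x \<in> space (config_space N)"
  then have "{x} = (\<Pi>\<^sub>E i\<in>{..<N}. {x i})"
    by (intro PiE_singleton[symmetric]) (auto simp: space_PiM PiE_def)
  then show ?thesis by (simp add: sets_PiM_I_finite)
qed

theorem corollary12:
  fixes b :: "'d::finite torus \<Rightarrow> real ^ 'd"
    and lam :: "'d torus \<Rightarrow> real"
    and L c1 c2 a \<gamma>\<^sub>0 :: real
    and \<eta>\<^sub>0 \<eta>'\<^sub>0 :: "'d torus measure"
  assumes "C1_torus b"
    and "c1 > 0" and "a > 0" and "\<gamma>\<^sub>0 > 0" and "c2 > 0"
    and K_contraction:
      "\<And>\<gamma> \<mu> \<nu>. 0 < \<gamma> \<Longrightarrow> \<gamma> \<le> \<gamma>\<^sub>0 \<Longrightarrow>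
         \<mu> \<in> space (prob_algebra borel) \<Longrightarrow> \<nu> \<in> space (prob_algebra borel) \<Longrightarrow>
         wasserstein borel (rho a) (\<mu> \<bind> K \<gamma> b) (\<nu> \<bind> K \<gamma> b)
           \<le> (1 - c1 * \<gamma>) * wasserstein borel (rho a) \<mu> \<nu>"
    and R_contraction:
      "\<And>l L' \<gamma> N \<mu> \<nu>. (\<And>x. 0 \<le> l x) \<Longrightarrow> L'-lipschitz_on UNIV l \<Longrightarrow>
         0 < \<gamma> \<Longrightarrow> \<gamma> \<le> \<gamma>\<^sub>0 \<Longrightarrow> 1 \<le> N \<Longrightarrow>
         \<mu> \<in> space (prob_algebra (config_space N)) \<Longrightarrow>
         \<nu> \<in> space (prob_algebra (config_space N)) \<Longrightarrow>
         wasserstein (config_space N) (rhoN a N) (\<mu> \<bind> R N \<gamma> b l) (\<nu> \<bind> R N \<gamma> b l)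
           \<le> (1 - \<gamma> * kappa c1 c2 L' l \<gamma>) * wasserstein (config_space N) (rhoN a N) \<mu> \<nu>"
    and "\<And>x. 0 \<le> lam x" and "L-lipschitz_on UNIV lam"
    and "\<eta>\<^sub>0 \<in> space (prob_algebra borel)" and "\<eta>'\<^sub>0 \<in> space (prob_algebra borel)"
  shows "\<forall>m. \<forall>\<gamma>\<in>{0<..\<gamma>\<^sub>0}.
    wasserstein borel (rho a) (nonlinear_flow \<gamma> b lam \<eta>\<^sub>0 m) (nonlinear_flow \<gamma> b lam \<eta>'\<^sub>0 m)
      \<le> (1 - \<gamma> * kappa c1 c2 L lam \<gamma>) ^ m * wasserstein borel (rho a) \<eta>\<^sub>0 \<eta>'\<^sub>0"
proof (intro allI ballI)
  fix m \<gamma> assume "\<gamma> \<in> {0<..\<gamma>\<^sub>0}"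
  then have \<gamma>: "0 < \<gamma>" "\<gamma> \<le> \<gamma>\<^sub>0" by auto
  have a: "a > 0" and lam_nonneg: "\<And>x. 0 \<le> lam x" by fact+
  define c where "c = 1 - \<gamma> * kappa c1 c2 L lam \<gamma>"
  have b: "continuous_on UNIV b" by (rule C1_torus_continuous) fact
  have lam_meas: "lam \<in> borel_measurable borel"
    by (intro borel_measurable_continuous_onI lipschitz_on_continuous_on) fact
  obtain B where B: "\<And>x. lam x \<le> B"
    using bounded_lipschitz_torus[OF \<open>L-lipschitz_on UNIV lam\<close>] by blast
  have return_in: "return (config_space N) x \<in> space (prob_algebra (config_space N))"
    if "x \<in> space (config_space N)" for N and x :: "nat \<Rightarrow> 'd torus"
    using that by (simp add: space_prob_algebra prob_space_return)
  have R_in: "R N \<gamma> b lam x \<in> space (prob_algebra (config_space N))"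
    if "N \<ge> 1" "x \<in> space (config_space N)" for N x
    using measurable_space[OF measurable_R[OF \<gamma>(1) lam_nonneg lam_meas b that(1)] that(2)] .
  have R_le: "wasserstein (config_space N) (rhoN a N) (R N \<gamma> b lam x) (R N \<gamma> b lam y)
      \<le> c * wasserstein (config_space N) (rhoN a N) (return (config_space N) x) (return (config_space N) y)"
    if N: "N \<ge> 1" and xy: "x \<in> space (config_space N)" "y \<in> space (config_space N)" for N x y
  proof -
    have "return (config_space N) u \<bind> R N \<gamma> b lam = R N \<gamma> b lam u" if "u \<in> space (config_space N)" for u
      using that by (intro bind_return[OF measurable_prob_algebraD[OF measurable_R[OF \<gamma>(1) lam_nonneg lam_meas b N]]])
    then show ?thesis
      using R_contraction[of lam L \<gamma> N "return (config_space N) x" "return (config_space N) y",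
          OF lam_nonneg \<open>L-lipschitz_on UNIV lam\<close> \<gamma> N return_in return_in] xy
      by (simp add: c_def)
  qed
  \<comment> \<open>No sign of 1 - \<gamma> kappa is assumed, yet the induction multiplies an
    inequality by it. One particle started at two different points decides the matter: the left side
    of the contraction is nonnegative, and the distance on the right is positive.\<close>
  have c: "c \<ge> 0"
  proof -
    obtain u v :: "'d torus" where uv: "u \<noteq> v" using nonconstant_torus by blast
    define x y where "x = restrict (\<lambda>_. u) {..<1 :: nat}" and "y = restrict (\<lambda>_. v) {..<1 :: nat}"
    have xy: "x \<in> space (config_space 1)" "y \<in> space (config_space 1)"
      by (auto simp: x_def y_def space_PiM)
    have "0 < rhoN a 1 x y" using rho_pos[OF a uv] by (simp add: rhoN_def x_def y_def)
    also have "\<dots> \<le> wasserstein (config_space 1) (rhoN a 1) (return (config_space 1) x) (return (config_space 1) y)"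
      using xy by (intro wasserstein_return_ge singleton_config_sets measurable_rhoN)
    finally have "0 < wasserstein (config_space 1) (rhoN a 1) (return (config_space 1) x) (return (config_space 1) y)" .
    moreover have "0 \<le> wasserstein (config_space 1) (rhoN a 1) (R 1 \<gamma> b lam x) (R 1 \<gamma> b lam y)"
      using xy by (intro wasserstein_nonneg R_in rhoN_nonneg[OF a]) auto
    ultimately show "c \<ge> 0" using R_le[of 1 x y] xy by (auto simp: zero_le_mult_iff dest: order_trans)
  qed
  have R_le_cost: "wasserstein (config_space N) (rhoN a N) (R N \<gamma> b lam x) (R N \<gamma> b lam y) \<le> c * rhoN a N x y"
    if N: "N \<ge> 1" and xy: "x \<in> space (config_space N)" "y \<in> space (config_space N)" for N x y
    using R_le[OF that] mult_left_mono[OF wasserstein_return_le[OF xy measurable_rhoN rhoN_nonneg[OF a]] c]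
    by (rule order_trans)
  have flow_in: "nonlinear_flow \<gamma> b lam \<eta> n \<in> space (prob_algebra borel)"
    if "\<eta> \<in> space (prob_algebra borel)" for \<eta> n
    by (induction n) (simp_all add: that bind_Q_in_prob_algebra[OF \<gamma>(1) lam_nonneg lam_meas b])
  show "wasserstein borel (rho a) (nonlinear_flow \<gamma> b lam \<eta>\<^sub>0 m) (nonlinear_flow \<gamma> b lam \<eta>'\<^sub>0 m)
      \<le> (1 - \<gamma> * kappa c1 c2 L lam \<gamma>) ^ m * wasserstein borel (rho a) \<eta>\<^sub>0 \<eta>'\<^sub>0"
    unfolding c_def[symmetric]
  proof (induction m)
    case (Suc m)
    have "wasserstein borel (rho a) (nonlinear_flow \<gamma> b lam \<eta>\<^sub>0 (Suc m)) (nonlinear_flow \<gamma> b lam \<eta>'\<^sub>0 (Suc m))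
      \<le> c * wasserstein borel (rho a) (nonlinear_flow \<gamma> b lam \<eta>\<^sub>0 m) (nonlinear_flow \<gamma> b lam \<eta>'\<^sub>0 m)"
      unfolding nonlinear_flow.simps
      by (rule wasserstein_bind_Q_le[OF \<gamma>(1) lam_nonneg lam_meas b a B c R_le_cost])
        (auto intro!: flow_in assms)
    also have "\<dots> \<le> c * (c ^ m * wasserstein borel (rho a) \<eta>\<^sub>0 \<eta>'\<^sub>0)"
      by (rule mult_left_mono[OF Suc c])
    finally show ?case by (simp add: mult.assoc)
  qed simp
qed

end
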